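(* Let $k$ be a positive integer and let $G$ be a graph that is $(3k-3)$-edge-connected or $(2k-2)$-tree-connected. Suppose there exists a set $Z\subseteq V(G)$ such that, with $m = [|E(G)|-\sum_{v\in Z}d_G(v)]_k$, we have $m> 0$ and $\sum_{v\in Z}[d_G(v)]_k+\sum_{v\in V(G)\setminus Z}[k-d_G(v)]_k= k-2m$. Define $f(v)=\lfloor d_G(v)/k \rfloor$ for $v\in Z$ and $f(v)=\lceil d_G(v)/k\rceil$ for $v\in V(G)\setminus Z$. Then $G$ can be edge-decomposed into $k$ almost $f$-factors $G_1,\ldots, G_k$. More precisely, for a nonnegative-integer-valued function $s$ on $V(G)$, $G$ can be edge-decomposed into $k$ factors $G_1,\ldots, G_k$, each of which is an almost $f$-factor, such that for every vertex $v$ exactly $s(v)$ of them are $v$-almost $f$-factors, if and only if the following hold: for each $v\in Z$, $s(v)-[d_G(v)]_k$ is a nonnegative even integer; for each $v\in V(G)\setminus Z$, $s(v)-[k-d_G(v)]_k$ is a nonnegative even integer; and $\sum_{v\in V(G)}s(v)=k$.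
   Context: Graphs may have loops and multiple edges; $d_G(v)$ is the degree of $v$ in $G$ (a loop counts twice). For an integer $x$, $[x]_k$ is the unique integer in $\{0,\ldots,k-1\}$ congruent to $x$ modulo $k$. A factor of $G$ is a spanning subgraph of $G$; $G$ is edge-decomposed into factors if their edge sets partition $E(G)$. A factor $F$ is a $u$-almost $f$-factor if $d_F(v)=f(v)$ for all vertices $v\neq u$ and $d_F(u)\in\{f(u)-1,f(u)+1\}$; it is an almost $f$-factor if it is a $u$-almost $f$-factor for some vertex $u$. For a vertex set $A$, $d_G(A)$ is the number of edges of $G$ with exactly one end in $A$; $G$ is $\lambda$-edge-connected if $d_G(A)\ge\lambda$ for every nonempty proper subset $A$ of $V(G)$. A graph is $m$-tree-connected if it contains $m$ edge-disjoint spanning trees. *)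

theory Defs
  imports Complex_Main "HOL-Library.Multiset" "HOL-Library.Disjoint_Sets"
begin

text \<open>Each edge is mapped to the multiset of its two ends, so that a loop at a vertex \<open>v\<close> has
  ends \<open>{#v, v#}\<close> and distinct edges may have the same ends.\<close>

record ('v, 'e) mgraph =
  verts :: "'v set"
  edges :: "'e set"
  ends :: "'e \<Rightarrow> 'v multiset"

definition multigraph :: "('v, 'e) mgraph \<Rightarrow> bool" where
  "multigraph G \<longleftrightarrow> finite (verts G) \<and> verts G \<noteq> {} \<and> finite (edges G) \<and>
     (\<forall>e\<in>edges G. size (ends G e) = 2 \<and> set_mset (ends G e) \<subseteq> verts G)"

definition degree :: "('v, 'e) mgraph \<Rightarrow> 'v \<Rightarrow> nat" where
  "degree G v = (\<Sum>e\<in>edges G. count (ends G e) v)"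

definition cut_size :: "('v, 'e) mgraph \<Rightarrow> 'v set \<Rightarrow> nat" where
  "cut_size G A = card {e \<in> edges G. size {#x \<in># ends G e. x \<in> A#} = 1}"

definition edge_connected :: "nat \<Rightarrow> ('v, 'e) mgraph \<Rightarrow> bool" where
  "edge_connected l G \<longleftrightarrow> (\<forall>A. A \<noteq> {} \<and> A \<subset> verts G \<longrightarrow> l \<le> cut_size G A)"

text \<open>Only the ends of edges of the factor are constrained; the value of \<open>ends\<close> outside
  \<open>edges\<close> carries no meaning.\<close>

definition factor :: "('v, 'e) mgraph \<Rightarrow> ('v, 'e) mgraph \<Rightarrow> bool" where
  "factor F G \<longleftrightarrow> verts F = verts G \<and> edges F \<subseteq> edges G \<and> (\<forall>e\<in>edges F. ends F e = ends G e)"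

definition connected_graph :: "('v, 'e) mgraph \<Rightarrow> bool" where
  "connected_graph G \<longleftrightarrow> verts G \<noteq> {} \<and>
     (\<forall>u\<in>verts G. \<forall>v\<in>verts G. (u, v) \<in> {(x, y). \<exists>e\<in>edges G. ends G e = {#x, y#}}\<^sup>*)"

text \<open>A cycle visits the distinct vertices \<open>vs\<close> along the distinct edges \<open>es\<close>. A loop is a
  cycle of length 1, and two parallel edges form a cycle of length 2.\<close>

definition cycle :: "('v, 'e) mgraph \<Rightarrow> 'v list \<Rightarrow> 'e list \<Rightarrow> bool" where
  "cycle G vs es \<longleftrightarrow> es \<noteq> [] \<and> length vs = length es \<and> distinct vs \<and> distinct es \<and>
     set vs \<subseteq> verts G \<and> set es \<subseteq> edges G \<and>
     (\<forall>i<length es. ends G (es ! i) = {#vs ! i, vs ! (Suc i mod length es)#})"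

definition tree :: "('v, 'e) mgraph \<Rightarrow> bool" where
  "tree T \<longleftrightarrow> connected_graph T \<and> \<not> (\<exists>vs es. cycle T vs es)"

definition tree_connected :: "nat \<Rightarrow> ('v, 'e) mgraph \<Rightarrow> bool" where
  "tree_connected m G \<longleftrightarrow> (\<exists>T :: nat \<Rightarrow> ('v, 'e) mgraph.
     (\<forall>i<m. factor (T i) G \<and> tree (T i)) \<and> disjoint_family_on (\<lambda>i. edges (T i)) {..<m})"

definition edge_decomposition ::
    "('v, 'e) mgraph \<Rightarrow> nat \<Rightarrow> (nat \<Rightarrow> ('v, 'e) mgraph) \<Rightarrow> bool" where
  "edge_decomposition G k H \<longleftrightarrow> (\<forall>i<k. factor (H i) G) \<and>
     disjoint_family_on (\<lambda>i. edges (H i)) {..<k} \<and> (\<Union>i<k. edges (H i)) = edges G"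

definition almost_factor_at ::
    "('v, 'e) mgraph \<Rightarrow> ('v \<Rightarrow> int) \<Rightarrow> 'v \<Rightarrow> ('v, 'e) mgraph \<Rightarrow> bool" where
  "almost_factor_at G f u F \<longleftrightarrow> factor F G \<and> u \<in> verts G \<and>
     (\<forall>v\<in>verts G - {u}. int (degree F v) = f v) \<and> int (degree F u) \<in> {f u - 1, f u + 1}"

definition almost_factor ::
    "('v, 'e) mgraph \<Rightarrow> ('v \<Rightarrow> int) \<Rightarrow> ('v, 'e) mgraph \<Rightarrow> bool" where
  "almost_factor G f F \<longleftrightarrow> (\<exists>u. almost_factor_at G f u F)"

end

theory Submission
  imports Defs
begin

text \<open>Let \<open>D v\<close> be the degree of \<open>v\<close> and \<open>r v\<close> the residue that the theorem attaches to \<open>v\<close>, so that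
\<open>D v - k * f v\<close> is \<open>r v\<close> on \<open>Z\<close> and \<open>- r v\<close> elsewhere. The conditions on \<open>s\<close> are necessary because the
degrees of \<open>v\<close> in the \<open>k\<close> factors differ from \<open>f v\<close> by \<open>1\<close> or \<open>- 1\<close> exactly \<open>s v\<close> times
(lemma \<open>almost_factor_counts\<close>).

For sufficiency, parity and \<open>r v \<le> s v\<close> allow writing \<open>s v = b v + c v\<close> with \<open>D v = k * f v + b v - c v\<close>;
the \<open>b v\<close> are the surpluses and the \<open>c v\<close> the deficits to be distributed over the factors. The
definition of \<open>m\<close> says precisely that the sum of all \<open>b v\<close> is congruent to the number of edges modulo
\<open>k\<close>, so one may ask for an orientation in which \<open>v\<close> has out-degree congruent to \<open>b v\<close>. Given one,
split every vertex into a tail copy and a head copy, let a new vertex \<open>w\<close> on the tail side take over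
\<open>b v\<close> of the edges leaving \<open>v\<close>, and join \<open>w\<close> to the head copy of \<open>v\<close> by \<open>c v\<close> dummy edges. In this
bipartite multigraph all degrees are multiples of \<open>k\<close> and \<open>w\<close> has degree \<open>k\<close>, so by Koenig's theorem
its edges can be coloured with \<open>k\<close> colours such that each vertex sees all colours equally often
(\<open>balanced_colouring\<close>). Each colour class then has degree \<open>f v\<close> at every vertex \<open>v\<close> except for the effect of its single edge
at \<open>w\<close>, which is the one deviation of an almost \<open>f\<close>-factor (\<open>decomposition_from_orientation\<close>).

The orientation (\<open>modulo_orientation\<close>) is the deep part. For edge-connected graphs it is the theorem of
Lovasz, Thomassen, Wu and Zhang on modulo orientations; the proof follows their idea of a stronger
statement that survives induction, in which the edges at one vertex \<open>z\<close> are oriented beforehand and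
every vertex set avoiding \<open>z\<close> satisfies a lower bound on its cut that depends on the residue to be
realised there (\<open>admissible_orientable\<close>). A graph with \<open>2 * k - 2\<close> edge-disjoint
spanning trees is treated by induction on the number of vertices: if no set violates these cut
bounds, the same theorem applies. Otherwise take a smallest violating set. If it has several vertices, it
is contracted, the quotient is oriented by induction, and inside the set the theorem applies with the
rest of the graph as \<open>z\<close>. If it is a single vertex, its degree is at most \<open>3 * k - 3\<close>, and lifting
pairs of its edges turns the trees into connected spanning subgraphs of the graph without it while enough edges stay
at the vertex to realise any residue there (\<open>packing_orientable\<close>).\<close>

section \<open>Distance to the multiples of 2k\<close>

text \<open>The distance of \<open>n\<close> to the nearest multiple of \<open>2 * k\<close>. Prescribing out-degrees modulo \<open>k\<close> amounts to
prescribing the differences of out-degree and in-degree modulo \<open>2 * k\<close>, and this distance is the smallest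
absolute value that such a difference can have if it is congruent to \<open>n\<close>.\<close>

definition cdist :: "int \<Rightarrow> int \<Rightarrow> int" where
  "cdist k n = min (n mod (2 * k)) (2 * k - n mod (2 * k))"

lemma cdist_eqI:
  assumes "2 * k dvd n - r" "\<bar>r\<bar> \<le> k" "k > 0"
  shows "cdist k n = \<bar>r\<bar>"
proof -
  have "n mod (2*k) = r mod (2*k)" using assms(1) by (simp add: mod_eq_dvd_iff)
  moreover have "r mod (2*k) = (if r \<ge> 0 then r else r + 2*k)"
  proof (cases "r \<ge> 0")
    case True then show ?thesis using assms by simp
  next
    case False
    have "r mod (2*k) = (r + 2*k) mod (2*k)" by simp
    also have "\<dots> = r + 2*k" using False assms by (intro mod_pos_pos_trivial) auto
    finally show ?thesis using False by simp
  qed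
  ultimately show ?thesis using assms unfolding cdist_def by auto
qed

lemma cdist_repr:
  assumes "k > 0"
  obtains r where "2 * k dvd n - r" "- k < r" "r \<le> k" "cdist k n = \<bar>r\<bar>"
proof -
  define q where "q = n mod (2 * k)"
  have q: "0 \<le> q" "q < 2 * k" using assms unfolding q_def by simp_all
  have d: "2 * k dvd n - q" unfolding q_def by (rule dvd_minus_mod)
  then have d': "2 * k dvd n - (q - 2 * k)"
    using dvd_add[OF d dvd_refl] by (simp add: algebra_simps)
  show ?thesis
  proof (cases "q \<le> k")
    case True
    have "cdist k n = \<bar>q\<bar>" using q True assms by (intro cdist_eqI[OF d]) linarith+
    then show ?thesis using that[OF d] q True assms by linarith
  next
    case False
    have "cdist k n = \<bar>q - 2 * k\<bar>" using q False assms by (intro cdist_eqI[OF d']) linarith+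
    then show ?thesis using that[OF d'] q False assms by linarith
  qed
qed

lemma cdist_cong: "2 * k dvd m - n \<Longrightarrow> cdist k m = cdist k n"
  unfolding cdist_def by (metis mod_eq_dvd_iff)

lemma cdist_le_abs:
  assumes "k > 0" shows "cdist k n \<le> \<bar>n\<bar>"
proof (cases "\<bar>n\<bar> \<le> k")
  case True then show ?thesis using cdist_eqI[of k n n] assms by simp
next
  case False then show ?thesis using cdist_repr[OF assms, of n] by (smt (verit))
qed

lemma cdist_le: "k > 0 \<Longrightarrow> cdist k n \<le> k"
  using cdist_repr[of k n] by (smt (verit))

lemma cdist_nonneg: "k > 0 \<Longrightarrow> 0 \<le> cdist k n"
  using cdist_repr[of k n] by (smt (verit))

lemma cdist_minus: 
  assumes "k > 0" shows "cdist k (- n) = cdist k n"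
proof -
  obtain r where r: "2 * k dvd n - r" "- k < r" "r \<le> k" "cdist k n = \<bar>r\<bar>"
    using cdist_repr[OF assms] by blast
  have "2 * k dvd - n - (- r)" using r(1) by (simp add: dvd_diff_commute)
  then show ?thesis using cdist_eqI[of k "- n" "- r"] r assms by simp
qed

lemma cdist_add:
  assumes "k > 0" shows "cdist k (m + n) \<le> cdist k m + cdist k n"
proof -
  obtain r where r: "2 * k dvd m - r" "cdist k m = \<bar>r\<bar>" using cdist_repr[OF assms] by blast
  obtain q where q: "2 * k dvd n - q" "cdist k n = \<bar>q\<bar>" using cdist_repr[OF assms] by blast
  have "2 * k dvd (m + n) - (r + q)" using dvd_add[OF r(1) q(1)] by (simp add: algebra_simps)
  then have "cdist k (m + n) = cdist k (r + q)" by (rule cdist_cong)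
  also have "\<dots> \<le> \<bar>r + q\<bar>" by (rule cdist_le_abs[OF assms])
  finally show ?thesis using r q by linarith
qed

lemma cdist_shift: "k > 0 \<Longrightarrow> cdist k (n + j) \<le> cdist k n + \<bar>j\<bar>"
  using cdist_add[of k n j] cdist_le_abs[of k j] by linarith

lemma cdist_parity:
  assumes "k > 0" shows "even (cdist k n + n)"
proof -
  obtain r where r: "2 * k dvd n - r" "cdist k n = \<bar>r\<bar>" using cdist_repr[OF assms] by blast
  have "even (n - r)" using r(1) by (meson dvd_mult_left)
  then show ?thesis using r(2) by presburger
qed

text \<open>A residue that is not a multiple of \<open>2 * k\<close> gets closer to one in at least one direction; at distance
exactly \<open>k\<close> both directions work.\<close>

lemma cdist_step_towards:
  assumes "k > 0" "\<not> 2 * k dvd n"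
  shows "cdist k (n - 1) = cdist k n - 1 \<or> cdist k (n + 1) = cdist k n - 1"
proof -
  obtain r where r: "2 * k dvd n - r" "- k < r" "r \<le> k" "cdist k n = \<bar>r\<bar>"
    using cdist_repr[OF assms(1)] by blast
  have "r \<noteq> 0" using r(1) assms(2) by auto
  have a: "2 * k dvd (n - 1) - (r - 1)" "2 * k dvd (n + 1) - (r + 1)" using r(1) by simp_all
  show ?thesis
  proof (cases "r > 0")
    case True
    then have "cdist k (n - 1) = \<bar>r - 1\<bar>" using r(2,3) assms(1) by (intro cdist_eqI[OF a(1)]) linarith+
    then show ?thesis using r(4) True by linarith
  next
    case False
    then have "cdist k (n + 1) = \<bar>r + 1\<bar>" using r(2,3) assms(1) by (intro cdist_eqI[OF a(2)]) linarith+
    then show ?thesis using r(4) False \<open>r \<noteq> 0\<close> by linarith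
  qed
qed

section \<open>Signed orientations of multigraphs\<close>

text \<open>Edges are represented by arcs, with an arbitrary reference direction; an orientation is then a sign
\<open>\<sigma> e\<close> per edge, negative for edges that are reversed. The flux is \<open>1\<close> for an arc leaving \<open>S\<close>, \<open>- 1\<close>
for one entering \<open>S\<close>, and \<open>0\<close> for all other arcs. In particular loops contribute nothing anywhere, so
contractions can keep the edge set unchanged.\<close>

definition flux :: "'v \<times> 'v \<Rightarrow> 'v set \<Rightarrow> int" where
  "flux a S = (if fst a \<in> S then 1 else 0) - (if snd a \<in> S then 1 else 0)"

definition net :: "('e \<Rightarrow> int) \<Rightarrow> 'e set \<Rightarrow> ('e \<Rightarrow> 'v \<times> 'v) \<Rightarrow> 'v set \<Rightarrow> int" where
  "net \<sigma> E h S = (\<Sum>e\<in>E. \<sigma> e * flux (h e) S)"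

definition ecut :: "'e set \<Rightarrow> ('e \<Rightarrow> 'v \<times> 'v) \<Rightarrow> 'v set \<Rightarrow> int" where
  "ecut E h S = (\<Sum>e\<in>E. \<bar>flux (h e) S\<bar>)"

definition sign_fun :: "('e \<Rightarrow> int) \<Rightarrow> bool" where
  "sign_fun \<sigma> \<longleftrightarrow> (\<forall>e. \<sigma> e = 1 \<or> \<sigma> e = - 1)"

definition orientable :: "int \<Rightarrow> 'v set \<Rightarrow> 'e set \<Rightarrow> ('e \<Rightarrow> 'v \<times> 'v) \<Rightarrow> ('v \<Rightarrow> int) \<Rightarrow> bool" where
  "orientable k V E h u \<longleftrightarrow> (\<exists>\<sigma>. sign_fun \<sigma> \<and> (\<forall>v\<in>V. 2 * k dvd net \<sigma> E h {v} - u v))"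

definition joins :: "('e \<Rightarrow> 'v \<times> 'v) \<Rightarrow> 'e \<Rightarrow> 'v \<Rightarrow> 'v \<Rightarrow> bool" where
  "joins h e x y \<longleftrightarrow> h e = (x, y) \<or> h e = (y, x)"

lemma flux_pair: "flux (x, y) S = (if x \<in> S then 1 else 0) - (if y \<in> S then 1 else 0)"
  by (simp add: flux_def)

lemma flux_rev: "flux (y, x) S = - flux (x, y) S"
  by (simp add: flux_def)

lemma joins_abs_flux: "joins h e x y \<Longrightarrow> \<bar>flux (h e) S\<bar> = \<bar>flux (x, y) S\<bar>"
  by (auto simp: joins_def flux_def)

lemma flux_le_1: "\<bar>flux a S\<bar> \<le> 1"
  by (auto simp: flux_def)

lemma sum_flux: "finite S \<Longrightarrow> (\<Sum>v\<in>S. flux a {v}) = flux a S"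
proof -
  assume f: "finite S"
  have "(\<Sum>v\<in>S. (if z = v then 1 else 0 :: int)) = (if z \<in> S then 1 else 0)" for z
    using f by simp
  then show ?thesis by (simp add: flux_def sum_subtractf)
qed

lemma sum_net: "finite S \<Longrightarrow> (\<Sum>v\<in>S. net \<sigma> E h {v}) = net \<sigma> E h S"
  unfolding net_def by (subst sum.swap) (simp flip: sum_distrib_left add: sum_flux)

lemma cut_parity_net: "even (ecut E h S + net (\<lambda>_. 1) E h S)"
  unfolding ecut_def net_def sum.distrib[symmetric] by (rule dvd_sum) (auto simp: abs_if)

lemma cut_parity_sum:
  assumes "finite S" shows "even (ecut E h S + (\<Sum>v\<in>S. ecut E h {v}))"
proof -
  have "even ((\<Sum>v\<in>S. ecut E h {v}) + net (\<lambda>_. 1) E h S)"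
    unfolding sum_net[OF assms, symmetric] sum.distrib[symmetric]
    by (rule dvd_sum) (rule cut_parity_net)
  then show ?thesis using cut_parity_net[of E h S] by presburger
qed

lemma cut_nonneg: "0 \<le> ecut E h S"
  unfolding ecut_def by (rule sum_nonneg) auto

lemma cut_compl:
  assumes "h ` E \<subseteq> V \<times> V" shows "ecut E h (V - S) = ecut E h S"
  unfolding ecut_def
proof (rule sum.cong[OF refl])
  fix e assume "e \<in> E"
  then have "h e \<in> V \<times> V" using assms by blast
  then show "\<bar>flux (h e) (V - S)\<bar> = \<bar>flux (h e) S\<bar>" by (auto simp: flux_def)
qed

lemma cut_edge:
  assumes "ecut E h S > 0" 
  obtains e x y where "e \<in> E" "joins h e x y" "x \<in> S" "y \<notin> S"
proof -
  have "\<exists>e\<in>E. flux (h e) S \<noteq> 0"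
  proof (rule ccontr)
    assume "\<not> ?thesis"
    then have "ecut E h S = 0" unfolding ecut_def by simp
    then show False using assms by simp
  qed
  then obtain e where e: "e \<in> E" "flux (h e) S \<noteq> 0" by blast
  have j: "joins h e (fst (h e)) (snd (h e))" "joins h e (snd (h e)) (fst (h e))"
    by (simp_all add: joins_def)
  have "(fst (h e) \<in> S) \<noteq> (snd (h e) \<in> S)" using e(2) by (auto simp: flux_def split: if_splits)
  then show ?thesis using that[OF e(1) j(1)] that[OF e(1) j(2)] by blast
qed

lemma cut_remove:
  "finite E \<Longrightarrow> e \<in> E \<Longrightarrow> joins h e x y \<Longrightarrow> ecut (E - {e}) h S = ecut E h S - \<bar>flux (x, y) S\<bar>"
  unfolding ecut_def by (simp add: sum_diff1 joins_abs_flux)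

lemma net_remove:
  "finite E \<Longrightarrow> e \<in> E \<Longrightarrow> net \<sigma> E h S = \<sigma> e * flux (h e) S + net \<sigma> (E - {e}) h S"
  unfolding net_def by (simp add: sum.remove)

lemma net_cong: "(\<And>e. e \<in> E \<Longrightarrow> \<sigma> e = \<sigma>' e) \<Longrightarrow> (\<And>e. e \<in> E \<Longrightarrow> h e = h' e) \<Longrightarrow> net \<sigma> E h S = net \<sigma>' E h' S"
  unfolding net_def by (rule sum.cong) auto

lemma orientable_cong:
  "orientable k V E h u \<Longrightarrow> (\<And>v. v \<in> V \<Longrightarrow> u v = u' v) \<Longrightarrow> orientable k V E h u'"
  unfolding orientable_def by auto

lemma orientable_add_edge:
  assumes "finite E" "e \<in> E" "joins h e x y"
    and "orientable k V (E - {e}) h (\<lambda>v. u v - flux (x, y) {v})"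
  shows "orientable k V E h u"
proof -
  obtain \<sigma> where s: "sign_fun \<sigma>" and d: "\<And>v. v \<in> V \<Longrightarrow> 2 * k dvd net \<sigma> (E - {e}) h {v} - (u v - flux (x, y) {v})"
    using assms(4) unfolding orientable_def by blast
  obtain c :: int where c: "c = 1 \<or> c = - 1" "\<And>S. c * flux (h e) S = flux (x, y) S"
    using assms(3) flux_rev unfolding joins_def by (metis mult_1 mult_minus_left minus_minus)
  define \<sigma>' where "\<sigma>' = \<sigma>(e := c)"
  have "net \<sigma>' E h {v} = flux (x, y) {v} + net \<sigma> (E - {e}) h {v}" for v
    using net_remove[OF assms(1,2), of \<sigma>' h "{v}"] net_cong[of "E - {e}" \<sigma>' \<sigma> h h "{v}"] c
    by (simp add: \<sigma>'_def)
  then have "\<forall>v\<in>V. 2 * k dvd net \<sigma>' E h {v} - u v" using d by (simp add: algebra_simps)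
  moreover have "sign_fun \<sigma>'" using s c by (auto simp: sign_fun_def \<sigma>'_def)
  ultimately show ?thesis unfolding orientable_def by blast
qed

text \<open>Lifting: two edges \<open>xy\<close> and \<open>xz\<close> are replaced by one edge \<open>yz\<close>. An orientation of the new edge is
pulled back to a directed path through \<open>x\<close>, which changes the balance of no vertex. The new edge keeps
the name \<open>e\<close>, and \<open>y = z\<close> is possible.\<close>

lemma orientable_unlift:
  assumes "finite E" "e \<in> E" "g \<in> E" "e \<noteq> g" "joins h e x y" "joins h g x z"
    and "orientable k V (E - {g}) (h(e := (y, z))) u"
  shows "orientable k V E h u"
proof -
  obtain \<sigma> where s: "sign_fun \<sigma>" and d: "\<And>v. v \<in> V \<Longrightarrow> 2 * k dvd net \<sigma> (E - {g}) (h(e := (y, z))) {v} - u v"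
    using assms(7) unfolding orientable_def by blast
  obtain c :: int where c: "c = 1 \<or> c = - 1" "\<And>S. c * flux (h e) S = flux (y, x) S"
    using assms(5) flux_rev unfolding joins_def by (metis mult_1 mult_minus_left minus_minus)
  obtain b :: int where b: "b = 1 \<or> b = - 1" "\<And>S. b * flux (h g) S = flux (x, z) S"
    using assms(6) flux_rev unfolding joins_def by (metis mult_1 mult_minus_left minus_minus)
  define \<sigma>' where "\<sigma>' = \<sigma>(e := \<sigma> e * c, g := \<sigma> e * b)"
  have e: "e \<in> E - {g}" "finite (E - {g})" using assms by auto
  have "net \<sigma>' E h S = net \<sigma> (E - {g}) (h(e := (y, z))) S" for S
  proof -
    have "net \<sigma>' E h S = \<sigma> e * (b * flux (h g) S) + (\<sigma> e * (c * flux (h e) S) + net \<sigma>' (E - {g} - {e}) h S)"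
      using net_remove[OF assms(1,3), of \<sigma>' h S] net_remove[OF e(2,1), of \<sigma>' h S] assms(4)
      by (simp add: \<sigma>'_def mult.assoc)
    also have "net \<sigma>' (E - {g} - {e}) h S = net \<sigma> (E - {g} - {e}) (h(e := (y, z))) S"
      by (rule net_cong) (auto simp: \<sigma>'_def)
    also have "\<sigma> e * (b * flux (h g) S) + (\<sigma> e * (c * flux (h e) S) + net \<sigma> (E - {g} - {e}) (h(e := (y, z))) S)
      = net \<sigma> (E - {g}) (h(e := (y, z))) S"
      unfolding b c using net_remove[OF e(2,1), of \<sigma> "h(e := (y, z))" S]
      by (simp add: flux_pair algebra_simps)
    finally show ?thesis .
  qed
  moreover have "sign_fun \<sigma>'" using s b(1) c(1) by (auto simp: sign_fun_def \<sigma>'_def)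
  ultimately show ?thesis unfolding orientable_def using d by metis
qed

text \<open>Only the cuts that separate \<open>x\<close> from both other ends are affected by lifting.\<close>

lemma cut_lift:
  assumes "finite E" "e \<in> E" "g \<in> E" "e \<noteq> g" "joins h e x y" "joins h g x z"
  shows "ecut (E - {g}) (h(e := (y, z))) S
    = ecut E h S - (if (x \<in> S \<and> y \<notin> S \<and> z \<notin> S) \<or> (x \<notin> S \<and> y \<in> S \<and> z \<in> S) then 2 else 0)"
proof -
  have "ecut E h S = \<bar>flux (x, z) S\<bar> + (\<bar>flux (x, y) S\<bar> + ecut (E - {g} - {e}) h S)"
    using cut_remove[OF assms(1,3,6), of S] cut_remove[OF _ _ assms(5), of "E - {g}" S] assms by auto
  moreover have "ecut (E - {g}) (h(e := (y, z))) S = \<bar>flux (y, z) S\<bar> + ecut (E - {g} - {e}) (h(e := (y, z))) S"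
    using cut_remove[of "E - {g}" e "h(e := (y, z))" y z S] assms by (auto simp: joins_def)
  moreover have "ecut (E - {g} - {e}) (h(e := (y, z))) S = ecut (E - {g} - {e}) h S"
    unfolding ecut_def by (rule sum.cong) auto
  ultimately show ?thesis by (auto simp: flux_pair)
qed

lemma orientable_reverse:
  assumes "orientable k V E h (\<lambda>v. - u v)" shows "orientable k V E h u"
proof -
  obtain \<sigma> where s: "sign_fun \<sigma>" and d: "\<And>v. v \<in> V \<Longrightarrow> 2 * k dvd net \<sigma> E h {v} + u v"
    using assms unfolding orientable_def by auto
  have "net (\<lambda>e. - \<sigma> e) E h {v} = - net \<sigma> E h {v}" for v by (simp add: net_def sum_negf)
  then have "2 * k dvd net (\<lambda>e. - \<sigma> e) E h {v} - u v" if "v \<in> V" for v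
    using d[OF that] by (metis dvd_minus_iff minus_add_distrib diff_conv_add_uminus)
  moreover have "sign_fun (\<lambda>e. - \<sigma> e)" using s by (auto simp: sign_fun_def)
  ultimately show ?thesis unfolding orientable_def by blast
qed

text \<open>Reversing one edge changes the balance at \<open>x\<close> by two, so every value of the right parity between the two
extremes occurs.\<close>

lemma exists_net_at_vertex:
  assumes "finite E" "\<bar>r\<bar> \<le> ecut E h {x}" "even (r + ecut E h {x})"
  obtains \<sigma> where "sign_fun \<sigma>" "net \<sigma> E h {x} = r"
proof -
  define D where "D = {e\<in>E. flux (h e) {x} \<noteq> 0}"
  have fD: "finite D" using assms(1) by (simp add: D_def)
  have one: "\<bar>flux (h e) {x}\<bar> = 1" if "e \<in> D" for e
    using that flux_le_1[of "h e" "{x}"] by (auto simp: D_def)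
  have cD: "ecut E h {x} = int (card D)"
  proof -
    have "ecut E h {x} = (\<Sum>e\<in>D. \<bar>flux (h e) {x}\<bar>)"
      unfolding ecut_def using assms(1) by (intro sum.mono_neutral_right) (auto simp: D_def)
    then show ?thesis using one by simp
  qed
  obtain j where j: "r + int (card D) = 2 * j" using assms(3) cD by (metis evenE)
  have "nat j \<le> card D" using j assms(2) cD by linarith
  then obtain P where P: "P \<subseteq> D" "card P = nat j" by (metis obtain_subset_with_card_n)
  define \<sigma> where "\<sigma> e = (if e \<in> D \<and> ((e \<in> P) \<noteq> (flux (h e) {x} = 1)) then - 1 else 1::int)" for e
  have fP: "finite P" using fD P finite_subset by blast
  have v: "\<sigma> e * flux (h e) {x} = (if e \<in> P then 1 else - 1)" if "e \<in> D" for e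
    using one[OF that] that by (auto simp: \<sigma>_def abs_if split: if_splits)
  have "net \<sigma> E h {x} = (\<Sum>e\<in>D. \<sigma> e * flux (h e) {x})"
    unfolding net_def using assms(1) by (intro sum.mono_neutral_right) (auto simp: D_def)
  also have "\<dots> = (\<Sum>e\<in>D. if e \<in> P then 1 else - 1)" using v by (intro sum.cong) auto
  also have "\<dots> = int (card (D \<inter> P)) - int (card (D - P))"
    using fD by (simp add: sum.If_cases Diff_eq)
  also have "D \<inter> P = P" using P by auto
  also have "int (card P) - int (card (D - P)) = r"
    using P j fP fD card_mono[OF fD P(1)] assms(2) cD by (simp add: card_Diff_subset)
  finally have "net \<sigma> E h {x} = r" .
  moreover have "sign_fun \<sigma>" by (auto simp: sign_fun_def \<sigma>_def)
  ultimately show ?thesis using that by blast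
qed

section \<open>Contraction and gluing\<close>

definition merge :: "'v set \<Rightarrow> 'v \<Rightarrow> 'v \<Rightarrow> 'v" where
  "merge A z v = (if v \<in> A then z else v)"

definition inner :: "'e set \<Rightarrow> ('e \<Rightarrow> 'v \<times> 'v) \<Rightarrow> 'v set \<Rightarrow> 'e set" where
  "inner E h A = {e\<in>E. h e \<in> A \<times> A}"

lemma flux_merge:
  assumes "fst a \<in> V" "snd a \<in> V"
  shows "flux (map_prod f f a) S = flux a {v\<in>V. f v \<in> S}"
  using assms by (cases a) (auto simp: flux_def)

lemma cut_merge:
  assumes "h ` E \<subseteq> V \<times> V"
  shows "ecut E (map_prod f f \<circ> h) S = ecut E h {v\<in>V. f v \<in> S}"
  unfolding ecut_def
proof (rule sum.cong[OF refl])
  fix e assume "e \<in> E"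
  then have "h e \<in> V \<times> V" using assms by blast
  then show "\<bar>flux ((map_prod f f \<circ> h) e) S\<bar> = \<bar>flux (h e) {v\<in>V. f v \<in> S}\<bar>"
    using flux_merge[of "h e" V f S] by (auto simp: mem_Times_iff)
qed

lemma net_merge:
  assumes "h ` E \<subseteq> V \<times> V"
  shows "net \<sigma> E (map_prod f f \<circ> h) S = net \<sigma> E h {v\<in>V. f v \<in> S}"
  unfolding net_def
proof (rule sum.cong[OF refl])
  fix e assume "e \<in> E"
  then have "h e \<in> V \<times> V" using assms by blast
  then show "\<sigma> e * flux ((map_prod f f \<circ> h) e) S = \<sigma> e * flux (h e) {v\<in>V. f v \<in> S}"
    using flux_merge[of "h e" V f S] by (auto simp: mem_Times_iff)
qed

lemma sum_fibres:
  assumes "finite V" "finite B"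
  shows "(\<Sum>v\<in>B. \<Sum>w\<in>{w\<in>V. f w = v}. g w) = (\<Sum>w\<in>{w\<in>V. f w \<in> B}. (g w :: int))"
proof -
  have "{w\<in>V. f w \<in> B} = (\<Union>v\<in>B. {w\<in>V. f w = v})" by auto
  then show ?thesis using assms by (simp only:) (subst sum.UNION_disjoint, auto)
qed

lemma cut_split: "finite E \<Longrightarrow> F \<subseteq> E \<Longrightarrow> ecut E h S = ecut (E - F) h S + ecut F h S"
  unfolding ecut_def by (simp add: sum.subset_diff)

lemma net_split: "finite E \<Longrightarrow> F \<subseteq> E \<Longrightarrow> net \<sigma> E h S = net \<sigma> (E - F) h S + net \<sigma> F h S"
  unfolding net_def by (simp add: sum.subset_diff)

lemma inner_subset: "inner E h A \<subseteq> E"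
  by (auto simp: inner_def)

lemma net_le_cut: "sign_fun \<sigma> \<Longrightarrow> \<bar>net \<sigma> E h S\<bar> \<le> ecut E h S"
  unfolding net_def ecut_def sign_fun_def
proof (rule order_trans[OF sum_abs], rule sum_mono)
  fix e assume "\<forall>e. \<sigma> e = 1 \<or> \<sigma> e = - 1"
  then have "\<sigma> e = 1 \<or> \<sigma> e = - 1" by blast
  then show "\<bar>\<sigma> e * flux (h e) S\<bar> \<le> \<bar>flux (h e) S\<bar>" by auto
qed

lemma net_parity: "sign_fun \<sigma> \<Longrightarrow> even (net \<sigma> E h S + ecut E h S)"
  unfolding net_def ecut_def sign_fun_def sum.distrib[symmetric]
proof (rule dvd_sum)
  fix e assume "\<forall>e. \<sigma> e = 1 \<or> \<sigma> e = - 1"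
  then have "\<sigma> e = 1 \<or> \<sigma> e = - 1" by blast
  then show "even (\<sigma> e * flux (h e) S + \<bar>flux (h e) S\<bar>)" by (auto simp: abs_if)
qed

text \<open>An edge that is not inside \<open>A\<close> has at most one end in \<open>A\<close>, hence cannot be counted twice or cancel.\<close>

lemma sum_cut_outer:
  assumes "finite E" "finite A" "B \<subseteq> A"
  shows "(\<Sum>v\<in>B. ecut (E - inner E h A) h {v}) = ecut (E - inner E h A) h B"
proof -
  have fB: "finite B" using assms finite_subset by blast
  have "(\<Sum>v\<in>B. \<bar>flux (h e) {v}\<bar>) = \<bar>flux (h e) B\<bar>" if "e \<in> E - inner E h A" for e
  proof -
    have "\<not> (fst (h e) \<in> B \<and> snd (h e) \<in> B)" using that assms(3) by (auto simp: inner_def mem_Times_iff)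
    moreover have "fst (h e) \<noteq> snd (h e)" if "fst (h e) \<in> B \<or> snd (h e) \<in> B"
      using that calculation by auto
    ultimately have "\<bar>flux (h e) {v}\<bar> = (if fst (h e) = v then 1 else 0) + (if snd (h e) = v then 1 else 0)" if "v \<in> B" for v
      using that by (auto simp: flux_def)
    then have "(\<Sum>v\<in>B. \<bar>flux (h e) {v}\<bar>) = (\<Sum>v\<in>B. (if fst (h e) = v then 1 else 0) + (if snd (h e) = v then 1 else 0))"
      by (intro sum.cong) auto
    also have "\<dots> = (if fst (h e) \<in> B then 1 else 0) + (if snd (h e) \<in> B then 1 else 0)"
      using fB by (simp add: sum.distrib)
    also have "\<dots> = \<bar>flux (h e) B\<bar>" using \<open>\<not> (fst (h e) \<in> B \<and> snd (h e) \<in> B)\<close> by (auto simp: flux_def)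
    finally show ?thesis .
  qed
  then show ?thesis unfolding ecut_def by (subst sum.swap) simp
qed

text \<open>Orient the graph in which \<open>A\<close> is contracted to its member \<open>z\<close>. This orients all edges that are not
inside \<open>A\<close>; they contribute a known balance \<open>w v\<close> to every \<open>v\<close> in \<open>A\<close>, and it remains to orient the inside of
\<open>A\<close> with the remaining demand \<open>u v - w v\<close>.\<close>

lemma orientable_glue:
  assumes V: "finite V" "finite E" "h ` E \<subseteq> V \<times> V" and A: "A \<subseteq> V" "z \<in> A"
    and outer: "orientable k (insert z (V - A)) E (map_prod (merge A z) (merge A z) \<circ> h)
        (\<lambda>v. \<Sum>w\<in>{w\<in>V. merge A z w = v}. u w)"
    and inside: "\<And>w. (\<And>v. v \<in> A \<Longrightarrow> \<bar>w v\<bar> \<le> ecut (E - inner E h A) h {v} \<and> even (w v + ecut (E - inner E h A) h {v}))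
       \<Longrightarrow> 2 * k dvd sum w A - sum u A \<Longrightarrow> orientable k A (inner E h A) h (\<lambda>v. u v - w v)"
  shows "orientable k V E h u"
proof -
  let ?I = "inner E h A" and ?f = "merge A z"
  obtain \<sigma> where s: "sign_fun \<sigma>" and d: "\<And>v. v \<in> insert z (V - A) \<Longrightarrow>
      2 * k dvd net \<sigma> E (map_prod ?f ?f \<circ> h) {v} - (\<Sum>w\<in>{w\<in>V. ?f w = v}. u w)"
    using outer unfolding orientable_def by blast
  have fA: "finite A" using A V finite_subset by blast
  have zA: "{w\<in>V. ?f w = z} = A" using A by (auto simp: merge_def)
  have zv: "{w\<in>V. ?f w = v} = {v}" if "v \<in> V - A" for v using that A by (auto simp: merge_def)
  have I0: "net \<tau> ?I h {v} = 0" if "v \<in> V - A" for v \<tau>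
    unfolding net_def by (rule sum.neutral) (use that in \<open>auto simp: inner_def flux_def mem_Times_iff\<close>)
  have IA: "net \<tau> ?I h A = 0" for \<tau>
    unfolding net_def by (rule sum.neutral) (auto simp: inner_def flux_def mem_Times_iff)
  define w where "w v = net \<sigma> (E - ?I) h {v}" for v
  have "sum w A = net \<sigma> (E - ?I) h A" unfolding w_def by (rule sum_net[OF fA])
  also have "\<dots> = net \<sigma> E h A" using net_split[OF V(2) inner_subset, of \<sigma> h A h A] IA by simp
  also have "\<dots> = net \<sigma> E (map_prod ?f ?f \<circ> h) {z}" using net_merge[OF V(3), of \<sigma> ?f "{z}"] zA by simp
  finally have "2 * k dvd sum w A - sum u A" using d[of z] zA by simp
  moreover have "\<bar>w v\<bar> \<le> ecut (E - ?I) h {v} \<and> even (w v + ecut (E - ?I) h {v})" for v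
    unfolding w_def using net_le_cut[OF s] net_parity[OF s] by blast
  ultimately obtain \<rho> where r: "sign_fun \<rho>" and dr: "\<And>v. v \<in> A \<Longrightarrow> 2 * k dvd net \<rho> ?I h {v} - (u v - w v)"
    using inside[of w] unfolding orientable_def by blast
  define \<tau> where "\<tau> e = (if e \<in> ?I then \<rho> e else \<sigma> e)" for e
  have nt: "net \<tau> E h S = net \<sigma> (E - ?I) h S + net \<rho> ?I h S" for S
    using net_split[OF V(2) inner_subset, of \<tau> h S h A] net_cong[of "E - ?I" \<tau> \<sigma> h h S]
      net_cong[of ?I \<tau> \<rho> h h S] by (simp add: \<tau>_def)
  have "2 * k dvd net \<tau> E h {v} - u v" if "v \<in> V" for v
  proof (cases "v \<in> A")
    case True
    then show ?thesis using dr[OF True] by (simp add: nt w_def algebra_simps)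
  next
    case False
    have "net \<tau> E h {v} = net \<sigma> E h {v}"
      using nt[of "{v}"] I0[of v] net_split[OF V(2) inner_subset, of \<sigma> h "{v}" h A] False that by simp
    also have "\<dots> = net \<sigma> E (map_prod ?f ?f \<circ> h) {v}"
      using net_merge[OF V(3), of \<sigma> ?f "{v}"] zv[of v] False that by simp
    finally show ?thesis using d[of v] zv[of v] False that by simp
  qed
  moreover have "sign_fun \<tau>" using s r by (auto simp: sign_fun_def \<tau>_def)
  ultimately show ?thesis unfolding orientable_def by blast
qed

section \<open>The extension theorem for modulo orientations\<close>

text \<open>This is the situation of a graph with a distinguished vertex \<open>z\<close> all of whose edges are already
oriented, after \<open>z\<close> has been removed: \<open>c v\<close> is the number of edges between \<open>v\<close> and \<open>z\<close>, and \<open>s v\<close> is the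
number of those directed from \<open>v\<close> to \<open>z\<close> minus the number of those directed from \<open>z\<close> to \<open>v\<close>. The
demand \<open>t v\<close> refers to the whole graph, so the remaining edges have to realise \<open>t v - s v\<close>. The two inequalities say that the
degree of \<open>z\<close> is small and that all other cuts are large, measured against the residues to be realised.
At most one vertex, the element of \<open>X\<close>, is exempt from the second inequality, and only if its demand is zero modulo \<open>2 * k\<close>:
such a vertex is about to be removed by lifting its edges in pairs, which keeps its demand but lowers its degree.\<close>

definition admissible ::
    "int \<Rightarrow> 'v set \<Rightarrow> 'e set \<Rightarrow> ('e \<Rightarrow> 'v \<times> 'v) \<Rightarrow> ('v \<Rightarrow> int) \<Rightarrow> ('v \<Rightarrow> int) \<Rightarrow> ('v \<Rightarrow> int) \<Rightarrow> 'v set \<Rightarrow> bool" where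
  "admissible k V E h c s t X \<longleftrightarrow> finite V \<and> finite E \<and> h ` E \<subseteq> V \<times> V \<and>
     (\<forall>v\<in>V. \<bar>s v\<bar> \<le> c v \<and> even (c v + s v) \<and> even (t v + c v + ecut E h {v})) \<and>
     2 * k dvd sum t V - sum s V \<and> sum c V \<le> 2 * k - 2 + cdist k (sum t V) \<and>
     X \<subseteq> V \<and> (\<forall>x\<in>X. 2 * k dvd t x) \<and> (\<forall>x\<in>X. \<forall>y\<in>X. x = y) \<and>
     (\<forall>A. A \<noteq> {} \<longrightarrow> A \<subset> V \<longrightarrow> (\<forall>x\<in>X. A \<noteq> {x}) \<longrightarrow>
        2 * k - 2 + cdist k (sum t A) \<le> ecut E h A + sum c A)"

lemma admissibleD:
  assumes "admissible k V E h c s t X"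
  shows "finite V" "finite E" "h ` E \<subseteq> V \<times> V"
    "\<And>v. v \<in> V \<Longrightarrow> \<bar>s v\<bar> \<le> c v" "\<And>v. v \<in> V \<Longrightarrow> even (c v + s v)"
    "\<And>v. v \<in> V \<Longrightarrow> even (t v + c v + ecut E h {v})"
    "2 * k dvd sum t V - sum s V" "sum c V \<le> 2 * k - 2 + cdist k (sum t V)"
    "X \<subseteq> V" "\<And>x. x \<in> X \<Longrightarrow> 2 * k dvd t x" "\<And>x y. x \<in> X \<Longrightarrow> y \<in> X \<Longrightarrow> x = y"
    "\<And>A. A \<noteq> {} \<Longrightarrow> A \<subset> V \<Longrightarrow> (\<And>x. x \<in> X \<Longrightarrow> A \<noteq> {x}) \<Longrightarrow>
        2 * k - 2 + cdist k (sum t A) \<le> ecut E h A + sum c A"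
  by (use assms[unfolded admissible_def] in \<open>elim conjE; assumption\<close>
     | use assms[unfolded admissible_def] in \<open>elim conjE; drule (1) bspec; elim conjE; assumption\<close>
     | use assms[unfolded admissible_def] in \<open>elim conjE; simp\<close>)+

lemma admissibleI:
  assumes "finite V" "finite E" "h ` E \<subseteq> V \<times> V"
    "\<And>v. v \<in> V \<Longrightarrow> \<bar>s v\<bar> \<le> c v" "\<And>v. v \<in> V \<Longrightarrow> even (c v + s v)"
    "\<And>v. v \<in> V \<Longrightarrow> even (t v + c v + ecut E h {v})"
    "2 * k dvd sum t V - sum s V" "sum c V \<le> 2 * k - 2 + cdist k (sum t V)"
    "X \<subseteq> V" "\<And>x. x \<in> X \<Longrightarrow> 2 * k dvd t x" "\<And>x y. x \<in> X \<Longrightarrow> y \<in> X \<Longrightarrow> x = y"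
    "\<And>A. A \<noteq> {} \<Longrightarrow> A \<subset> V \<Longrightarrow> (\<And>x. x \<in> X \<Longrightarrow> A \<noteq> {x}) \<Longrightarrow>
        2 * k - 2 + cdist k (sum t A) \<le> ecut E h A + sum c A"
  shows "admissible k V E h c s t X"
  unfolding admissible_def
  by (intro conjI ballI allI impI; (rule assms; (assumption | drule (1) bspec; assumption)?))

lemma even_sum_cut:
  assumes "finite A" "\<And>v. v \<in> A \<Longrightarrow> even (t v + c v + ecut E h {v})"
  shows "even (sum t A + sum c A + ecut E h A)"
proof -
  have "even (\<Sum>v\<in>A. t v + c v + ecut E h {v})" using assms(2) by (rule dvd_sum)
  then show ?thesis using cut_parity_sum[OF assms(1), of E h] by (simp add: sum.distrib)
qed

lemma admissible_parity:
  assumes "admissible k V E h c s t X" "A \<subseteq> V"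
  shows "even (sum t A + sum c A + ecut E h A)"
proof (rule even_sum_cut)
  show "finite A" using admissibleD(1)[OF assms(1)] assms(2) finite_subset by blast
  show "even (t v + c v + ecut E h {v})" if "v \<in> A" for v
    using admissibleD(6)[OF assms(1)] assms(2) that by blast
qed

text \<open>Cuts and residues have the same parity, so a strict inequality already holds with slack two. Changing
a demand and a cut by one costs at most two, which is why non-tight sets survive a single reduction.\<close>

lemma slack_two:
  assumes "k > 0" "even (t + w)" "2 * k - 2 + cdist k t < w"
  shows "2 * k + cdist k t \<le> (w :: int)"
  using cdist_parity[OF assms(1), of t] assms(2,3) by presburger

lemma admissible_slack:
  assumes "admissible k V E h c s t X" "k > 0" "A \<subseteq> V"
    "2 * k - 2 + cdist k (sum t A) < ecut E h A + sum c A"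
  shows "2 * k + cdist k (sum t A) \<le> ecut E h A + sum c A"
  using slack_two[OF assms(2) _ assms(4)] admissible_parity[OF assms(1,3)] by (simp add: ac_simps)

lemma card_ge_2I: "finite A \<Longrightarrow> A \<noteq> {} \<Longrightarrow> (\<And>v. A \<noteq> {v}) \<Longrightarrow> card A \<ge> 2"
  by (metis One_nat_def Suc_1 Suc_leI card_1_singletonE card_gt_0_iff le_neq_implies_less)

text \<open>A set of the contracted graph corresponds to a union of vertices of the original graph with the same cut
and the same demand. An exempt vertex inside \<open>A\<close> disappears; one outside stays exempt.\<close>

lemma admissible_contract:
  assumes adm: "admissible k V E h c s t X" and A: "A \<subset> V" "card A \<ge> 2" "z \<in> A"
  defines "f \<equiv> merge A z"
  defines "fib \<equiv> \<lambda>g v. \<Sum>w\<in>{w\<in>V. f w = v}. (g w :: int)"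
  shows "admissible k (insert z (V - A)) E (map_prod f f \<circ> h) (fib c) (fib s) (fib t) (X - A)"
proof -
  note D = admissibleD[OF adm]
  let ?V = "insert z (V - A)"
  have fV: "f w \<in> ?V" if "w \<in> V" for w using that A by (auto simp: f_def merge_def)
  have sumfib: "sum (fib g) B = sum g {w\<in>V. f w \<in> B}" if "B \<subseteq> ?V" for g B
    unfolding fib_def using sum_fibres[where V = V and B = B and f = f and g = g] D(1) that finite_subset by (metis finite_Diff finite_insert)
  have V: "{w\<in>V. f w \<in> ?V} = V" using fV by auto
  have cutm: "ecut E (map_prod f f \<circ> h) B = ecut E h {w\<in>V. f w \<in> B}" for B
    by (rule cut_merge[OF D(3)])
  show ?thesis
  proof (rule admissibleI)
    show "finite ?V" "finite E" using D by auto
    have "map_prod f f (h e) \<in> ?V \<times> ?V" if "e \<in> E" for e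
    proof -
      have "h e \<in> V \<times> V" using D(3) that by blast
      then show ?thesis using fV by (cases "h e") auto
    qed
    then show "(map_prod f f \<circ> h) ` E \<subseteq> ?V \<times> ?V" unfolding comp_def image_subset_iff by blast
  next
    fix v assume v: "v \<in> ?V"
    have "\<bar>fib s v\<bar> \<le> (\<Sum>w\<in>{w\<in>V. f w = v}. \<bar>s w\<bar>)" unfolding fib_def by (rule sum_abs)
    also have "\<dots> \<le> fib c v" unfolding fib_def by (rule sum_mono) (use D(4) in auto)
    finally show "\<bar>fib s v\<bar> \<le> fib c v" .
    show "even (fib c v + fib s v)" unfolding fib_def sum.distrib[symmetric]
      by (rule dvd_sum) (use D(5) in auto)
    show "even (fib t v + fib c v + ecut E (map_prod f f \<circ> h) {v})"
      using admissible_parity[OF adm, of "{w\<in>V. f w = v}"] cutm[of "{v}"] by (auto simp: fib_def)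
  next
    show "2 * k dvd sum (fib t) ?V - sum (fib s) ?V" using D(7) sumfib[OF order_refl] V by simp
    show "sum (fib c) ?V \<le> 2 * k - 2 + cdist k (sum (fib t) ?V)" using D(8) sumfib[OF order_refl] V by simp
    show "X - A \<subseteq> ?V" using D(9) by auto
    show "\<And>x y. x \<in> X - A \<Longrightarrow> y \<in> X - A \<Longrightarrow> x = y" using D(11) by auto
    show "2 * k dvd fib t x" if "x \<in> X - A" for x
    proof -
      have "{w\<in>V. f w = x} = {x}" using that D(9) A by (auto simp: f_def merge_def)
      then show ?thesis using D(10) that by (auto simp: fib_def)
    qed
  next
    fix B assume B: "B \<noteq> {}" "B \<subset> ?V" "\<And>x. x \<in> X - A \<Longrightarrow> B \<noteq> {x}"
    let ?S = "{w\<in>V. f w \<in> B}"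
    have id: "f v = v" if "v \<in> ?V" for v using that A by (auto simp: f_def merge_def)
    have BS: "B \<subseteq> ?S" using B(2) id A by auto
    have S1: "?S \<noteq> {}" using B(1) BS by auto
    have S2: "?S \<subset> V"
    proof -
      obtain v where "v \<in> ?V" "v \<notin> B" using B(2) by auto
      then have "v \<in> V" "v \<notin> ?S" using id A by auto
      then show ?thesis by auto
    qed
    have S3: "?S \<noteq> {x}" if "x \<in> X" for x
    proof
      assume S: "?S = {x}"
      then have Bx: "B = {x}" using BS B(1) by auto
      then have "x \<in> A" using B(3)[of x] that by auto
      then have "x = z" using Bx B(2) by auto
      then have "A \<subseteq> ?S" using Bx A by (auto simp: f_def merge_def)
      then have "A \<subseteq> {x}" using S by auto
      then have "card A \<le> 1" using card_mono[of "{x}" A] by auto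
      then show False using A(2) by simp
    qed
    show "2 * k - 2 + cdist k (sum (fib t) B) \<le> ecut E (map_prod f f \<circ> h) B + sum (fib c) B"
      using D(12)[OF S1 S2 S3] sumfib[of B] B(2) cutm by (simp add: psubset_imp_subset)
  qed
qed

text \<open>After the contracted graph has been oriented, the rest of the graph serves as the distinguished vertex
for the inside of \<open>A\<close>. Its degree is the cut of \<open>A\<close>, whence the upper bound \<open>tight\<close> on this cut; the cuts of
the subsets of \<open>A\<close> are the same as before.\<close>

lemma glue_admissible:
  assumes V: "finite V" "finite E" "h ` E \<subseteq> V \<times> V" and A: "A \<subseteq> V" "z \<in> A"
    and loc: "\<And>v. v \<in> A \<Longrightarrow> \<bar>s v\<bar> \<le> c v" "\<And>v. v \<in> A \<Longrightarrow> even (c v + s v)"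
      "\<And>v. v \<in> A \<Longrightarrow> even (t v + c v + ecut E h {v})"
    and X: "X \<subseteq> A" "\<And>x. x \<in> X \<Longrightarrow> 2 * k dvd t x" "\<And>x y. x \<in> X \<Longrightarrow> y \<in> X \<Longrightarrow> x = y"
    and tight: "ecut E h A + sum c A \<le> 2 * k - 2 + cdist k (sum t A)"
    and cond: "\<And>B. B \<noteq> {} \<Longrightarrow> B \<subset> A \<Longrightarrow> (\<And>x. x \<in> X \<Longrightarrow> B \<noteq> {x}) \<Longrightarrow>
        2 * k - 2 + cdist k (sum t B) \<le> ecut E h B + sum c B"
    and outer: "orientable k (insert z (V - A)) E (map_prod (merge A z) (merge A z) \<circ> h)
        (\<lambda>v. \<Sum>w\<in>{w\<in>V. merge A z w = v}. t w - s w)"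
    and IH: "\<And>c s. admissible k A (inner E h A) h c s t X \<Longrightarrow> orientable k A (inner E h A) h (\<lambda>v. t v - s v)"
  shows "orientable k V E h (\<lambda>v. t v - s v)"
proof (rule orientable_glue[OF V A outer])
  fix w :: "'a \<Rightarrow> int"
  let ?I = "inner E h A" and ?O = "E - inner E h A"
  assume w: "\<And>v. v \<in> A \<Longrightarrow> \<bar>w v\<bar> \<le> ecut ?O h {v} \<and> even (w v + ecut ?O h {v})"
    and wA: "2 * k dvd sum w A - (\<Sum>v\<in>A. t v - s v)"
  have fA: "finite A" using A V finite_subset by blast
  have split: "ecut E h S = ecut ?O h S + ecut ?I h S" for S
    by (rule cut_split[OF V(2) inner_subset])
  have outs: "(\<Sum>v\<in>B. c v + ecut ?O h {v}) = sum c B + ecut ?O h B" if "B \<subseteq> A" for B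
    using sum_cut_outer[OF V(2) fA that, of h] by (simp add: sum.distrib)
  have IA: "ecut ?I h A = 0" unfolding ecut_def
    by (rule sum.neutral) (auto simp: inner_def flux_def mem_Times_iff)
  have "admissible k A ?I h (\<lambda>v. c v + ecut ?O h {v}) (\<lambda>v. s v + w v) t X"
  proof (rule admissibleI)
    show "finite A" "finite ?I" "h ` ?I \<subseteq> A \<times> A"
      using fA V finite_subset[OF inner_subset] by (auto simp: inner_def)
    show "\<bar>s v + w v\<bar> \<le> c v + ecut ?O h {v}" if "v \<in> A" for v
      using w[OF that] loc(1)[OF that] by linarith
    show "even (c v + ecut ?O h {v} + (s v + w v))" if "v \<in> A" for v
      using w[OF that] loc(2)[OF that] by presburger
    show "even (t v + (c v + ecut ?O h {v}) + ecut ?I h {v})" if "v \<in> A" for v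
      using loc(3)[OF that] split[of "{v}"] by (simp add: ac_simps)
    show "2 * k dvd sum t A - (\<Sum>v\<in>A. s v + w v)"
    proof -
      have "2 * k dvd - (sum w A - (\<Sum>v\<in>A. t v - s v))" using wA by (simp only: dvd_minus_iff)
      then show ?thesis by (simp add: sum.distrib sum_subtractf algebra_simps)
    qed
    show "(\<Sum>v\<in>A. c v + ecut ?O h {v}) \<le> 2 * k - 2 + cdist k (sum t A)"
      using tight split[of A] IA outs[of A] by simp
    show "2 * k - 2 + cdist k (sum t B) \<le> ecut ?I h B + (\<Sum>v\<in>B. c v + ecut ?O h {v})"
      if "B \<noteq> {}" "B \<subset> A" "\<And>x. x \<in> X \<Longrightarrow> B \<noteq> {x}" for B
      using cond[OF that] split[of B] outs[of B] that(2) by simp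
  qed (use X in auto)
  from IH[OF this] show "orientable k A ?I h (\<lambda>v. t v - s v - w v)"
    by (rule orientable_cong) auto
qed

text \<open>The edges at \<open>x\<close> are oriented first, with balance \<open>r\<close> at \<open>x\<close>, and their contribution is subtracted from
the demands of the other vertices.\<close>

lemma orientable_remove_vertex:
  assumes V: "finite E" "h ` E \<subseteq> V \<times> V" and x: "x \<in> V"
    and r: "\<bar>r\<bar> \<le> ecut E h {x}" "even (r + ecut E h {x})" "2 * k dvd r - u x"
    and rest: "\<And>\<sigma>. sign_fun \<sigma> \<Longrightarrow> net \<sigma> (E - inner E h (V - {x})) h {x} = r \<Longrightarrow>
       orientable k (V - {x}) (inner E h (V - {x})) h (\<lambda>v. u v - net \<sigma> (E - inner E h (V - {x})) h {v})"
  shows "orientable k V E h u"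
proof -
  let ?I = "inner E h (V - {x})" and ?O = "E - inner E h (V - {x})"
  have I0: "net \<tau> ?I h {x} = 0" "ecut ?I h {x} = 0" for \<tau>
    unfolding net_def ecut_def by (rule sum.neutral, auto simp: inner_def flux_def mem_Times_iff)+
  have c: "ecut ?O h {x} = ecut E h {x}" using cut_split[OF V(1) inner_subset, of h "{x}" h "V - {x}"] I0 by simp
  obtain \<sigma> where s: "sign_fun \<sigma>" "net \<sigma> ?O h {x} = r"
    using exists_net_at_vertex[of ?O r h x] V r c by auto
  obtain \<rho> where p: "sign_fun \<rho>" and d: "\<And>v. v \<in> V - {x} \<Longrightarrow> 2 * k dvd net \<rho> ?I h {v} - (u v - net \<sigma> ?O h {v})"
    using rest[OF s] unfolding orientable_def by blast
  define \<tau> where "\<tau> e = (if e \<in> ?I then \<rho> e else \<sigma> e)" for e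
  have nt: "net \<tau> E h S = net \<sigma> ?O h S + net \<rho> ?I h S" for S
    using net_split[OF V(1) inner_subset, of \<tau> h S h "V - {x}"] net_cong[of ?O \<tau> \<sigma> h h S]
      net_cong[of ?I \<tau> \<rho> h h S] by (simp add: \<tau>_def)
  have "2 * k dvd net \<tau> E h {v} - u v" if "v \<in> V" for v
  proof (cases "v = x")
    case True
    then show ?thesis using r(3) s(2) I0 nt by simp
  next
    case False
    then show ?thesis using d[of v] that nt[of "{v}"] by (simp add: algebra_simps)
  qed
  moreover have "sign_fun \<tau>" using s p by (auto simp: sign_fun_def \<tau>_def)
  ultimately show ?thesis unfolding orientable_def by blast
qed

lemma admissible_reverse:
  "admissible k V E h c s t X \<Longrightarrow> k > 0 \<Longrightarrow> admissible k V E h c (\<lambda>v. - s v) (\<lambda>v. - t v) X"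
  unfolding admissible_def
  by (auto simp: sum_negf cdist_minus dvd_diff_commute)

lemma sum_bump: "finite A \<Longrightarrow> (\<Sum>v\<in>A. g v + (if v = x then j else 0)) = sum g A + (if x \<in> A then (j::int) else 0)"
  by (simp add: sum.distrib)

text \<open>Adding \<open>j\<close> edges directed from \<open>x\<close> to the distinguished vertex raises the demand of \<open>x\<close> by the same
amount. Only the degree bound for the distinguished vertex has to be checked.\<close>

lemma admissible_raise:
  assumes adm: "admissible k V E h c s t {}" and k: "k > 0" and x: "x \<in> V" and j: "0 \<le> j"
    and total: "sum c V + j \<le> 2 * k - 2 + cdist k (sum t V + j)"
  shows "admissible k V E h (\<lambda>v. c v + (if v = x then j else 0)) (\<lambda>v. s v + (if v = x then j else 0))
    (\<lambda>v. t v + (if v = x then j else 0)) {}"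
proof (rule admissibleI)
  note D = admissibleD[OF adm]
  show "finite V" "finite E" "h ` E \<subseteq> V \<times> V" using D by auto
  fix v assume v: "v \<in> V"
  show "\<bar>s v + (if v = x then j else 0)\<bar> \<le> c v + (if v = x then j else 0)" using D(4)[OF v] j by auto
  show "even (c v + (if v = x then j else 0) + (s v + (if v = x then j else 0)))" using D(5)[OF v] by auto
  show "even (t v + (if v = x then j else 0) + (c v + (if v = x then j else 0)) + ecut E h {v})"
    using D(6)[OF v] by auto
next
  note D = admissibleD[OF adm]
  show "2 * k dvd (\<Sum>v\<in>V. t v + (if v = x then j else 0)) - (\<Sum>v\<in>V. s v + (if v = x then j else 0))"
    using D(7) by (simp add: sum_bump[OF D(1)])
  show "(\<Sum>v\<in>V. c v + (if v = x then j else 0)) \<le> 2 * k - 2 + cdist k (\<Sum>v\<in>V. t v + (if v = x then j else 0))"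
    using total x by (simp add: sum_bump[OF D(1)])
  fix A assume A: "A \<noteq> {}" "A \<subset> V"
  have fA: "finite A" using A D(1) finite_subset by blast
  show "2 * k - 2 + cdist k (\<Sum>v\<in>A. t v + (if v = x then j else 0))
      \<le> ecut E h A + (\<Sum>v\<in>A. c v + (if v = x then j else 0))"
    using D(12)[OF A] cdist_shift[OF k, of "sum t A" j] j by (simp add: sum_bump[OF fA])
qed auto

text \<open>Conversely, an edge directed from \<open>x\<close> to the distinguished vertex can be deleted if this does
not violate the bound at \<open>x\<close> itself and no set of two or more vertices is tight.\<close>

lemma admissible_lower:
  assumes adm: "admissible k V E h c s t {}" and k: "k > 0" and x: "x \<in> V"
    and s: "- c x < s x"
    and out: "2 * k - 2 + cdist k (t x - 1) + 1 \<le> ecut E h {x} + c x"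
    and strict: "\<And>A. card A \<ge> 2 \<Longrightarrow> A \<subset> V \<Longrightarrow> 2 * k - 2 + cdist k (sum t A) < ecut E h A + sum c A"
  shows "admissible k V E h (\<lambda>v. c v + (if v = x then - 1 else 0)) (\<lambda>v. s v + (if v = x then - 1 else 0))
    (\<lambda>v. t v + (if v = x then - 1 else 0)) {}"
proof (rule admissibleI)
  note D = admissibleD[OF adm]
  show "finite V" "finite E" "h ` E \<subseteq> V \<times> V" using D by auto
  fix v assume v: "v \<in> V"
  show "\<bar>s v + (if v = x then - 1 else 0)\<bar> \<le> c v + (if v = x then - 1 else 0)"
  proof (cases "v = x")
    case True
    have "s x \<noteq> - c x + 1" using D(5)[OF x] by auto
    then show ?thesis using D(4)[OF v] s True by auto
  next
    case False then show ?thesis using D(4)[OF v] by auto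
  qed
  show "even (c v + (if v = x then - 1 else 0) + (s v + (if v = x then - 1 else 0)))" using D(5)[OF v] by auto
  show "even (t v + (if v = x then - 1 else 0) + (c v + (if v = x then - 1 else 0)) + ecut E h {v})"
    using D(6)[OF v] by auto
next
  note D = admissibleD[OF adm]
  show "2 * k dvd (\<Sum>v\<in>V. t v + (if v = x then - 1 else 0)) - (\<Sum>v\<in>V. s v + (if v = x then - 1 else 0))"
    using D(7) by (simp add: sum_bump[OF D(1)])
  show "(\<Sum>v\<in>V. c v + (if v = x then - 1 else 0)) \<le> 2 * k - 2 + cdist k (\<Sum>v\<in>V. t v + (if v = x then - 1 else 0))"
    using D(8) x cdist_shift[OF k, of "sum t V - 1" 1] by (simp add: sum_bump[OF D(1)])
  fix A assume A: "A \<noteq> {}" "A \<subset> V"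
  have fA: "finite A" using A D(1) finite_subset by blast
  show "2 * k - 2 + cdist k (\<Sum>v\<in>A. t v + (if v = x then - 1 else 0))
      \<le> ecut E h A + (\<Sum>v\<in>A. c v + (if v = x then - 1 else 0))"
  proof (cases "x \<in> A")
    case False
    then show ?thesis using D(12)[OF A] by (simp add: sum_bump[OF fA])
  next
    case True
    show ?thesis
    proof (cases "A = {x}")
      case True
      then show ?thesis using out by simp
    next
      case False
      then have "card A \<ge> 2" using card_ge_2I[OF fA A(1)] True by blast
      then have "2 * k + cdist k (sum t A) \<le> ecut E h A + sum c A"
        using admissible_slack[OF adm k] strict A(2) by blast
      then show ?thesis using cdist_shift[OF k, of "sum t A" "- 1"] True by (simp add: sum_bump[OF fA])
    qed
  qed
qed auto

text \<open>Orienting an edge from \<open>x\<close> to \<open>y\<close> and deleting it is harmless as soon as the bounds at the two ends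
survive and no set of two or more vertices is tight.\<close>

lemma admissible_delete_edge:
  assumes adm: "admissible k V E h c s t {}" and k: "k > 0" and e: "e \<in> E" "joins h e x y" "x \<noteq> y"
    and out: "2 * k - 2 + cdist k (t x - 1) + 1 \<le> ecut E h {x} + c x"
    and "in": "2 * k - 2 + cdist k (t y + 1) + 1 \<le> ecut E h {y} + c y"
    and strict: "\<And>A. card A \<ge> 2 \<Longrightarrow> A \<subset> V \<Longrightarrow> 2 * k - 2 + cdist k (sum t A) < ecut E h A + sum c A"
  shows "admissible k V (E - {e}) h c s (\<lambda>v. t v - flux (x, y) {v}) {}"
proof (rule admissibleI)
  note D = admissibleD[OF adm]
  show "finite V" "finite (E - {e})" "h ` (E - {e}) \<subseteq> V \<times> V" using D by auto
  have xy: "x \<in> V" "y \<in> V" using D(3) e(1,2) by (auto simp: joins_def image_subset_iff)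
  have st: "(\<Sum>v\<in>A. t v - flux (x, y) {v}) = sum t A - flux (x, y) A" if "A \<subseteq> V" for A
    using sum_flux[of A "(x, y)"] that D(1) finite_subset by (metis sum_subtractf)
  have fV: "flux (x, y) V = 0" using xy by (simp add: flux_pair)
  have cr: "ecut (E - {e}) h A = ecut E h A - \<bar>flux (x, y) A\<bar>" for A
    by (rule cut_remove[OF D(2) e(1,2)])
  show "2 * k dvd (\<Sum>v\<in>V. t v - flux (x, y) {v}) - sum s V"
    "sum c V \<le> 2 * k - 2 + cdist k (\<Sum>v\<in>V. t v - flux (x, y) {v})"
    using D(7,8) fV by (simp_all add: st)
  show "even (t v - flux (x, y) {v} + c v + ecut (E - {e}) h {v})" if "v \<in> V" for v
    using D(6)[OF that] by (auto simp: cr flux_pair)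
  fix A assume A: "A \<noteq> {}" "A \<subset> V"
  have fA: "finite A" using A D(1) finite_subset by blast
  have "2 * k - 2 + cdist k (sum t A - flux (x, y) A) \<le> ecut E h A - \<bar>flux (x, y) A\<bar> + sum c A"
  proof (cases "card A \<ge> 2")
    case True
    then have "2 * k + cdist k (sum t A) \<le> ecut E h A + sum c A"
      using admissible_slack[OF adm k] strict A(2) by blast
    then show ?thesis using cdist_shift[OF k, of "sum t A" "- flux (x, y) A"] flux_le_1[of "(x, y)" A] by simp
  next
    case False
    then obtain v where v: "A = {v}" using card_ge_2I[OF fA A(1)] by blast
    consider "v = x" | "v = y" | "v \<noteq> x" "v \<noteq> y" by blast
    then show ?thesis using out "in" e(3) v D(12)[OF A] by cases (auto simp: flux_pair)
  qed
  then show "2 * k - 2 + cdist k (\<Sum>v\<in>A. t v - flux (x, y) {v}) \<le> ecut (E - {e}) h A + sum c A"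
    using st[of A] cr A(2) by simp
qed (use admissibleD[OF adm] in auto)

text \<open>Adding the bounds for \<open>A\<close> and its complement counts the cut twice and every edge to the distinguished
vertex once. As those edges are few, the cut cannot be empty.\<close>

lemma admissible_cut_pos:
  assumes adm: "admissible k V E h c s t {}" and k: "k \<ge> 2" and A: "A \<noteq> {}" "A \<subset> V"
  shows "ecut E h A > 0"
proof -
  note D = admissibleD[OF adm]
  have B: "V - A \<noteq> {}" "V - A \<subset> V" using A by auto
  have s: "sum g A + sum g (V - A) = sum g V" for g :: "'a \<Rightarrow> int"
    using D(1) A by (metis psubset_imp_subset sum.subset_diff add.commute)
  have "cdist k (sum t V) \<le> cdist k (sum t A) + cdist k (sum t (V - A))"
    using cdist_add[of k "sum t A" "sum t (V - A)"] s[of t] k by simp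
  then have "2 * k - 2 \<le> 2 * ecut E h A"
    using D(12)[OF A] D(12)[OF B] cut_compl[OF D(3), of A] s[of c] D(8) by simp
  then show ?thesis using k by simp
qed

lemma psubset_card_1:
  assumes "finite V" "x \<in> V" "card V \<ge> 2" shows "{x} \<subset> V"
proof -
  have "V \<noteq> {x}" using assms(3) by auto
  then show ?thesis using assms(2) by auto
qed

lemma orientable_single:
  assumes adm: "admissible k V E h c s t X" and V: "card V < 2"
  shows "orientable k V E h (\<lambda>v. t v - s v)"
proof (cases "V = {}")
  case True
  then show ?thesis unfolding orientable_def sign_fun_def by (intro exI[of _ "\<lambda>_. 1"]) simp
next
  case False
  note D = admissibleD[OF adm]
  obtain v where v: "V = {v}" using card_ge_2I[OF D(1) False] V by (meson not_less)
  have "net (\<lambda>_. 1) E h {v} = 0" unfolding net_def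
    by (rule sum.neutral) (use D(3) v in \<open>auto simp: flux_def image_subset_iff mem_Times_iff\<close>)
  then have "2 * k dvd net (\<lambda>_. 1) E h {v} - (t v - s v)" using D(7) v by (simp add: dvd_diff_commute)
  then show ?thesis unfolding orientable_def sign_fun_def v by (intro exI[of _ "\<lambda>_. 1"]) simp
qed

text \<open>A tight set of at least two vertices splits the problem into the contraction of the set and its inside, both with fewer vertices.\<close>

lemma orientable_tight:
  fixes h :: "'e \<Rightarrow> 'v \<times> 'v"
  assumes adm: "admissible k V E h c s t X" and A: "A \<subset> V" "card A \<ge> 2"
    and tight: "ecut E h A + sum c A \<le> 2 * k - 2 + cdist k (sum t A)"
    and IH: "\<And>V' E' h' c' s' t' X'. admissible k V' (E' :: 'e set) h' c' s' (t' :: 'v \<Rightarrow> int) X' \<Longrightarrow> card V' + card E' < card V + card E \<Longrightarrow>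
       orientable k V' E' h' (\<lambda>v. t' v - s' v)"
  shows "orientable k V E h (\<lambda>v. t v - s v)"
proof -
  note D = admissibleD[OF adm]
  have fA: "finite A" using A D(1) finite_subset by blast
  obtain z where z: "z \<in> A" using A(2) by fastforce
  have lt: "card A < card V" using psubset_card_mono[OF D(1) A(1)] .
  have cV: "card (insert z (V - A)) < card V"
    using z A D(1) fA lt card_Diff_subset[OF fA] by (simp add: psubset_imp_subset)
  show ?thesis
  proof (rule glue_admissible[where X = "X \<inter> A" and z = z, OF D(1-3)])
    show "A \<subseteq> V" "z \<in> A" using A z by auto
    show "orientable k (insert z (V - A)) E (map_prod (merge A z) (merge A z) \<circ> h)
        (\<lambda>v. \<Sum>w\<in>{w\<in>V. merge A z w = v}. t w - s w)"
      using IH[OF admissible_contract[OF adm A z]] cV by (simp add: sum_subtractf)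
    show "orientable k A (inner E h A) h (\<lambda>v. t v - s' v)"
      if "admissible k A (inner E h A) h c' s' t (X \<inter> A)" for c' s'
      using IH[OF that] lt card_mono[OF D(2) inner_subset, of h A] by simp
    show "2 * k - 2 + cdist k (sum t B) \<le> ecut E h B + sum c B"
      if "B \<noteq> {}" "B \<subset> A" "\<And>x. x \<in> X \<inter> A \<Longrightarrow> B \<noteq> {x}" for B
      by (rule D(12)) (use that A in auto)
    show "even (c v + s v)" "even (t v + c v + ecut E h {v})" if "v \<in> A" for v
      using D(5,6)[of v] that A(1) by blast+
  qed (use D(4,9-11) A tight in auto)
qed

text \<open>If no set with at least two vertices is tight, then lifting two edges at \<open>x\<close> towards different neighbours violates at most the bound
at \<open>x\<close> itself, from which \<open>x\<close> is exempt; the distinguished vertex counts as a neighbour here. When all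
edges of \<open>x\<close> lead to one vertex \<open>y\<close>, half of them are directed each way and \<open>x\<close> is deleted; the cuts that
remain are the old cuts of the sets that contain \<open>x\<close> if and only if they contain \<open>y\<close>.\<close>

lemma orientable_exempt:
  fixes h :: "'e \<Rightarrow> 'v \<times> 'v"
  assumes adm: "admissible k V E h c s t {x}" and k: "k \<ge> 2"
    and strict: "\<And>A. card A \<ge> 2 \<Longrightarrow> A \<subset> V \<Longrightarrow> 2 * k - 2 + cdist k (sum t A) < ecut E h A + sum c A"
    and IH: "\<And>V' E' h' c' s' t' X'. admissible k V' (E' :: 'e set) h' c' s' (t' :: 'v \<Rightarrow> int) X' \<Longrightarrow> card V' + card E' < card V + card E \<Longrightarrow>
       orientable k V' E' h' (\<lambda>v. t' v - s' v)"
  shows "orientable k V E h (\<lambda>v. t v - s v)"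
proof (cases "card V < 2")
  case True
  then show ?thesis by (rule orientable_single[OF adm])
next
  case V2: False
  note D = admissibleD[OF adm]
  have k0: "k > 0" using k by simp
  have x: "x \<in> V" "2 * k dvd t x" using D(9,10) by auto
  have Vx: "V - {x} \<noteq> {}" "V - {x} \<subset> V"
    using psubset_card_1[OF D(1) x(1)] V2 x by auto
  have split: "sum g V = g x + sum g (V - {x})" for g :: "'v \<Rightarrow> int"
    using D(1) x by (simp add: sum.remove)
  have slack: "2 * k + cdist k (sum t A) \<le> ecut E h A + sum c A" if "card A \<ge> 2" "A \<subset> V" for A
    using admissible_slack[OF adm k0] strict[OF that] that(2) by blast
  have tx: "cdist k (sum t (V - {x})) = cdist k (sum t V)"
    by (rule cdist_cong) (use x split[of t] in \<open>simp add: dvd_diff_commute\<close>)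
  have Vx': "V - {x} \<noteq> {z}" if "z \<in> {x}" for z using that by auto
  \<comment> \<open>At most half of the edges at \<open>x\<close> lead to the distinguished vertex, since its degree is small against the cut of \<open>V - {x}\<close>.\<close>
  have half: "c x \<le> ecut E h {x}"
    using D(12)[OF Vx Vx'] D(8) cut_compl[OF D(3), of "{x}"] split[of c] tx by auto
  show ?thesis
  proof (cases "c x > 0")
    case True
    then have "ecut E h {x} > 0" using half by simp
    from cut_edge[OF this] obtain e w y where "e \<in> E" "joins h e w y" "w \<in> {x}" "y \<notin> {x}" .
    then have e: "e \<in> E" "joins h e x y" "y \<noteq> x" by auto
    have y: "y \<in> V" using D(3) e by (auto simp: joins_def image_subset_iff)
    \<comment> \<open>An edge between \<open>x\<close> and the distinguished vertex is lifted with the edge \<open>xy\<close>; whether a leaving or an entering one is available depends on \<open>s x\<close>.\<close>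
    define p q where "p = (if - c x < s x then y else x)" and "q = (if - c x < s x then x else y)"
    have pq: "joins h e p q" using e(2) by (auto simp: p_def q_def joins_def)
    have fpq: "flux (p, q) {x} = (if - c x < s x then - 1 else 1)" "\<bar>flux (p, q) {y}\<bar> = 1"
      "\<And>v. v \<noteq> x \<Longrightarrow> v \<noteq> y \<Longrightarrow> flux (p, q) {v} = 0" "flux (p, q) V = 0"
      using e(3) x y by (auto simp: p_def q_def flux_pair)
    let ?c = "\<lambda>v. c v + (if v = y then 1 else 0) + (if v = x then - 1 else 0)"
    have cA: "sum ?c A = sum c A + (if y \<in> A then 1 else 0) + (if x \<in> A then - 1 else 0)" if "A \<subseteq> V" for A
    proof -
      have "finite A" using that D(1) finite_subset by blast
      then show ?thesis by (simp only: sum_bump)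
    qed
    have cr: "ecut (E - {e}) h A = ecut E h A - \<bar>flux (x, y) A\<bar>" for A
      by (rule cut_remove[OF D(2) e(1,2)])
    have "admissible k V (E - {e}) h ?c (\<lambda>v. s v + flux (p, q) {v}) t {x}"
    proof (rule admissibleI)
      show "finite V" "finite (E - {e})" "h ` (E - {e}) \<subseteq> V \<times> V" using D by auto
      fix v assume v: "v \<in> V"
      consider "v = x" | "v = y" | "v \<noteq> x" "v \<noteq> y" by blast
      then show "\<bar>s v + flux (p, q) {v}\<bar> \<le> ?c v"
      proof cases
        case 1
        have "s x \<noteq> - c x + 1" using D(5)[OF x(1)] by auto
        then show ?thesis using D(4)[OF x(1)] True fpq(1) e(3) 1 by auto
      next
        case 2
        then show ?thesis using D(4)[OF v] fpq(2) e(3) by simp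
      next
        case 3
        then show ?thesis using D(4)[OF v] fpq(3) by simp
      qed
      have par: "even (\<bar>flux (p, q) {v}\<bar> + flux (p, q) {v})" by (simp add: abs_if)
      have ab: "\<bar>flux (p, q) {v}\<bar> = \<bar>flux (x, y) {v}\<bar>" "\<bar>flux (x, y) {v}\<bar> = (if v = y then 1 else 0) + (if v = x then 1 else 0)"
        using e(3) by (auto simp: p_def q_def flux_pair)
      show "even (?c v + (s v + flux (p, q) {v}))"
        using D(5)[OF v] par ab by (auto split: if_splits)
      show "even (t v + ?c v + ecut (E - {e}) h {v})"
        using D(6)[OF v] ab(2) unfolding cr by (auto split: if_splits)
    next
      have "(\<Sum>v\<in>V. s v + flux (p, q) {v}) = sum s V"
        using sum_flux[OF D(1), of "(p, q)"] fpq(4) by (simp add: sum.distrib)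
      then show "2 * k dvd sum t V - (\<Sum>v\<in>V. s v + flux (p, q) {v})" using D(7) by simp
      show "sum ?c V \<le> 2 * k - 2 + cdist k (sum t V)" using D(8) cA[OF order_refl] x y by simp
      fix A assume A: "A \<noteq> {}" "A \<subset> V" "\<And>z. z \<in> {x} \<Longrightarrow> A \<noteq> {z}"
      have fA: "finite A" using A D(1) finite_subset by blast
      show "2 * k - 2 + cdist k (sum t A) \<le> ecut (E - {e}) h A + sum ?c A"
      proof (cases "x \<in> A")
        case True
        then have "card A \<ge> 2" using card_ge_2I[OF fA A(1)] A(3) by blast
        then show ?thesis using slack[of A] A(2) cr[of A] cA[of A] flux_le_1[of "(x, y)" A] True
          by (auto simp: flux_pair)
      next
        case False
        then show ?thesis using D(12)[OF A] A(2) cr[of A] cA[of A] by (auto simp: flux_pair)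
      qed
    qed (use x in auto)
    moreover have "card (E - {e}) < card E" using D(2) e(1) by (rule card_Diff1_less)
    ultimately have "orientable k V (E - {e}) h (\<lambda>v. t v - (s v + flux (p, q) {v}))"
      by (intro IH) auto
    then have "orientable k V (E - {e}) h (\<lambda>v. (t v - s v) - flux (p, q) {v})"
      by (rule orientable_cong) simp
    then show ?thesis by (rule orientable_add_edge[OF D(2) e(1) pq])
  next
    case False
    then have cx: "c x = 0" "s x = 0" using D(4)[OF x(1)] by auto
    show ?thesis
    proof (cases "\<exists>e\<in>E. \<exists>g\<in>E. \<exists>y z. joins h e x y \<and> joins h g x z \<and> y \<noteq> z \<and> y \<noteq> x \<and> z \<noteq> x")
      case True
      then obtain e g y z where e: "e \<in> E" "g \<in> E" "joins h e x y" "joins h g x z" "y \<noteq> z" "y \<noteq> x" "z \<noteq> x"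
        by blast
      have eg: "e \<noteq> g" using e by (auto simp: joins_def)
      have yz: "y \<in> V" "z \<in> V" using D(3) e by (auto simp: joins_def image_subset_iff)
      note cl = cut_lift[OF D(2) e(1,2) eg e(3,4)]
      have "admissible k V (E - {g}) (h(e := (y, z))) c s t {x}"
      proof (rule admissibleI)
        show "(h(e := (y, z))) ` (E - {g}) \<subseteq> V \<times> V" using D(3) yz by auto
        show "even (t v + c v + ecut (E - {g}) (h(e := (y, z))) {v})" if "v \<in> V" for v
          using D(6)[OF that] by (auto simp: cl)
        fix A assume A: "A \<noteq> {}" "A \<subset> V" "\<And>z. z \<in> {x} \<Longrightarrow> A \<noteq> {z}"
        have fA: "finite A" using A D(1) finite_subset by blast
        show "2 * k - 2 + cdist k (sum t A) \<le> ecut (E - {g}) (h(e := (y, z))) A + sum c A"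
        proof (cases "card A \<ge> 2")
          case True
          then show ?thesis using slack[of A] A(2) cl[of A] by auto
        next
          case False
          then obtain v where v: "A = {v}" "v \<noteq> x" using card_ge_2I[OF fA A(1)] A(3) by blast
          then have "\<not> ((x \<in> A \<and> y \<notin> A \<and> z \<notin> A) \<or> (x \<notin> A \<and> y \<in> A \<and> z \<in> A))" using e(5) by auto
          then show ?thesis using D(12)[OF A] cl[of A] by auto
        qed
      qed (use D in auto)
      moreover have "card (E - {g}) < card E" using D(2) e(2) by (rule card_Diff1_less)
      ultimately have "orientable k V (E - {g}) (h(e := (y, z))) (\<lambda>v. t v - s v)" by (intro IH) auto
      then show ?thesis by (rule orientable_unlift[OF D(2) e(1,2) eg e(3,4)])
    next
      case one: False
      obtain y where y: "\<And>e z. e \<in> E \<Longrightarrow> joins h e x z \<Longrightarrow> z \<noteq> x \<Longrightarrow> z = y" using one by metis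
      let ?V = "V - {x}" and ?I = "inner E h (V - {x})"
      have out: "h e = (x, x) \<or> h e = (x, y) \<or> h e = (y, x)" if "e \<in> E - ?I" for e
      proof -
        have "h e \<in> V \<times> V" "h e \<notin> ?V \<times> ?V" using that D(3) by (auto simp: inner_def)
        then have "\<exists>z. joins h e x z" by (cases "h e") (auto simp: joins_def)
        then show ?thesis using y[of e] that by (auto simp: joins_def)
      qed
      have adm': "admissible k ?V ?I h c s t {}"
      proof (rule admissibleI)
        show "finite ?V" "finite ?I" "h ` ?I \<subseteq> ?V \<times> ?V"
          using D(1,2) finite_subset[OF inner_subset] by (auto simp: inner_def)
        have cI: "ecut ?I h A = ecut E h (if y \<in> A then insert x A else A)" if "A \<subseteq> ?V" for A
        proof -
          let ?B = "if y \<in> A then insert x A else A"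
          have "ecut (E - ?I) h ?B = 0" unfolding ecut_def
          proof (rule sum.neutral, rule ballI)
            fix e assume "e \<in> E - ?I"
            from out[OF this] show "\<bar>flux (h e) ?B\<bar> = 0"
              using that by - (elim disjE, auto simp: flux_pair) 
          qed
          moreover have "ecut ?I h A = ecut ?I h ?B" unfolding ecut_def
            by (rule sum.cong[OF refl]) (use that in \<open>auto simp: inner_def flux_def mem_Times_iff split: if_splits\<close>)
          ultimately show ?thesis using cut_split[OF D(2) inner_subset, of h ?B h ?V] by simp
        qed
        have tI: "2 * k - 2 + cdist k (sum t A) \<le> ecut ?I h A + sum c A" if A: "A \<noteq> {}" "A \<subset> ?V" for A
        proof -
          let ?B = "if y \<in> A then insert x A else A"
          have "?B \<noteq> {}" "?B \<subset> V" "?B \<noteq> {x}" using A x by auto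
          then have 1: "2 * k - 2 + cdist k (sum t ?B) \<le> ecut E h ?B + sum c ?B" by (intro D(12)) auto
          have fA: "finite A" "x \<notin> A" using A D(1) finite_subset by auto
          have "sum c ?B = sum c A" using fA cx by auto
          moreover have "cdist k (sum t ?B) = cdist k (sum t A)"
            by (rule cdist_cong) (use fA x in auto)
          ultimately show ?thesis using 1 cI[of A] A by auto
        qed
        then show "2 * k - 2 + cdist k (sum t A) \<le> ecut ?I h A + sum c A" if "A \<noteq> {}" "A \<subset> ?V" for A
          using that by blast
        show "even (t v + c v + ecut ?I h {v})" if "v \<in> ?V" for v
        proof -
          have "even (sum t (insert x {v}) + sum c (insert x {v}) + ecut E h (insert x {v}))"
            by (rule admissible_parity[OF adm]) (use that x in auto)
          moreover have "even (t x)" using x(2) by (meson dvd_mult_left)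
          ultimately show ?thesis using D(6)[of v] that cI[of "{v}"] cx by auto
        qed
        show "2 * k dvd sum t ?V - sum s ?V" using D(7) split[of t] split[of s] cx x(2)
          by (metis add_0 add_diff_eq dvd_add_right_iff)
        show "sum c ?V \<le> 2 * k - 2 + cdist k (sum t ?V)" using D(8) split[of c] cx tx by simp
      qed (use D in auto)
      have less: "card ?V + card ?I < card V + card E"
        using card_Diff1_less[OF D(1) x(1)] card_mono[OF D(2) inner_subset, of h ?V] by linarith
      show ?thesis
      proof (rule orientable_remove_vertex[OF D(2,3) x(1), where r = 0])
        show "\<bar>0\<bar> \<le> ecut E h {x}" by (simp add: cut_nonneg)
        have "even (t x)" using x(2) by (meson dvd_mult_left)
        then show "even (0 + ecut E h {x})" using D(6)[OF x(1)] cx by simp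
        show "2 * k dvd 0 - (t x - s x)" using x(2) cx by simp
        fix \<sigma> :: "'e \<Rightarrow> int" assume s: "sign_fun \<sigma>" "net \<sigma> (E - ?I) h {x} = 0"
        have "net \<sigma> (E - ?I) h {v} = 0" if "v \<in> ?V" for v
        proof (cases "v = y")
          case True
          have "net \<sigma> (E - ?I) h {y} = - net \<sigma> (E - ?I) h {x}" unfolding net_def sum_negf[symmetric]
          proof (rule sum.cong[OF refl])
            fix e assume "e \<in> E - ?I"
            from out[OF this] show "\<sigma> e * flux (h e) {y} = - (\<sigma> e * flux (h e) {x})"
              using True that by (elim disjE) (auto simp: flux_pair)
          qed
          then show ?thesis using s True by simp
        next
          case False
          show ?thesis unfolding net_def
          proof (rule sum.neutral, rule ballI)
            fix e assume "e \<in> E - ?I"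
            from out[OF this] show "\<sigma> e * flux (h e) {v} = 0"
              using False that by (elim disjE) (auto simp: flux_pair)
          qed
        qed
        then show "orientable k ?V ?I h (\<lambda>v. t v - s v - net \<sigma> (E - ?I) h {v})"
          using orientable_cong[OF IH[OF adm' less]] by simp
      qed
    qed
  qed
qed

text \<open>This is the case in which every vertex can afford to lose an outgoing edge but none can afford to lose an incoming one, so no edge can be deleted
directly. Then every demand is congruent to a number strictly between \<open>0\<close> and \<open>k\<close>, and the bound at every single vertex is tight.
Edges towards the distinguished vertex are deleted one at a time. Once there are none, choose a vertex \<open>v\<close>
and add edges from \<open>v\<close> to the distinguished vertex until the demand of \<open>v\<close> is \<open>k\<close> modulo \<open>2 * k\<close>; there the
directions are equivalent, and an edge can be deleted as one entering \<open>v\<close>. The degree bound of the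
distinguished vertex survives because all its previous edges leave it, so there are at most \<open>2 * k - 1\<close> of them.\<close>

lemma orientable_all_positive:
  fixes h :: "'e \<Rightarrow> 'v \<times> 'v"
  assumes adm: "admissible k V E h c s t {}" and k: "k \<ge> 2" and V2: "card V \<ge> 2"
    and strict: "\<And>A. card A \<ge> 2 \<Longrightarrow> A \<subset> V \<Longrightarrow> 2 * k - 2 + cdist k (sum t A) < ecut E h A + sum c A"
    and nz: "\<And>v. v \<in> V \<Longrightarrow> \<not> 2 * k dvd t v"
    and nin: "\<And>v. v \<in> V \<Longrightarrow> ecut E h {v} + c v < 2 * k - 2 + cdist k (t v + 1) + 1"
    and IH: "\<And>V' E' h' c' s' t' X'. admissible k V' (E' :: 'e set) h' c' s' (t' :: 'v \<Rightarrow> int) X' \<Longrightarrow> card V' + card E' < card V + card E \<Longrightarrow>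
       orientable k V' E' h' (\<lambda>v. t' v - s' v)"
    and IH2: "\<And>c' s' t'. admissible k V E h c' s' t' {} \<Longrightarrow> sum c' V < sum c V \<Longrightarrow> orientable k V E h (\<lambda>v. t' v - s' v)"
  shows "orientable k V E h (\<lambda>v. t v - s v)"
proof -
  note D = admissibleD[OF adm]
  have k0: "k > 0" using k by simp
  have one: "2 * k - 2 + cdist k (t v) \<le> ecut E h {v} + c v" if "v \<in> V" for v
    using D(12)[of "{v}"] psubset_card_1[OF D(1) that V2] by simp
  have out: "2 * k - 2 + cdist k (t v - 1) + 1 \<le> ecut E h {v} + c v" if "v \<in> V" for v
    using cdist_step_towards[OF k0 nz[OF that]] nin[OF that] one[OF that] by auto
  show ?thesis
  proof (cases "\<exists>v\<in>V. - c v < s v")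
    case True
    then obtain v where v: "v \<in> V" "- c v < s v" by blast
    let ?g = "\<lambda>g w. g w + (if w = v then - 1 else 0 :: int)"
    have "admissible k V E h (?g c) (?g s) (?g t) {}"
      by (rule admissible_lower[OF adm k0 v out[OF v(1)] strict])
    moreover have "sum (?g c) V < sum c V" using v sum_bump[OF D(1), of c v "- 1"] by simp
    ultimately have "orientable k V E h (\<lambda>w. ?g t w - ?g s w)" by (rule IH2)
    then show ?thesis by (rule orientable_cong) auto
  next
    case False
    have sc: "s v = - c v" if "v \<in> V" for v using False D(4)[OF that] that by force
    define d where "d = sum c V"
    have d0: "0 \<le> d" unfolding d_def using D(4) by (intro sum_nonneg) force
    have sd: "sum s V = - d" unfolding d_def using sc by (simp add: sum_negf)
    have td: "cdist k (sum t V + i) = cdist k (d - i)" for i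
    proof -
      have "cdist k (sum t V + i) = cdist k (- (d - i))"
        by (rule cdist_cong) (use D(7) sd in simp)
      then show ?thesis using cdist_minus[OF k0, of "i - d"] by simp
    qed
    \<comment> \<open>All \<open>d\<close> edges at the distinguished vertex leave it, so its residue is that of \<open>d\<close> itself.\<close>
    have dd: "d \<le> 2 * k - 2 + cdist k d" using D(8) td[of 0] by (simp add: d_def)
    have d1: "d \<le> 2 * k - 1"
    proof (rule ccontr)
      assume "\<not> ?thesis"
      moreover have "cdist k d = cdist k (d - 2 * k)" by (rule cdist_cong) simp
      ultimately show False using dd cdist_le_abs[OF k0, of "d - 2 * k"] by linarith
    qed
    obtain v where v: "v \<in> V" using V2 by fastforce
    have "ecut E h {v} > 0" using admissible_cut_pos[OF adm k _ psubset_card_1[OF D(1) v V2]] by simp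
    from cut_edge[OF this] obtain e w y where "e \<in> E" "joins h e w y" "w \<in> {v}" "y \<notin> {v}" .
    then have e: "e \<in> E" "joins h e v y" "y \<noteq> v" by auto
    have y: "y \<in> V" using D(3) e by (auto simp: joins_def image_subset_iff)
    obtain r where r: "2 * k dvd t v - r" "- k < r" "r \<le> k" "cdist k (t v) = \<bar>r\<bar>"
      using cdist_repr[OF k0] by blast
    have up: "cdist k (t v + 1) = cdist k (r + 1)" by (rule cdist_cong) (use r in simp)
    have r1: "1 \<le> r"
    proof (rule ccontr)
      assume "\<not> 1 \<le> r"
      moreover have "r \<noteq> 0" using r(1) nz[OF v] by auto
      ultimately show False using cdist_le_abs[OF k0, of "r + 1"] up nin[OF v] one[OF v] r(4) by linarith
    qed
    have rk: "r \<noteq> k"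
    proof
      assume rk: "r = k"
      have "cdist k (k + 1) = cdist k (1 - k)" by (rule cdist_cong) simp
      then have "cdist k (t v + 1) \<le> \<bar>1 - k\<bar>" using cdist_le_abs[OF k0, of "1 - k"] up rk by simp
      then show False using rk nin[OF v] one[OF v] r(4) k by linarith
    qed
    have par: "even (t v + (ecut E h {v} + c v))" using D(6)[OF v] by (simp add: ac_simps)
    have W: "ecut E h {v} + c v = 2 * k - 2 + r"
    proof (rule ccontr)
      assume "\<not> ?thesis"
      then have "2 * k - 2 + cdist k (t v) < ecut E h {v} + c v" using one[OF v] r(4) r1 by simp
      then have "2 * k + cdist k (t v) \<le> ecut E h {v} + c v" by (rule slack_two[OF k0 par])
      then show False using nin[OF v] cdist_shift[OF k0, of "t v" 1] by simp
    qed
    \<comment> \<open>Adding \<open>j\<close> edges brings the demand of \<open>v\<close> to the residue \<open>k\<close>.\<close>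
    define j where "j = k - r"
    have j: "1 \<le> j" "j \<le> k - 1" using r1 rk r(3) by (auto simp: j_def)
    let ?g = "\<lambda>g w. g w + (if w = v then j else 0 :: int)"
    have adm1: "admissible k V E h (?g c) (?g s) (?g t) {}"
    proof (rule admissible_raise[OF adm k0 v])
      have "d + j \<le> 2 * k - 2 + cdist k (d - j)"
      proof (cases "d - j \<le> k")
        case True
        have "cdist k (d - j) = \<bar>d - j\<bar>" by (rule cdist_eqI) (use True d0 j k0 in auto)
        then show ?thesis using j d1 by linarith
      next
        case False
        have "cdist k (d - j) = \<bar>d - j - 2 * k\<bar>" by (rule cdist_eqI) (use False d1 j k0 in auto)
        then show ?thesis using j d1 by linarith
      qed
      then show "sum c V + j \<le> 2 * k - 2 + cdist k (sum t V + j)" using td[of j] by (simp add: d_def)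
    qed (use j in simp)
    have adm2: "admissible k V (E - {e}) h (?g c) (?g s) (\<lambda>w. ?g t w - flux (y, v) {w}) {}"
    proof (rule admissible_delete_edge[OF adm1 k0 e(1)])
      show "joins h e y v" using e(2) by (auto simp: joins_def)
      show "y \<noteq> v" by (rule e(3))
      show "2 * k - 2 + cdist k (?g t y - 1) + 1 \<le> ecut E h {y} + ?g c y" using out[OF y] e(3) by simp
      have "cdist k (?g t v + 1) = \<bar>1 - k\<bar>"
      proof (rule cdist_eqI)
        have "?g t v + 1 - (1 - k) = (t v - r) + 2 * k" by (simp add: j_def)
        then show "2 * k dvd ?g t v + 1 - (1 - k)" using dvd_add[OF r(1) dvd_refl] by (simp only:)
      qed (use k0 in auto)
      then show "2 * k - 2 + cdist k (?g t v + 1) + 1 \<le> ecut E h {v} + ?g c v"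
        using W k by (simp add: j_def)
      fix A assume A: "card A \<ge> 2" "A \<subset> V"
      have fA: "finite A" using A D(1) finite_subset by blast
      show "2 * k - 2 + cdist k (sum (?g t) A) < ecut E h A + sum (?g c) A"
        using strict[OF A] cdist_shift[OF k0, of "sum t A" j] j by (simp add: sum_bump[OF fA])
    qed
    have "card (E - {e}) < card E" using D(2) e(1) by (rule card_Diff1_less)
    then have "orientable k V (E - {e}) h (\<lambda>w. (?g t w - flux (y, v) {w}) - ?g s w)" by (intro IH[OF adm2]) auto
    then have "orientable k V (E - {e}) h (\<lambda>w. (t w - s w) - flux (y, v) {w})" by (rule orientable_cong) auto
    moreover have "joins h e y v" using e(2) by (auto simp: joins_def)
    ultimately show ?thesis by (intro orientable_add_edge[OF D(2) e(1), of h y v k V "\<lambda>w. t w - s w"])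
  qed
qed

text \<open>Every vertex can afford to lose an outgoing or an incoming edge. By connectivity, either some edge leads from a
vertex of the first kind to one of the second and can be deleted, or all vertices are exclusively of
one kind. The second kind is reduced to the first by reversing all directions.\<close>

lemma orientable_nonexempt:
  fixes h :: "'e \<Rightarrow> 'v \<times> 'v"
  assumes adm: "admissible k V E h c s t {}" and k: "k \<ge> 2" and V2: "card V \<ge> 2"
    and strict: "\<And>A. card A \<ge> 2 \<Longrightarrow> A \<subset> V \<Longrightarrow> 2 * k - 2 + cdist k (sum t A) < ecut E h A + sum c A"
    and nz: "\<And>v. v \<in> V \<Longrightarrow> \<not> 2 * k dvd t v"
    and IH: "\<And>V' E' h' c' s' t' X'. admissible k V' (E' :: 'e set) h' c' s' (t' :: 'v \<Rightarrow> int) X' \<Longrightarrow> card V' + card E' < card V + card E \<Longrightarrow>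
       orientable k V' E' h' (\<lambda>v. t' v - s' v)"
    and IH2: "\<And>c' s' t'. admissible k V E h c' s' t' {} \<Longrightarrow> sum c' V < sum c V \<Longrightarrow> orientable k V E h (\<lambda>v. t' v - s' v)"
  shows "orientable k V E h (\<lambda>v. t v - s v)"
proof -
  note D = admissibleD[OF adm]
  have k0: "k > 0" using k by simp
  define out_ok where "out_ok v \<longleftrightarrow> 2 * k - 2 + cdist k (t v - 1) + 1 \<le> ecut E h {v} + c v" for v
  define in_ok where "in_ok v \<longleftrightarrow> 2 * k - 2 + cdist k (t v + 1) + 1 \<le> ecut E h {v} + c v" for v
  have or: "out_ok v \<or> in_ok v" if "v \<in> V" for v
    using cdist_step_towards[OF k0 nz[OF that]] D(12)[of "{v}"] psubset_card_1[OF D(1) that V2]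
    unfolding out_ok_def in_ok_def by auto
  show ?thesis
  proof (cases "\<exists>e\<in>E. \<exists>x y. joins h e x y \<and> x \<noteq> y \<and> out_ok x \<and> in_ok y")
    case True
    then obtain e x y where e: "e \<in> E" "joins h e x y" "x \<noteq> y" "out_ok x" "in_ok y" by blast
    have "admissible k V (E - {e}) h c s (\<lambda>v. t v - flux (x, y) {v}) {}"
      using e(4,5) unfolding out_ok_def in_ok_def
      by (rule admissible_delete_edge[OF adm k0 e(1-3) _ _ strict])
    moreover have "card (E - {e}) < card E" using D(2) e(1) by (rule card_Diff1_less)
    ultimately have "orientable k V (E - {e}) h (\<lambda>v. t v - flux (x, y) {v} - s v)" by (intro IH) auto
    then have "orientable k V (E - {e}) h (\<lambda>v. (t v - s v) - flux (x, y) {v})" by (rule orientable_cong) simp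
    then show ?thesis by (rule orientable_add_edge[OF D(2) e(1,2)])
  next
    case False
    then have no: "\<not> (out_ok x \<and> in_ok y)" if "e \<in> E" "joins h e x y" "x \<noteq> y" for e x y using that by blast
    have edge: "\<exists>e\<in>E. \<exists>x\<in>A. \<exists>y\<in>V - A. joins h e x y" if A: "A \<noteq> {}" "A \<subset> V" for A
    proof -
      obtain e x y where e: "e \<in> E" "joins h e x y" "x \<in> A" "y \<notin> A"
        by (rule cut_edge[OF admissible_cut_pos[OF adm k A]])
      moreover have "y \<in> V" using D(3) e by (auto simp: joins_def image_subset_iff)
      ultimately show ?thesis by blast
    qed
    consider (all_out) "\<And>v. v \<in> V \<Longrightarrow> \<not> in_ok v" | (all_in) "\<And>v. v \<in> V \<Longrightarrow> \<not> out_ok v"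
      | (mixed) p q where "p \<in> V" "in_ok p" "q \<in> V" "out_ok q" by blast
    then show ?thesis
    proof cases
      case all_out
      then have "ecut E h {v} + c v < 2 * k - 2 + cdist k (t v + 1) + 1" if "v \<in> V" for v
        using that unfolding in_ok_def by (simp add: not_le)
      then show ?thesis by (intro orientable_all_positive[OF adm k V2 strict nz _ IH IH2])
    next
      case all_in
      have shift: "cdist k (- t v + 1) = cdist k (t v - 1)" for v
        using cdist_minus[OF k0, of "t v - 1"] by simp
      have "orientable k V E h (\<lambda>v. - t v - - s v)"
      proof (rule orientable_all_positive[OF admissible_reverse[OF adm k0] k V2 _ _ _ IH IH2])
        show "2 * k - 2 + cdist k (\<Sum>v\<in>A. - t v) < ecut E h A + sum c A" if "card A \<ge> 2" "A \<subset> V" for A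
          using strict[OF that] cdist_minus[OF k0] by (simp add: sum_negf)
        show "\<not> 2 * k dvd - t v" if "v \<in> V" for v using nz[OF that] by simp
        show "ecut E h {v} + c v < 2 * k - 2 + cdist k (- t v + 1) + 1" if "v \<in> V" for v
          using all_in[OF that] unfolding out_ok_def shift by (simp add: not_le)
      qed
      then have "orientable k V E h (\<lambda>v. - (t v - s v))" by (rule orientable_cong) simp
      then show ?thesis by (rule orientable_reverse)
    next
      case mixed
      have False
      proof (cases "\<forall>v\<in>V. in_ok v")
        case True
        have "{q} \<subset> V" using psubset_card_1[OF D(1) mixed(3) V2] .
        then obtain e y where "e \<in> E" "y \<in> V - {q}" "joins h e q y" using edge[of "{q}"] by auto
        then show False using no[of e q y] mixed(4) True by auto
      next
        case False
        then obtain e x y where "e \<in> E" "x \<in> {v\<in>V. in_ok v}" "y \<in> V - {v\<in>V. in_ok v}" "joins h e x y"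
          using edge[of "{v\<in>V. in_ok v}"] mixed by blast
        moreover from this have "joins h e y x" "out_ok y" using or by (auto simp: joins_def)
        ultimately show False using no[of e y x] by auto
      qed
      then show ?thesis ..
    qed
  qed
qed

text \<open>The reductions decrease the number of vertices plus edges, except for the deletion of edges at the distinguished vertex, which is
covered by an inner induction on the total of \<open>c\<close>.\<close>

theorem admissible_orientable:
  fixes h :: "'e \<Rightarrow> 'v \<times> 'v"
  assumes "k \<ge> 2" "admissible k V E h c s t X"
  shows "orientable k V E h (\<lambda>v. t v - s v)"
  using assms(2)
proof (induction "card V + card E" arbitrary: V E h c s t X rule: less_induct)
  case less
  note IH = less.hyps
  have k0: "k > 0" using assms(1) by simp
  have main: "orientable k V E h (\<lambda>v. t v - s v)" if "admissible k V E h c s t X" for c s t X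
    using that
  proof (induction "nat (sum c V)" arbitrary: c s t X rule: less_induct)
    case (less c s t X)
    note adm = less.prems
    note D = admissibleD[OF adm]
    have IH2: "orientable k V E h (\<lambda>v. t' v - s' v)"
      if "admissible k V E h c' s' t' {}" "sum c' V < sum c V" for c' s' t'
    proof (rule less.hyps[OF _ that(1)])
      have "0 \<le> sum c' V" using admissibleD(4)[OF that(1)] by (intro sum_nonneg) force
      then show "nat (sum c' V) < nat (sum c V)" using that(2) by simp
    qed
    show ?case
    proof (cases "\<exists>A. card A \<ge> 2 \<and> A \<subset> V \<and> ecut E h A + sum c A \<le> 2 * k - 2 + cdist k (sum t A)")
      case True
      then obtain A where A: "A \<subset> V" "card A \<ge> 2" "ecut E h A + sum c A \<le> 2 * k - 2 + cdist k (sum t A)"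
        by blast
      show ?thesis by (rule orientable_tight[OF adm A IH])
    next
      case False
      then have strict: "2 * k - 2 + cdist k (sum t A) < ecut E h A + sum c A" if "card A \<ge> 2" "A \<subset> V" for A
        using that by (meson not_le)
      show ?thesis
      proof (cases "card V < 2")
        case True
        then show ?thesis by (rule orientable_single[OF adm])
      next
        case V2: False
        show ?thesis
        proof (cases "\<exists>x\<in>V. 2 * k dvd t x")
          case True
          have "\<exists>x\<in>V. 2 * k dvd t x \<and> X \<subseteq> {x}"
          proof (cases "X = {}")
            case True
            then show ?thesis using \<open>\<exists>x\<in>V. 2 * k dvd t x\<close> by auto
          next
            case False
            then obtain x where x: "x \<in> X" by blast
            then have "X \<subseteq> {x}" using D(11) by auto
            then show ?thesis using x D(9,10) by auto
          qed
          then obtain x where x: "x \<in> V" "2 * k dvd t x" "X \<subseteq> {x}" by blast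
          \<comment> \<open>Exempting a vertex only weakens the hypotheses.\<close>
          have "admissible k V E h c s t {x}"
          proof (rule admissibleI)
            fix A assume A: "A \<noteq> {}" "A \<subset> V" "\<And>z. z \<in> {x} \<Longrightarrow> A \<noteq> {z}"
            show "2 * k - 2 + cdist k (sum t A) \<le> ecut E h A + sum c A"
              by (rule D(12)[OF A(1,2)]) (use A(3) x(3) in auto)
          next
            show "even (c v + s v)" "even (t v + c v + ecut E h {v})" if "v \<in> V" for v
              using D(5,6)[OF that] by blast+
          qed (use D(1-4,7,8) x in auto)
          then show ?thesis by (rule orientable_exempt[OF _ assms(1) strict IH])
        next
          case False
          then have X: "X = {}" using D(9,10) by auto
          have "\<not> 2 * k dvd t v" if "v \<in> V" for v using False that by blast
          moreover have "card V \<ge> 2" using V2 by simp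
          ultimately show ?thesis using adm unfolding X
            by (intro orientable_nonexempt[OF _ assms(1) _ strict _ IH IH2])
        qed
      qed
    qed
  qed
  show ?case by (rule main[OF less.prems])
qed

section \<open>Graphs with many edge-disjoint spanning trees\<close>

text \<open>Connectivity in terms of cuts; in this form it passes to contractions without further argument.\<close>

definition spans :: "'v set \<Rightarrow> 'e set \<Rightarrow> ('e \<Rightarrow> 'v \<times> 'v) \<Rightarrow> bool" where
  "spans V F h \<longleftrightarrow> (\<forall>A. A \<noteq> {} \<longrightarrow> A \<subset> V \<longrightarrow> (\<exists>e\<in>F. flux (h e) A \<noteq> 0))"

lemma flux_eq_0_iff: "flux a A = 0 \<longleftrightarrow> (fst a \<in> A \<longleftrightarrow> snd a \<in> A)"
  by (auto simp: flux_def)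

lemma spansD: 
  assumes "spans V F h" "A \<noteq> {}" "A \<subset> V" obtains e where "e \<in> F" "flux (h e) A \<noteq> 0"
  using assms unfolding spans_def by meson

lemma flux_compl:
  assumes "a \<in> V \<times> V" shows "flux a (V - A) = 0 \<longleftrightarrow> flux a A = 0"
  using assms by (cases a) (auto simp: flux_pair)

text \<open>Let \<open>C\<close> be a side of the cut in which \<open>e\<close> is the only edge, not containing its end \<open>v\<close>. Moving that
end to any vertex \<open>y\<close> outside \<open>C\<close> still connects \<open>C\<close> to the rest.\<close>

lemma spans_redirect:
  assumes sp: "spans V F h" and h: "h ` F \<subseteq> V \<times> V" and e: "e \<in> F" "joins h e v z" and v: "v \<in> V"
    and C: "C \<subset> V" "v \<notin> C" "z \<in> C" "\<forall>f\<in>F - {e}. flux (h f) C = 0"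
    and y: "y \<notin> C" "y \<in> V"
  shows "spans V F (h(e := (z, y)))"
  unfolding spans_def
proof (intro allI impI, rule ccontr)
  fix A assume A: "A \<noteq> {}" "A \<subset> V" and no: "\<not> (\<exists>f\<in>F. flux ((h(e := (z, y))) f) A \<noteq> 0)"
  have F0: "flux (h f) A = 0" if "f \<in> F - {e}" for f using no that by auto
  have zy: "z \<in> A \<longleftrightarrow> y \<in> A" using no e(1) by (force simp: flux_eq_0_iff)
  define B where "B = (if v \<in> A then V - A else A)"
  have B: "B \<noteq> {}" "B \<subset> V" "v \<notin> B" using A v by (auto simp: B_def)
  have zV: "z \<in> V" using C by auto
  have zyB: "z \<in> B \<longleftrightarrow> y \<in> B" using zy y zV by (auto simp: B_def)
  have FB: "flux (h f) B = 0" if "f \<in> F - {e}" for f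
  proof -
    have "h f \<in> V \<times> V" using h that by blast
    then show ?thesis using F0[OF that] flux_compl[of "h f" V A] by (simp add: B_def)
  qed
  obtain f where f: "f \<in> F" "flux (h f) B \<noteq> 0" using spansD[OF sp B(1,2)] .
  have "f = e" using FB f by auto
  then have "z \<in> B" using f(2) e(2) B(3) by (auto simp: joins_def flux_pair split: if_splits)
  then have "y \<in> B - C" using zyB y by auto
  then have BC: "B - C \<noteq> {}" "B - C \<subset> V" using B by auto
  obtain f where f: "f \<in> F" "flux (h f) (B - C) \<noteq> 0" using spansD[OF sp BC] .
  have "f = e"
  proof (rule ccontr)
    assume "f \<noteq> e"
    then have "flux (h f) C = 0" "flux (h f) B = 0" using FB[of f] C(4) f(1) by blast+
    then show False using f(2) by (auto simp: flux_eq_0_iff)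
  qed
  then show False using f(2) e(2) B(3) C(3) by (auto simp: joins_def flux_pair split: if_splits)
qed

lemma bridge_side:
  assumes sp: "spans V F h" and h: "h ` F \<subseteq> V \<times> V" and e: "e \<in> F" "joins h e v z" and v: "v \<in> V"
    and br: "\<not> spans V (F - {e}) h"
  obtains C where "C \<subset> V" "v \<notin> C" "z \<in> C" "\<forall>f\<in>F - {e}. flux (h f) C = 0"
proof -
  obtain A where A: "A \<noteq> {}" "A \<subset> V" and F0: "\<And>f. f \<in> F - {e} \<Longrightarrow> flux (h f) A = 0"
    using br unfolding spans_def by meson
  define B where "B = (if v \<in> A then V - A else A)"
  have B: "B \<noteq> {}" "B \<subset> V" "v \<notin> B" using A v by (auto simp: B_def)
  have FB: "flux (h f) B = 0" if "f \<in> F - {e}" for f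
  proof -
    have "h f \<in> V \<times> V" using h that by blast
    then show ?thesis using F0[OF that] flux_compl[of "h f" V A] by (simp add: B_def)
  qed
  obtain f where f: "f \<in> F" "flux (h f) B \<noteq> 0" using spansD[OF sp B(1,2)] .
  have "f = e" using FB f by auto
  then have "z \<in> B" using f(2) e(2) B(3) by (auto simp: joins_def flux_pair split: if_splits)
  then show ?thesis using that[OF B(2,3)] FB by blast
qed

text \<open>If two edges at \<open>v\<close> are bridges of a connected edge set, the far sides of the two bridges are disjoint, so \<open>y\<close> misses
one of them.\<close>

lemma spans_exchange:
  assumes sp: "spans V F h" and h: "h ` F \<subseteq> V \<times> V" and v: "v \<in> V"
    and e: "e \<in> F" "joins h e v z" "f \<in> F" "joins h f v w" "e \<noteq> f"
    and br: "\<not> spans V (F - {e}) h" "\<not> spans V (F - {f}) h" and y: "y \<in> V"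
  shows "spans V F (h(e := (z, y))) \<or> spans V F (h(f := (w, y)))"
proof -
  obtain C where C: "C \<subset> V" "v \<notin> C" "z \<in> C" "\<forall>f\<in>F - {e}. flux (h f) C = 0"
    using bridge_side[OF sp h e(1,2) v br(1)] .
  obtain D where D: "D \<subset> V" "v \<notin> D" "w \<in> D" "\<forall>g\<in>F - {f}. flux (h g) D = 0"
    using bridge_side[OF sp h e(3,4) v br(2)] .
  have "flux (h e) D = 0" "flux (h f) C = 0" using C(4) D(4) e by blast+
  then have "z \<notin> D" "w \<notin> C" using e C(2) D(2) by (auto simp: joins_def flux_eq_0_iff)
  have "C \<inter> D = {}"
  proof (rule ccontr)
    assume ne: "C \<inter> D \<noteq> {}"
    have ss: "C \<inter> D \<subset> V" using C by auto
    obtain g where g: "g \<in> F" "flux (h g) (C \<inter> D) \<noteq> 0" using spansD[OF sp ne ss] .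
    have "g = e \<or> g = f"
    proof (rule ccontr)
      assume "\<not> (g = e \<or> g = f)"
      then have "flux (h g) C = 0" "flux (h g) D = 0" using C(4) D(4) g(1) by blast+
      then show False using g(2) by (auto simp: flux_eq_0_iff)
    qed
    then show False using g(2) e C(2) D(2) \<open>z \<notin> D\<close> \<open>w \<notin> C\<close>
      by (auto simp: joins_def flux_pair split: if_splits)
  qed
  then have "y \<notin> C \<or> y \<notin> D" by auto
  then show ?thesis
    using spans_redirect[OF sp h e(1,2) v C _ y] spans_redirect[OF sp h e(3,4) v D _ y] by blast
qed

text \<open>Among \<open>d\<close> edges at a vertex every residue modulo \<open>2 * k\<close> of the right parity can be realised once
\<open>d \<ge> k - 1\<close>.\<close>

lemma exists_representative:
  assumes "k \<ge> 2" "k - 1 \<le> d" "even (u + d)"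
  obtains r where "\<bar>r\<bar> \<le> d" "even (r + d)" "2 * k dvd r - (u :: int)"
proof -
  obtain r where r: "2 * k dvd u - r" "- k < r" "r \<le> k" using cdist_repr[of k u] assms(1) by auto
  have e: "even (u - r)" using r(1) by (meson dvd_mult_left)
  then have par: "even (r + d)" using assms(3) by presburger
  have "\<bar>r\<bar> \<le> d"
  proof (rule ccontr)
    assume "\<not> ?thesis"
    then have "r = k" "d = k - 1" using r(2,3) assms(1,2) by linarith+
    then show False using par by presburger
  qed
  then show ?thesis using that par r(1) by (simp add: dvd_diff_commute)
qed

lemma sum_cut_disjoint:
  assumes "finite J" "\<And>j. j \<in> J \<Longrightarrow> finite (F j)" "disjoint_family_on F J"
  shows "(\<Sum>j\<in>J. ecut (F j) h S) = ecut (\<Union>j\<in>J. F j) h S"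
  unfolding ecut_def
  by (rule sum.UNION_disjoint[symmetric]) (use assms in \<open>auto simp: disjoint_family_on_def\<close>)

definition packing :: "nat \<Rightarrow> 'v set \<Rightarrow> 'e set \<Rightarrow> ('e \<Rightarrow> 'v \<times> 'v) \<Rightarrow> (nat \<Rightarrow> 'e set) \<Rightarrow> bool" where
  "packing m V E h F \<longleftrightarrow> (\<forall>i<m. F i \<subseteq> E \<and> spans V (F i) h) \<and> disjoint_family_on F {..<m}"

text \<open>The vertex \<open>v\<close> is removed by lifting. The indices in \<open>J\<close> are those whose edge set still uses its edges at
\<open>v\<close> for connectivity; the other edge sets connect the graph without \<open>v\<close> on their own, and their edges at \<open>v\<close> are free.
An edge set of \<open>J\<close> with only one edge at \<open>v\<close> is released from \<open>J\<close>. Otherwise it loses one edge at \<open>v\<close>, either because this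
edge is dispensable, or by lifting it together with a free edge according to \<open>spans_exchange\<close>. A lift costs two edges
at \<open>v\<close> and decreases the excess, the sum over \<open>J\<close> of the number of edges at \<open>v\<close> minus one, by one. Therefore the
hypothesis \<open>deg\<close> is an invariant: it guarantees a free edge whenever one is needed, and at the end at least
\<open>k - 1\<close> edges at \<open>v\<close> for realising the demand of \<open>v\<close>.\<close>

lemma split_off_vertex:
  fixes h :: "'e \<Rightarrow> 'v \<times> 'v"
  assumes k: "k \<ge> 2" and V: "finite V" "v \<in> V" "V \<noteq> {v}"
    and rest: "\<And>E (h :: 'e \<Rightarrow> 'v \<times> 'v) F u. finite E \<Longrightarrow> h ` E \<subseteq> (V - {v}) \<times> (V - {v}) \<Longrightarrow> packing m (V - {v}) E h F \<Longrightarrow>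
       (\<And>w. w \<in> V - {v} \<Longrightarrow> even (u w + ecut E h {w})) \<Longrightarrow> 2 * k dvd sum u (V - {v}) \<Longrightarrow>
       orientable k (V - {v}) E h u"
    and J: "J \<subseteq> {..<m}"
    and E: "finite E" "h ` E \<subseteq> V \<times> V" and F: "\<And>i. i < m \<Longrightarrow> F i \<subseteq> E" "disjoint_family_on F {..<m}"
    and FJ: "\<And>i. i \<in> J \<Longrightarrow> spans V (F i) h"
    and FL: "\<And>i. i < m \<Longrightarrow> i \<notin> J \<Longrightarrow> spans (V - {v}) {e\<in>F i. flux (h e) {v} = 0} h"
    and u: "\<And>w. w \<in> V \<Longrightarrow> even (u w + ecut E h {w})" "2 * k dvd sum u V"
    and deg: "k - 1 \<le> ecut E h {v} - 2 * ((\<Sum>i\<in>J. ecut (F i) h {v}) - int (card J))"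
  shows "orientable k V E h u"
  using J E F FJ FL u(1) deg
proof (induction "nat (\<Sum>i\<in>J. ecut (F i) h {v})" arbitrary: J E F h rule: less_induct)
  case less
  note J = less.prems(1) and E = less.prems(2,3) and F = less.prems(4,5)
    and FJ = less.prems(6) and FL = less.prems(7) and u1 = less.prems(8) and deg = less.prems(9)
  have fJ: "finite J" using J finite_subset by blast
  have q0: "0 \<le> (\<Sum>i\<in>J. ecut (F i) h {v})" by (intro sum_nonneg cut_nonneg)
  have fF: "finite (F i)" if "i < m" for i using F(1)[OF that] E(1) finite_subset by blast
  have hF: "h ` F i \<subseteq> V \<times> V" if "i < m" for i using F(1)[OF that] E(2) by blast
  have Jm: "i < m" if "i \<in> J" for i using J that by auto
  have vV: "{v} \<subset> V" using V by auto
  have q1: "1 \<le> ecut (F i) h {v}" if iJ: "i \<in> J" for i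
  proof -
    obtain e where e: "e \<in> F i" "flux (h e) {v} \<noteq> 0" using spansD[OF FJ[OF iJ] insert_not_empty vV] .
    have "0 < ecut (F i) h {v}" unfolding ecut_def
      by (rule sum_pos2[OF fF[OF Jm[OF that]] e(1)]) (use e(2) in auto)
    then show ?thesis by simp
  qed
  show ?case
  proof (cases "J = {}")
    case True
    let ?V = "V - {v}" and ?I = "inner E h (V - {v})"
    obtain r where r: "\<bar>r\<bar> \<le> ecut E h {v}" "even (r + ecut E h {v})" "2 * k dvd r - u v"
      using exists_representative[OF k, of "ecut E h {v}" "u v"] deg u1[OF V(2)] True by auto
    show ?thesis
    proof (rule orientable_remove_vertex[where u = u and r = r, OF E V(2) r])
      fix \<sigma> :: "'e \<Rightarrow> int" assume s: "sign_fun \<sigma>" "net \<sigma> (E - ?I) h {v} = r"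
      show "orientable k ?V ?I h (\<lambda>w. u w - net \<sigma> (E - ?I) h {w})"
      proof (rule rest)
        show "finite ?I" "h ` ?I \<subseteq> ?V \<times> ?V" using E finite_subset[OF inner_subset] by (auto simp: inner_def)
        show "packing m ?V ?I h (\<lambda>i. F i \<inter> ?I)" unfolding packing_def
        proof (intro conjI allI impI)
          fix i assume i: "i < m"
          show "F i \<inter> ?I \<subseteq> ?I" by auto
          show "spans ?V (F i \<inter> ?I) h" unfolding spans_def
          proof (intro allI impI)
            fix A assume A: "A \<noteq> {}" "A \<subset> ?V"
            have sp: "spans ?V {e\<in>F i. flux (h e) {v} = 0} h" using FL[OF i] True by simp
            obtain e where e: "e \<in> {e\<in>F i. flux (h e) {v} = 0}" "flux (h e) A \<noteq> 0"
              using spansD[OF sp A] .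
            then have "h e \<in> V \<times> V" using hF[OF i] by blast
            then have "e \<in> ?I" using e A F(1)[OF i]
              by (cases "h e") (auto simp: inner_def flux_pair split: if_splits)
            then show "\<exists>e\<in>F i \<inter> ?I. flux (h e) A \<noteq> 0" using e by auto
          qed
        next
          show "disjoint_family_on (\<lambda>i. F i \<inter> ?I) {..<m}" using F(2) unfolding disjoint_family_on_def by blast
        qed
        show "even (u w - net \<sigma> (E - ?I) h {w} + ecut ?I h {w})" if "w \<in> ?V" for w
          using u1[of w] that net_parity[OF s(1), of "E - ?I" h "{w}"] cut_split[OF E(1) inner_subset, of h "{w}" h ?V]
          by auto
        have "net \<sigma> (E - ?I) h V = 0" unfolding net_def
        proof (rule sum.neutral, rule ballI)
          fix e assume "e \<in> E - ?I"
          then have "h e \<in> V \<times> V" using E by blast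
          then show "\<sigma> e * flux (h e) V = 0" by (cases "h e") (simp add: flux_pair)
        qed
        then have "(\<Sum>w\<in>V. net \<sigma> (E - ?I) h {w}) = 0" using sum_net[OF V(1)] by metis
        then have "(\<Sum>w\<in>?V. net \<sigma> (E - ?I) h {w}) = - r" using V s(2) by (simp add: sum.remove)
        then have "(\<Sum>w\<in>?V. u w - net \<sigma> (E - ?I) h {w}) = sum u V + (r - u v)"
          using V by (simp add: sum_subtractf sum.remove[of V v u])
        then show "2 * k dvd (\<Sum>w\<in>?V. u w - net \<sigma> (E - ?I) h {w})" using u(2) r(3) by simp
      qed
    qed
  next
    case Jne: False
    show ?thesis
    proof (cases "\<exists>i\<in>J. ecut (F i) h {v} = 1")
      case True
      then obtain i where i: "i \<in> J" "ecut (F i) h {v} = 1" by blast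
      have sum_i: "(\<Sum>j\<in>J. ecut (F j) h {v}) = 1 + (\<Sum>j\<in>J - {i}. ecut (F j) h {v})"
        using fJ i by (simp add: sum.remove)
      show ?thesis
      proof (rule less.hyps[OF _ _ E F _ _ u1])
        have "0 \<le> (\<Sum>j\<in>J - {i}. ecut (F j) h {v})" by (intro sum_nonneg cut_nonneg)
        then show "nat (\<Sum>j\<in>J - {i}. ecut (F j) h {v}) < nat (\<Sum>j\<in>J. ecut (F j) h {v})" using sum_i by simp
        show "J - {i} \<subseteq> {..<m}" using J by auto
        show "spans V (F j) h" if "j \<in> J - {i}" for j using FJ that by auto
        show "k - 1 \<le> ecut E h {v} - 2 * ((\<Sum>j\<in>J - {i}. ecut (F j) h {v}) - int (card (J - {i})))"
        proof -
          have "int (card J) = int (card (J - {i})) + 1" using card_Suc_Diff1[OF fJ i(1)] by linarith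
          then show ?thesis using deg sum_i by simp
        qed
        fix j assume j: "j < m" "j \<notin> J - {i}"
        show "spans (V - {v}) {e\<in>F j. flux (h e) {v} = 0} h"
        proof (cases "j = i")
          case False
          then show ?thesis using FL j by auto
        next
          case ji: True
          obtain e where e: "e \<in> F i" "flux (h e) {v} \<noteq> 0" using spansD[OF FJ[OF i(1)] insert_not_empty vV] .
          have only: "f = e" if "f \<in> F i" "flux (h f) {v} \<noteq> 0" for f
          proof (rule ccontr)
            assume "f \<noteq> e"
            have "(\<Sum>g\<in>{e, f}. \<bar>flux (h g) {v}\<bar>) \<le> ecut (F i) h {v}" unfolding ecut_def
              using e that fF[OF Jm[OF i(1)]] by (intro sum_mono2) auto
            then show False using e(2) that(2) i(2) \<open>f \<noteq> e\<close> by auto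
          qed
          show ?thesis unfolding spans_def ji
          proof (intro allI impI, rule ccontr)
            fix A assume A: "A \<noteq> {}" "A \<subset> V - {v}"
              and no: "\<not> (\<exists>f\<in>{e\<in>F i. flux (h e) {v} = 0}. flux (h f) A \<noteq> 0)"
            have A1: "A \<subset> V" "insert v A \<noteq> {}" "insert v A \<subset> V" "v \<notin> A" using A V by auto
            obtain f where f: "f \<in> F i" "flux (h f) A \<noteq> 0" using spansD[OF FJ[OF i(1)] A(1) A1(1)] .
            have "f = e" using only[of f] no f by auto
            obtain g where g: "g \<in> F i" "flux (h g) (insert v A) \<noteq> 0" using spansD[OF FJ[OF i(1)] A1(2,3)] .
            have "g \<noteq> e" using g(2) f(2) e(2) \<open>f = e\<close> A1(4) by (auto simp: flux_eq_0_iff)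
            then have "flux (h g) {v} = 0" using only[of g] g by auto
            then have "flux (h g) A \<noteq> 0" using g(2) A1(4) by (auto simp: flux_eq_0_iff)
            then show False using no g(1) \<open>flux (h g) {v} = 0\<close> by auto
          qed
        qed
      qed
    next
      case False
      have q2: "2 \<le> ecut (F i) h {v}" if "i \<in> J" for i using q1[OF that] False that by force
      obtain i where i: "i \<in> J" using Jne by blast
      have im: "i < m" using Jm[OF i] .
      have sum_i: "(\<Sum>j\<in>J. g j) = g i + (\<Sum>j\<in>J - {i}. g j)" for g :: "nat \<Rightarrow> int"
        using fJ i by (simp add: sum.remove)
      show ?thesis
      proof (cases "\<exists>e\<in>F i. flux (h e) {v} \<noteq> 0 \<and> spans V (F i - {e}) h")
        case True
        then obtain e where e: "e \<in> F i" "flux (h e) {v} \<noteq> 0" "spans V (F i - {e}) h" by blast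
        let ?F = "F(i := F i - {e})"
        have "\<bar>flux (h e) {v}\<bar> = 1" using e(2) flux_le_1[of "h e" "{v}"] by linarith
        then have "ecut (F i - {e}) h {v} = ecut (F i) h {v} - 1"
          unfolding ecut_def using fF[OF im] e(1) by (simp add: sum_diff1)
        then have sumF: "(\<Sum>j\<in>J. ecut (?F j) h {v}) = (\<Sum>j\<in>J. ecut (F j) h {v}) - 1"
          unfolding sum_i[of "\<lambda>j. ecut (?F j) h {v}"] sum_i[of "\<lambda>j. ecut (F j) h {v}"] by simp
        show ?thesis
        proof (rule less.hyps[OF _ J E])
          have "0 \<le> (\<Sum>j\<in>J. ecut (?F j) h {v})" by (intro sum_nonneg cut_nonneg)
          then show "nat (\<Sum>j\<in>J. ecut (?F j) h {v}) < nat (\<Sum>j\<in>J. ecut (F j) h {v})" using sumF by simp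
          show "?F j \<subseteq> E" if "j < m" for j using F(1)[OF that] F(1)[OF im] by auto
          show "disjoint_family_on ?F {..<m}" using F(2) unfolding disjoint_family_on_def by auto
          show "spans V (?F j) h" if "j \<in> J" for j using FJ[OF that] e(3) by auto
          show "spans (V - {v}) {e\<in>?F j. flux (h e) {v} = 0} h" if "j < m" "j \<notin> J" for j
            using FL[OF that] i that(2) by auto
          show "k - 1 \<le> ecut E h {v} - 2 * ((\<Sum>j\<in>J. ecut (?F j) h {v}) - int (card J))" using deg sumF by simp
        qed (use u1 in auto)
      next
        case bridges: False
        \<comment> \<open>Every edge set in \<open>J\<close> has at least two edges at \<open>v\<close>, so the invariant leaves an edge at \<open>v\<close> outside all of them.\<close>
        have "ecut E h {v} > (\<Sum>j\<in>J. ecut (F j) h {v})"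
        proof -
          have "(\<Sum>j\<in>J. 2) \<le> (\<Sum>j\<in>J. ecut (F j) h {v})" by (rule sum_mono) (rule q2)
          then show ?thesis using deg k by simp
        qed
        moreover have "(\<Sum>j\<in>J. ecut (F j) h {v}) = ecut (\<Union>j\<in>J. F j) h {v}"
          by (rule sum_cut_disjoint[OF fJ fF[OF Jm] disjoint_family_on_mono[OF J F(2)]])
        ultimately have lt: "ecut (\<Union>j\<in>J. F j) h {v} < ecut E h {v}" by simp
        have "\<exists>g\<in>E. flux (h g) {v} \<noteq> 0 \<and> g \<notin> (\<Union>j\<in>J. F j)"
        proof (rule ccontr)
          assume "\<not> ?thesis"
          then have *: "g \<in> (\<Union>j\<in>J. F j)" if "g \<in> E" "flux (h g) {v} \<noteq> 0" for g using that by blast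
          have "ecut E h {v} = ecut (\<Union>j\<in>J. F j) h {v}" unfolding ecut_def
          proof (rule sum.mono_neutral_right[OF E(1)])
            show "(\<Union>j\<in>J. F j) \<subseteq> E" using F(1) Jm by blast
            show "\<forall>g\<in>E - (\<Union>j\<in>J. F j). \<bar>flux (h g) {v}\<bar> = 0" using * by (metis DiffE abs_zero)
          qed
          then show False using lt by simp
        qed
        then obtain g where g: "g \<in> E" "flux (h g) {v} \<noteq> 0" "g \<notin> (\<Union>j\<in>J. F j)" by blast
        have "\<exists>e\<in>F i. \<exists>f\<in>F i. e \<noteq> f \<and> flux (h e) {v} \<noteq> 0 \<and> flux (h f) {v} \<noteq> 0"
        proof (rule ccontr)
          assume no: "\<not> ?thesis"
          obtain e where e: "e \<in> F i" "flux (h e) {v} \<noteq> 0" using spansD[OF FJ[OF i] insert_not_empty vV] .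
          have "ecut (F i) h {v} = (\<Sum>f\<in>{e}. \<bar>flux (h f) {v}\<bar>)" unfolding ecut_def
          proof (rule sum.mono_neutral_right[OF fF[OF im]])
            show "{e} \<subseteq> F i" using e(1) by simp
            show "\<forall>f\<in>F i - {e}. \<bar>flux (h f) {v}\<bar> = 0" using no e by (metis DiffE abs_zero singletonI)
          qed
          then show False using q2[OF i] flux_le_1[of "h e" "{v}"] by simp
        qed
        \<comment> \<open>Two edges of \<open>F i\<close> at \<open>v\<close>; both are bridges of \<open>F i\<close> in this case.\<close>
        then obtain e f where ef: "e \<in> F i" "f \<in> F i" "e \<noteq> f" "flux (h e) {v} \<noteq> 0" "flux (h f) {v} \<noteq> 0"
          by blast
        have other: "\<exists>z. joins h a v z \<and> z \<noteq> v \<and> z \<in> V" if "a \<in> E" "flux (h a) {v} \<noteq> 0" for a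
        proof -
          have "h a \<in> V \<times> V" using that(1) E(2) by blast
          then show ?thesis using that(2) by (cases "h a") (auto simp: joins_def flux_pair split: if_splits)
        qed
        have efE: "e \<in> E" "f \<in> E" using ef F(1)[OF im] by auto
        obtain y where y: "joins h g v y" "y \<noteq> v" "y \<in> V" using other[OF g(1,2)] by blast
        obtain z where z: "joins h e v z" "z \<noteq> v" "z \<in> V" using other[OF efE(1) ef(4)] by blast
        obtain w where w: "joins h f v w" "w \<noteq> v" "w \<in> V" using other[OF efE(2) ef(5)] by blast
        have "spans V (F i) (h(e := (z, y))) \<or> spans V (F i) (h(f := (w, y)))"
          using spans_exchange[OF FJ[OF i] hF[OF im] V(2) ef(1) z(1) ef(2) w(1) ef(3) _ _ y(3)] bridges ef by blast
        then obtain a b where a: "a \<in> F i" "joins h a v b" "b \<noteq> v" "b \<in> V" "spans V (F i) (h(a := (b, y)))"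
          using ef z w by blast
        have aE: "a \<in> E" and ag: "a \<noteq> g" using a(1) F(1)[OF im] g(3) i by auto
        have aj: "a \<notin> F j" if "j < m" "j \<noteq> i" for j
          using F(2) that a(1) im unfolding disjoint_family_on_def by auto
        let ?h = "h(a := (b, y))" and ?F = "\<lambda>j. F j - {g}"
        note cl = cut_lift[OF E(1) aE g(1) ag a(2) y(1)]
        have FJg: "?F j = F j" if "j \<in> J" for j using g(3) that by auto
        have hj: "ecut (F j) ?h S = ecut (F j) h S" if "j < m" "j \<noteq> i" for j S
          unfolding ecut_def using aj[OF that] by (intro sum.cong) auto
        have spj: "spans X Y ?h = spans X Y h" if "a \<notin> Y" for X Y
          unfolding spans_def using that by (metis fun_upd_other)
        have "ecut (F i) ?h {v} = ecut (F i) h {v} - 1"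
        proof -
          have "ecut (F i) ?h {v} = \<bar>flux (?h a) {v}\<bar> + ecut (F i - {a}) ?h {v}"
            "ecut (F i) h {v} = \<bar>flux (h a) {v}\<bar> + ecut (F i - {a}) h {v}"
            unfolding ecut_def using fF[OF im] a(1) by (simp_all add: sum.remove)
          moreover have "ecut (F i - {a}) ?h {v} = ecut (F i - {a}) h {v}"
            unfolding ecut_def by (rule sum.cong) auto
          ultimately show ?thesis using a(3) y(2) joins_abs_flux[OF a(2), of "{v}"] by (simp add: flux_pair)
        qed
        moreover have "(\<Sum>j\<in>J - {i}. ecut (?F j) ?h {v}) = (\<Sum>j\<in>J - {i}. ecut (F j) h {v})"
          using FJg hj Jm by (intro sum.cong) auto
        ultimately have sumF: "(\<Sum>j\<in>J. ecut (?F j) ?h {v}) = (\<Sum>j\<in>J. ecut (F j) h {v}) - 1"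
          unfolding sum_i[of "\<lambda>j. ecut (?F j) ?h {v}"] sum_i[of "\<lambda>j. ecut (F j) h {v}"] using FJg[OF i] by simp
        have "orientable k V (E - {g}) ?h u"
        proof (rule less.hyps[OF _ J])
          have "0 \<le> (\<Sum>j\<in>J. ecut (?F j) ?h {v})" by (intro sum_nonneg cut_nonneg)
          then show "nat (\<Sum>j\<in>J. ecut (?F j) ?h {v}) < nat (\<Sum>j\<in>J. ecut (F j) h {v})" using sumF by simp
          show "finite (E - {g})" using E by simp
          show "?h ` (E - {g}) \<subseteq> V \<times> V" using E(2) a(4) y(3) by auto
          show "?F j \<subseteq> E - {g}" if "j < m" for j using F(1)[OF that] by auto
          show "disjoint_family_on ?F {..<m}" using F(2) unfolding disjoint_family_on_def by blast
          show "spans V (?F j) ?h" if "j \<in> J" for j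
          proof (cases "j = i")
            case True
            then show ?thesis using a(5) FJg[OF i] by simp
          next
            case False
            then show ?thesis using spj[of "F j"] aj[OF Jm[OF that]] FJ[OF that] FJg[OF that] by simp
          qed
          show "spans (V - {v}) {e\<in>?F j. flux (?h e) {v} = 0} ?h" if j: "j < m" "j \<notin> J" for j
          proof -
            have "a \<notin> F j" using aj[OF j(1)] i j(2) by auto
            then have "{e\<in>?F j. flux (?h e) {v} = 0} = {e\<in>F j. flux (h e) {v} = 0}" using g(2) by auto
            then show ?thesis using FL[OF j] spj \<open>a \<notin> F j\<close> by simp
          qed
          show "even (u w + ecut (E - {g}) ?h {w})" if "w \<in> V" for w using u1[OF that] by (auto simp: cl)
          have "ecut (E - {g}) ?h {v} = ecut E h {v} - 2" using cl[of "{v}"] a(3) y(2) by simp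
          then show "k - 1 \<le> ecut (E - {g}) ?h {v} - 2 * ((\<Sum>j\<in>J. ecut (?F j) ?h {v}) - int (card J))"
            using deg sumF by simp
        qed
        then show ?thesis by (rule orientable_unlift[OF E(1) aE g(1) ag a(2) y(1)])
      qed
    qed
  qed
qed

text \<open>A vertex set is called bad if it violates the bound of the extension theorem for a graph in which nothing is oriented yet. All
proper subsets of a smallest bad set \<open>A\<close> satisfy the bound, so the extension theorem applies inside \<open>A\<close>
when the contraction of \<open>A\<close> has been oriented by induction. If \<open>A\<close> consists of one vertex \<open>v\<close>, contraction
achieves nothing, but then the degree of \<open>v\<close> is at most \<open>3 * k - 3\<close> and \<open>v\<close> can be split off.\<close>

theorem packing_orientable:
  fixes h :: "'e \<Rightarrow> 'v \<times> 'v"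
  assumes k: "k \<ge> 2" and m: "int m = 2 * k - 2"
    and "finite V" "finite E" "h ` E \<subseteq> V \<times> V" "packing m V E h F"
    and "\<And>v. v \<in> V \<Longrightarrow> even (u v + ecut E h {v})" "2 * k dvd sum u V"
  shows "orientable k V E h u"
  using assms(3-)
proof (induction "card V" arbitrary: V E h F u rule: less_induct)
  case less
  note V = less.prems(1-3) and P = less.prems(4) and u = less.prems(5,6)
  have k0: "k > 0" using k by simp
  define bad where "bad A \<longleftrightarrow> A \<noteq> {} \<and> A \<subset> V \<and> ecut E h A < 2 * k - 2 + cdist k (sum u A)" for A
  show ?case
  proof (cases "\<exists>A. bad A")
    case False
    have "admissible k V E h (\<lambda>_. 0) (\<lambda>_. 0) u {}"
    proof (rule admissibleI)
      show "2 * k - 2 + cdist k (sum u A) \<le> ecut E h A + (\<Sum>v\<in>A. 0)" if "A \<noteq> {}" "A \<subset> V" for A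
      proof -
        have "\<not> bad A" using False by blast
        then show ?thesis using that unfolding bad_def by auto
      qed
      show "(\<Sum>v\<in>V. 0) \<le> 2 * k - 2 + cdist k (sum u V)" using k cdist_nonneg[OF k0] by simp
    qed (use V u in auto)
    from admissible_orientable[OF k this] show ?thesis by simp
  next
    case True
    then obtain A where A: "bad A" and min: "\<And>B. bad B \<Longrightarrow> card A \<le> card B"
      using ex_has_least_nat[of bad _ card] by blast
    have AV: "A \<noteq> {}" "A \<subset> V" and Ac: "ecut E h A < 2 * k - 2 + cdist k (sum u A)"
      using A unfolding bad_def by auto
    have fA: "finite A" using AV V(1) finite_subset by blast
    have sub: "2 * k - 2 + cdist k (sum u B) \<le> ecut E h B" if "B \<noteq> {}" "B \<subset> A" for B
    proof (rule ccontr)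
      assume "\<not> ?thesis"
      then have "bad B" using that AV unfolding bad_def by auto
      then show False using min[of B] psubset_card_mono[OF fA that(2)] by simp
    qed
    have Pi: "F i \<subseteq> E" "spans V (F i) h" if "i < m" for i using P that unfolding packing_def by auto
    have Pd: "disjoint_family_on F {..<m}" using P unfolding packing_def by auto
    show ?thesis
    proof (cases "card A \<ge> 2")
      case True
      obtain z where z: "z \<in> A" using AV by auto
      let ?f = "merge A z" and ?V = "insert z (V - A)"
      have "card ?V < card V"
        using z AV(2) True V(1) fA psubset_card_mono[OF V(1) AV(2)] card_Diff_subset[OF fA]
        by (simp add: psubset_imp_subset)
      have fV: "?f w \<in> ?V" if "w \<in> V" for w using that z by (auto simp: merge_def)
      have hE: "h e \<in> V \<times> V" if "e \<in> E" for e using V(3) that by blast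
      have "orientable k ?V E (map_prod ?f ?f \<circ> h) (\<lambda>v. \<Sum>w\<in>{w\<in>V. ?f w = v}. u w)"
      proof (rule less.hyps[OF \<open>card ?V < card V\<close>])
        show "finite ?V" "finite E" using V by auto
        have "map_prod ?f ?f (h e) \<in> ?V \<times> ?V" if "e \<in> E" for e using hE[OF that] fV by (cases "h e") auto
        then show "(map_prod ?f ?f \<circ> h) ` E \<subseteq> ?V \<times> ?V" unfolding comp_def image_subset_iff by blast
        show "packing m ?V E (map_prod ?f ?f \<circ> h) F" unfolding packing_def
        proof (intro conjI allI impI)
          fix i assume i: "i < m"
          show "F i \<subseteq> E" using Pi[OF i] by simp
          show "spans ?V (F i) (map_prod ?f ?f \<circ> h)" unfolding spans_def
          proof (intro allI impI)
            fix B assume B: "B \<noteq> {}" "B \<subset> ?V"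
            let ?S = "{w\<in>V. ?f w \<in> B}"
            have id: "?f v = v" if "v \<in> ?V" for v using that z by (auto simp: merge_def)
            have VV: "?V \<subseteq> V" using z AV by auto
            have BS: "B \<subseteq> ?S" using B(2) id VV by auto
            obtain b where b: "b \<in> ?V" "b \<notin> B" using B(2) by auto
            have S: "?S \<noteq> {}" "?S \<subset> V" using BS B(1) b id[OF b(1)] VV by auto
            obtain e where e: "e \<in> F i" "flux (h e) ?S \<noteq> 0" using spansD[OF Pi(2)[OF i] S] .
            have "h e \<in> V \<times> V" using e(1) Pi(1)[OF i] hE by auto
            then have "flux ((map_prod ?f ?f \<circ> h) e) B = flux (h e) ?S"
              using flux_merge[of "h e" V ?f B] by (auto simp: mem_Times_iff)
            then show "\<exists>e\<in>F i. flux ((map_prod ?f ?f \<circ> h) e) B \<noteq> 0" using e by metis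
          qed
        qed (rule Pd)
        show "even ((\<Sum>w\<in>{w\<in>V. ?f w = v}. u w) + ecut E (map_prod ?f ?f \<circ> h) {v})" for v
        proof -
          have "even (sum u {w\<in>V. ?f w = v} + sum (\<lambda>_. 0) {w\<in>V. ?f w = v} + ecut E h {w\<in>V. ?f w = v})"
            by (rule even_sum_cut) (use V u(1) in auto)
          then show ?thesis using cut_merge[OF V(3), of ?f "{v}"] by simp
        qed
        have "{w\<in>V. ?f w \<in> ?V} = V" using fV by auto
        then show "2 * k dvd (\<Sum>v\<in>?V. \<Sum>w\<in>{w\<in>V. ?f w = v}. u w)"
          using sum_fibres[OF V(1), where B = ?V and f = ?f and g = u] V(1) u(2) by simp
      qed
      then have outer: "orientable k ?V E (map_prod ?f ?f \<circ> h) (\<lambda>v. \<Sum>w\<in>{w\<in>V. ?f w = v}. u w - 0)" by simp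
      have "orientable k V E h (\<lambda>v. u v - 0)"
      proof (rule glue_admissible[OF V _ z _ _ _ _ _ _ _ _ outer, where c = "\<lambda>_. 0" and X = "{}"])
        show "orientable k A (inner E h A) h (\<lambda>v. u v - s v)"
          if "admissible k A (inner E h A) h c s u {}" for c s
          by (rule admissible_orientable[OF k that])
        show "even (u v + 0 + ecut E h {v})" if "v \<in> A" for v using u(1)[of v] that AV by auto
        show "2 * k - 2 + cdist k (sum u B) \<le> ecut E h B + (\<Sum>v\<in>B. 0)" if "B \<noteq> {}" "B \<subset> A" for B
          using sub[OF that] by simp
        show "ecut E h A + (\<Sum>v\<in>A. 0) \<le> 2 * k - 2 + cdist k (sum u A)" using Ac by simp
      qed (use AV in auto)
      then show ?thesis by simp
    next
      case False
      then obtain v where v: "A = {v}" using card_ge_2I[OF fA AV(1)] by blast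
      have vV: "v \<in> V" "V \<noteq> {v}" using AV v by auto
      have d: "ecut E h {v} \<le> 3 * k - 3" using Ac v cdist_le[OF k0, of "u v"] by simp
      have "(\<Sum>i<m. ecut (F i) h {v}) = ecut (\<Union>i<m. F i) h {v}"
        by (rule sum_cut_disjoint) (use Pd finite_subset[OF Pi(1) V(2)] in auto)
      also have "\<dots> \<le> ecut E h {v}" unfolding ecut_def
        by (rule sum_mono2) (use V(2) Pi(1) in auto)
      finally have le: "(\<Sum>i<m. ecut (F i) h {v}) \<le> ecut E h {v}" .
      show ?thesis
      proof (rule split_off_vertex[OF k V(1) vV _ order_refl V(2,3) Pi(1) Pd Pi(2) _ u])
        show "orientable k (V - {v}) E h u"
          if "finite E" "h ` E \<subseteq> (V - {v}) \<times> (V - {v})" "packing m (V - {v}) E h F"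
            "\<And>w. w \<in> V - {v} \<Longrightarrow> even (u w + ecut E h {w})" "2 * k dvd sum u (V - {v})"
          for E and h :: "'e \<Rightarrow> 'v \<times> 'v" and F u
          using less.hyps[OF card_Diff1_less[OF V(1) vV(1)] _ that] V(1) by simp
        show "k - 1 \<le> ecut E h {v} - 2 * ((\<Sum>i<m. ecut (F i) h {v}) - int (card {..<m}))"
          using d le m by simp
      qed auto
    qed
  qed
qed

section \<open>Balanced colourings of bipartite multigraphs\<close>

text \<open>Hall's marriage theorem, by the argument of Halmos and Vaughan: if some proper nonempty index set is tight, it is
matched within its own neighbourhood and the rest outside it; otherwise an arbitrary first choice leaves enough room.\<close>

lemma hall:
  assumes "finite I" "\<And>i. i \<in> I \<Longrightarrow> finite (A i)" "\<And>J. J \<subseteq> I \<Longrightarrow> card J \<le> card (\<Union>i\<in>J. A i)"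
  shows "\<exists>f. inj_on f I \<and> (\<forall>i\<in>I. f i \<in> A i)"
  using assms
proof (induction "card I" arbitrary: I A rule: less_induct)
  case less
  note fin = less.prems(1,2) and H = less.prems(3)
  show ?case
  proof (cases "I = {}")
    case False
    then obtain i where i: "i \<in> I" by auto
    have fU: "finite (\<Union>j\<in>J. A j)" if "J \<subseteq> I" for J
      using fin finite_subset[OF that] that by blast
    show ?thesis
    proof (cases "\<exists>J. J \<noteq> {} \<and> J \<subset> I \<and> card J = card (\<Union>j\<in>J. A j)")
      case True
      then obtain J where J: "J \<noteq> {}" "J \<subset> I" "card J = card (\<Union>j\<in>J. A j)" by blast
      have fJ: "finite J" using J(2) fin(1) finite_subset by blast
      have cJ: "card J < card I" by (rule psubset_card_mono[OF fin(1) J(2)])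
      have HJ: "card K \<le> card (\<Union>j\<in>K. A j)" if "K \<subseteq> J" for K using H[of K] that J(2) by blast
      have "\<exists>f. inj_on f J \<and> (\<forall>j\<in>J. f j \<in> A j)"
        by (rule less.hyps[OF cJ fJ _ HJ]) (use fin J(2) in auto)
      then obtain f where f: "inj_on f J" "\<And>j. j \<in> J \<Longrightarrow> f j \<in> A j" by blast
      define U where "U = (\<Union>j\<in>J. A j)"
      have cI: "card (I - J) < card I"
        using fin(1) J fJ by (intro psubset_card_mono) auto
      have "\<exists>g. inj_on g (I - J) \<and> (\<forall>j\<in>I - J. g j \<in> A j - U)"
      proof (rule less.hyps[OF cI])
        fix K assume K: "K \<subseteq> I - J"
        have fK: "finite K" using K fin(1) finite_subset by blast
        have "card J + card K = card (J \<union> K)" using K fJ fK by (subst card_Un_disjoint) auto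
        also have "\<dots> \<le> card (\<Union>j\<in>J \<union> K. A j)" using H[of "J \<union> K"] K J(2) by blast
        also have "(\<Union>j\<in>J \<union> K. A j) = U \<union> (\<Union>j\<in>K. A j - U)" by (auto simp: U_def)
        also have "card \<dots> \<le> card U + card (\<Union>j\<in>K. A j - U)" by (rule card_Un_le)
        finally show "card K \<le> card (\<Union>j\<in>K. A j - U)" using J(3) by (simp add: U_def)
      qed (use fin in auto)
      then obtain g where g: "inj_on g (I - J)" "\<And>j. j \<in> I - J \<Longrightarrow> g j \<in> A j - U" by blast
      define h where "h j = (if j \<in> J then f j else g j)" for j
      have "inj_on h I"
      proof (rule inj_onI)
        fix a b assume ab: "a \<in> I" "b \<in> I" "h a = h b"
        have fU': "f j \<in> U" if "j \<in> J" for j using f(2) that by (auto simp: U_def)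
        show "a = b"
          using ab f(1) g(1) fU'[of a] fU'[of b] g(2)[of a] g(2)[of b]
          by (auto simp: h_def inj_on_def split: if_splits)
      qed
      moreover have "\<forall>j\<in>I. h j \<in> A j" using f(2) g(2) by (auto simp: h_def)
      ultimately show ?thesis by blast
    next
      case noTight: False
      have "card {i} \<le> card (A i)" using H[of "{i}"] i by simp
      then obtain x where x: "x \<in> A i" by fastforce
      have cI: "card (I - {i}) < card I" using card_Diff1_less[OF fin(1) i] .
      have "\<exists>g. inj_on g (I - {i}) \<and> (\<forall>j\<in>I - {i}. g j \<in> A j - {x})"
      proof (rule less.hyps[OF cI])
        fix K assume K: "K \<subseteq> I - {i}"
        show "card K \<le> card (\<Union>j\<in>K. A j - {x})"
        proof (cases "K = {}")
          case False
          have "K \<subset> I" using K i by auto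
          then have "card K \<noteq> card (\<Union>j\<in>K. A j)" using noTight False by blast
          then have "card K < card (\<Union>j\<in>K. A j)" using H[OF psubset_imp_subset[OF \<open>K \<subset> I\<close>]] by simp
          moreover have "(\<Union>j\<in>K. A j - {x}) = (\<Union>j\<in>K. A j) - {x}" by auto
          moreover have "card (\<Union>j\<in>K. A j) \<le> card ((\<Union>j\<in>K. A j) - {x}) + 1"
            using diff_card_le_card_Diff[of "{x}" "\<Union>j\<in>K. A j"] by simp
          ultimately show ?thesis by simp
        qed simp
      qed (use fin in auto)
      then obtain g where g: "inj_on g (I - {i})" "\<And>j. j \<in> I - {i} \<Longrightarrow> g j \<in> A j - {x}" by blast
      have "inj_on (g(i := x)) I"
      proof (rule inj_onI)
        fix a b assume ab: "a \<in> I" "b \<in> I" "(g(i := x)) a = (g(i := x)) b"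
        then show "a = b" using g(1) g(2)[of a] g(2)[of b] by (auto simp: inj_on_def split: if_splits)
      qed
      moreover have "\<forall>j\<in>I. (g(i := x)) j \<in> A j" using g(2) x by auto
      ultimately show ?thesis by blast
    qed
  qed auto
qed

lemma card_fibres:
  assumes "finite S" "finite T" "g ` S \<subseteq> T" shows "card S = (\<Sum>j\<in>T. card {y\<in>S. g y = j})"
  using sum.group[OF assms, of "\<lambda>_. 1::nat"] by simp

text \<open>In this section the elements of \<open>X\<close> are the edges of a bipartite multigraph, and \<open>L\<close> and \<open>R\<close> map them to
their ends on the two sides. A \<open>k\<close>-regular one satisfies Hall's condition by double counting.\<close>

lemma regular_matching:
  fixes L :: "'x \<Rightarrow> 'l" and R :: "'x \<Rightarrow> 'r"
  assumes X: "finite X" and k: "k > 0"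
    and L: "\<And>x. x \<in> X \<Longrightarrow> card {y\<in>X. L y = L x} = k"
    and R: "\<And>x. x \<in> X \<Longrightarrow> card {y\<in>X. R y = R x} = k"
  shows "\<exists>M\<subseteq>X. (\<forall>x\<in>X. card {y\<in>M. L y = L x} = 1) \<and> (\<forall>x\<in>X. card {y\<in>M. R y = R x} = 1)"
proof -
  define A where "A l = R ` {x\<in>X. L x = l}" for l
  have cL: "card {y\<in>X. L y = l} = k" if "l \<in> L ` X" for l using L that by auto
  have cR: "card {y\<in>X. R y = r} = k" if "r \<in> R ` X" for r using R that by auto
  have "\<exists>f. inj_on f (L ` X) \<and> (\<forall>l\<in>L ` X. f l \<in> A l)"
  proof (rule hall)
    fix J assume J: "J \<subseteq> L ` X"
    have fJ: "finite J" using J X finite_subset by blast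
    have fU: "finite (\<Union>l\<in>J. A l)" using fJ X by (auto simp: A_def)
    let ?S = "{x\<in>X. L x \<in> J}"
    have "card ?S = (\<Sum>l\<in>J. card {y\<in>?S. L y = l})" by (rule card_fibres) (use X fJ in auto)
    also have "\<dots> = (\<Sum>l\<in>J. k)"
    proof (rule sum.cong[OF refl])
      fix l assume l: "l \<in> J"
      then have "{y\<in>?S. L y = l} = {y\<in>X. L y = l}" by auto
      then show "card {y\<in>?S. L y = l} = k" using cL l J by auto
    qed
    finally have 1: "card ?S = card J * k" by simp
    have "card ?S = (\<Sum>r\<in>(\<Union>l\<in>J. A l). card {y\<in>?S. R y = r})"
      by (rule card_fibres) (use X fU in \<open>auto simp: A_def\<close>)
    also have "\<dots> \<le> (\<Sum>r\<in>(\<Union>l\<in>J. A l). k)"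
    proof (rule sum_mono)
      fix r assume "r \<in> (\<Union>l\<in>J. A l)"
      then have "card {y\<in>X. R y = r} = k" using cR by (auto simp: A_def)
      moreover have "card {y\<in>?S. R y = r} \<le> card {y\<in>X. R y = r}" using X by (intro card_mono) auto
      ultimately show "card {y\<in>?S. R y = r} \<le> k" by simp
    qed
    finally show "card J \<le> card (\<Union>l\<in>J. A l)" using 1 k by simp
  qed (use X in \<open>auto simp: A_def\<close>)
  then obtain f where f: "inj_on f (L ` X)" "\<And>l. l \<in> L ` X \<Longrightarrow> f l \<in> A l" by blast
  have "card (L ` X) * k = card X"
    using card_fibres[OF X _ order_refl, of L] cL X by simp
  moreover have "card (R ` X) * k = card X"
    using card_fibres[OF X _ order_refl, of R] cR X by simp
  ultimately have cc: "card (f ` L ` X) = card (R ` X)"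
    using k card_image[OF f(1)] by (metis mult_cancel2 not_less0)
  have fR: "f ` L ` X = R ` X"
    by (rule card_subset_eq) (use X f(2) cc in \<open>auto simp: A_def\<close>)
  have "\<forall>l\<in>L ` X. \<exists>x\<in>X. L x = l \<and> R x = f l" using f(2) by (force simp: A_def)
  then obtain m where m: "\<And>l. l \<in> L ` X \<Longrightarrow> m l \<in> X \<and> L (m l) = l \<and> R (m l) = f l" by metis
  let ?M = "m ` L ` X"
  have "card {y\<in>?M. L y = L x} = 1" if "x \<in> X" for x
  proof -
    have "{y\<in>?M. L y = L x} = {m (L x)}" using m that by auto
    then show ?thesis by simp
  qed
  moreover have "card {y\<in>?M. R y = R x} = 1" if x: "x \<in> X" for x
  proof -
    have "R x \<in> f ` L ` X" using fR x by simp
    then obtain l where l: "l \<in> L ` X" "f l = R x" by (metis imageE)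
    have "{y\<in>?M. R y = R x} = {m l}"
    proof (intro equalityI subsetI)
      fix y assume "y \<in> {y\<in>?M. R y = R x}"
      then obtain l' where l': "l' \<in> L ` X" "y = m l'" "R y = R x" by auto
      then have "f l' = f l" using m[OF l'(1)] l(2) by auto
      then show "y \<in> {m l}" using f(1) l(1) l'(1,2) by (auto simp: inj_on_def)
    next
      fix y assume "y \<in> {m l}"
      then show "y \<in> {y\<in>?M. R y = R x}" using m[OF l(1)] l by auto
    qed
    then show ?thesis by simp
  qed
  moreover have "?M \<subseteq> X" using m by auto
  ultimately show ?thesis by blast
qed

lemma regular_factorization:
  fixes L :: "'x \<Rightarrow> 'l" and R :: "'x \<Rightarrow> 'r"
  assumes "finite X"
    and "\<And>x. x \<in> X \<Longrightarrow> card {y\<in>X. L y = L x} = k" "\<And>x. x \<in> X \<Longrightarrow> card {y\<in>X. R y = R x} = k"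
  shows "\<exists>col. \<forall>x\<in>X. col x < k \<and>
    (\<forall>i<k. card {y\<in>X. L y = L x \<and> col y = i} = 1 \<and> card {y\<in>X. R y = R x \<and> col y = i} = 1)"
  using assms
proof (induction k arbitrary: X)
  case 0
  have "X = {}"
  proof (rule ccontr)
    assume "X \<noteq> {}"
    then obtain x where "x \<in> X" by auto
    then show False using 0(2)[of x] 0(1) by auto
  qed
  then show ?case by simp
next
  case (Suc k)
  obtain M where M: "M \<subseteq> X" "\<And>x. x \<in> X \<Longrightarrow> card {y\<in>M. L y = L x} = 1"
    "\<And>x. x \<in> X \<Longrightarrow> card {y\<in>M. R y = R x} = 1"
    using regular_matching[OF Suc.prems(1) _ Suc.prems(2,3)] by auto
  have fM: "finite M" using M(1) Suc.prems(1) finite_subset by blast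
  have diff: "card {y\<in>X - M. P y} = k" if "card {y\<in>X. P y} = Suc k" "card {y\<in>M. P y} = 1" for P
  proof -
    have "{y\<in>X - M. P y} = {y\<in>X. P y} - {y\<in>M. P y}" by auto
    moreover have "{y\<in>M. P y} \<subseteq> {y\<in>X. P y}" using M(1) by auto
    ultimately show ?thesis using that fM by (simp add: card_Diff_subset)
  qed
  have "\<exists>col. \<forall>x\<in>X - M. col x < k \<and>
    (\<forall>i<k. card {y\<in>X - M. L y = L x \<and> col y = i} = 1 \<and> card {y\<in>X - M. R y = R x \<and> col y = i} = 1)"
    by (rule Suc.IH) (use Suc.prems M(2,3) diff in auto)
  then obtain col where col: "\<And>x. x \<in> X - M \<Longrightarrow> col x < k"
    "\<And>x i. x \<in> X - M \<Longrightarrow> i < k \<Longrightarrow> card {y\<in>X - M. L y = L x \<and> col y = i} = 1"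
    "\<And>x i. x \<in> X - M \<Longrightarrow> i < k \<Longrightarrow> card {y\<in>X - M. R y = R x \<and> col y = i} = 1" by blast
  define col' where "col' x = (if x \<in> M then k else col x)" for x
  have kM: "{y\<in>X. P y \<and> col' y = k} = {y\<in>M. P y}" for P
    using col(1) M(1) by (force simp: col'_def)
  have iM: "{y\<in>X. P y \<and> col' y = i} = {y\<in>X - M. P y \<and> col y = i}" if "i < k" for P i
    using that by (auto simp: col'_def)
  have ex: "\<exists>y\<in>X - M. P y" if "card {y\<in>X. P y} = Suc k" "card {y\<in>M. P y} = 1" "i < k" for P i
  proof (rule ccontr)
    assume "\<not> ?thesis"
    then have "{y\<in>X - M. P y} = {}" by blast
    then have "card {y\<in>X - M. P y} = 0" by (simp only: card.empty)
    then show False using diff[OF that(1,2)] that(3) by linarith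
  qed
  have "col' x < Suc k \<and> (\<forall>i<Suc k. card {y\<in>X. L y = L x \<and> col' y = i} = 1 \<and> card {y\<in>X. R y = R x \<and> col' y = i} = 1)"
    if x: "x \<in> X" for x
  proof (intro conjI allI impI)
    show "col' x < Suc k" using col(1)[of x] x by (auto simp: col'_def less_Suc_eq)
    fix i assume i: "i < Suc k"
    show "card {y\<in>X. L y = L x \<and> col' y = i} = 1"
    proof (cases "i = k")
      case True
      then show ?thesis using kM[of "\<lambda>y. L y = L x"] M(2)[OF x] by simp
    next
      case False
      then have i': "i < k" using i by simp
      obtain z where z: "z \<in> X - M" "L z = L x"
        using ex[OF Suc.prems(2)[OF x] M(2)[OF x] i'] by blast
      then show ?thesis using iM[OF i', of "\<lambda>y. L y = L x"] col(2)[OF z(1) i'] by simp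
    qed
    show "card {y\<in>X. R y = R x \<and> col' y = i} = 1"
    proof (cases "i = k")
      case True
      then show ?thesis using kM[of "\<lambda>y. R y = R x"] M(3)[OF x] by simp
    next
      case False
      then have i': "i < k" using i by simp
      obtain z where z: "z \<in> X - M" "R z = R x"
        using ex[OF Suc.prems(3)[OF x] M(3)[OF x] i'] by blast
      then show ?thesis using iM[OF i', of "\<lambda>y. R y = R x"] col(3)[OF z(1) i'] by simp
    qed
  qed
  then show ?case by blast
qed

text \<open>A vertex whose degree is a multiple of \<open>k\<close> is split into vertices of degree exactly \<open>k\<close>, numbered by \<open>p\<close>.\<close>

lemma split_fibres:
  fixes L :: "'x \<Rightarrow> 'l"
  assumes X: "finite X" and k: "k > 0" and L: "\<And>x. x \<in> X \<Longrightarrow> k dvd card {y\<in>X. L y = L x}"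
  shows "\<exists>p :: 'x \<Rightarrow> nat. \<forall>x\<in>X. card {y\<in>X. L y = L x \<and> p y = p x} = k"
proof -
  define F where "F l = {y\<in>X. L y = l}" for l
  have "\<exists>g. bij_betw g (F l) {..<card (F l)}" for l
    using X ex_bij_betw_finite_nat[of "F l"] by (auto simp: F_def atLeast0LessThan)
  then obtain g where g: "\<And>l. bij_betw (g l) (F l) {..<card (F l)}" by metis
  define p where "p x = g (L x) x div k" for x
  have "card {y\<in>X. L y = L x \<and> p y = p x} = k" if x: "x \<in> X" for x
  proof -
    let ?l = "L x" and ?n = "card (F (L x))"
    let ?j = "g (L x) x div k"
    have inj: "inj_on (g ?l) (F ?l)" and im: "g ?l ` F ?l = {..<?n}" using g[of ?l] by (auto simp: bij_betw_def)
    have xn: "g ?l x < ?n" using im x by (auto simp: F_def)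
    obtain q where q: "?n = k * q" using L[OF x] by (auto simp: F_def)
    have "?j < q" using xn q k by (simp add: less_mult_imp_div_less mult.commute)
    then have le: "?j * k + k \<le> ?n" using q
      by (metis Suc_leI add.commute mult.commute mult_Suc mult_le_mono1)
    have "g ?l ` {y\<in>X. L y = ?l \<and> p y = p x} = {a. a < ?n \<and> a div k = ?j}"
    proof (intro equalityI subsetI)
      fix a assume "a \<in> g ?l ` {y\<in>X. L y = ?l \<and> p y = p x}"
      then obtain y where y: "y \<in> X" "L y = ?l" "p y = p x" "a = g ?l y" by auto
      then show "a \<in> {a. a < ?n \<and> a div k = ?j}" using im by (auto simp: p_def F_def)
    next
      fix a assume a: "a \<in> {a. a < ?n \<and> a div k = ?j}"
      then obtain y where "y \<in> F ?l" "a = g ?l y" using im by (metis (mono_tags, lifting) imageE lessThan_iff mem_Collect_eq)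
      then show "a \<in> g ?l ` {y\<in>X. L y = ?l \<and> p y = p x}" using a by (auto simp: p_def F_def)
    qed
    also have "\<dots> = {?j * k..<?j * k + k}"
    proof (intro equalityI subsetI)
      fix a assume "a \<in> {a. a < ?n \<and> a div k = ?j}"
      then have "a div k = ?j" by simp
      then have "a = ?j * k + a mod k" by (metis div_mult_mod_eq)
      moreover have "a mod k < k" using k by simp
      ultimately show "a \<in> {?j * k..<?j * k + k}" by auto
    next
      fix a assume a: "a \<in> {?j * k..<?j * k + k}"
      define b where "b = a - ?j * k"
      have "a = ?j * k + b" "b < k" using a by (auto simp: b_def)
      then have "a div k = ?j" using k by simp
      then show "a \<in> {a. a < ?n \<and> a div k = ?j}" using a le by auto
    qed
    finally have im': "g ?l ` {y\<in>X. L y = ?l \<and> p y = p x} = {?j * k..<?j * k + k}" .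
    have "inj_on (g ?l) {y\<in>X. L y = ?l \<and> p y = p x}"
      by (rule inj_on_subset[OF inj]) (auto simp: F_def)
    then show ?thesis using card_image im' by fastforce
  qed
  then show ?thesis by blast
qed

lemma balanced_count:
  assumes X: "finite X" and g: "\<And>x. x \<in> X \<Longrightarrow> card {y\<in>X. L y = L x \<and> p y = p x} = k"
    and c: "\<And>x. x \<in> X \<Longrightarrow> card {y\<in>X. (L y = L x \<and> p y = p x) \<and> col y = i} = 1"
  shows "k * card {y\<in>X. L y = l \<and> col y = i} = card {y\<in>X. L y = l}"
proof -
  let ?F = "{y\<in>X. L y = l}"
  let ?P = "p ` ?F"
  have 1: "card ?F = (\<Sum>j\<in>?P. card {y\<in>?F. p y = j})"
    by (rule card_fibres) (use X in auto)
  have 2: "card {y\<in>X. L y = l \<and> col y = i} = (\<Sum>j\<in>?P. card {y\<in>{y\<in>X. L y = l \<and> col y = i}. p y = j})"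
    by (rule card_fibres) (use X in auto)
  have "card {y\<in>?F. p y = j} = k \<and> card {y\<in>{y\<in>X. L y = l \<and> col y = i}. p y = j} = 1" if j: "j \<in> ?P" for j
  proof -
    obtain x where x: "x \<in> X" "L x = l" "p x = j" using j by auto
    have "{y\<in>?F. p y = j} = {y\<in>X. L y = L x \<and> p y = p x}"
      "{y\<in>{y\<in>X. L y = l \<and> col y = i}. p y = j} = {y\<in>X. (L y = L x \<and> p y = p x) \<and> col y = i}"
      using x by auto
    then show ?thesis using g[OF x(1)] c[OF x(1)] by simp
  qed
  then show ?thesis unfolding 1 2 by (simp add: mult.commute)
qed

text \<open>Split all vertices into vertices of degree \<open>k\<close> and colour by perfect matchings; merging the pieces again
adds up equal numbers of each colour.\<close>

theorem balanced_colouring: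
  fixes L :: "'x \<Rightarrow> 'l" and R :: "'x \<Rightarrow> 'r"
  assumes X: "finite X" and k: "k > 0"
    and L: "\<And>x. x \<in> X \<Longrightarrow> k dvd card {y\<in>X. L y = L x}"
    and R: "\<And>x. x \<in> X \<Longrightarrow> k dvd card {y\<in>X. R y = R x}"
  obtains col :: "'x \<Rightarrow> nat" where "\<And>x. x \<in> X \<Longrightarrow> col x < k"
    "\<And>i l. i < k \<Longrightarrow> k * card {y\<in>X. L y = l \<and> col y = i} = card {y\<in>X. L y = l}"
    "\<And>i r. i < k \<Longrightarrow> k * card {y\<in>X. R y = r \<and> col y = i} = card {y\<in>X. R y = r}"
proof -
  obtain p :: "'x \<Rightarrow> nat" where p: "\<And>x. x \<in> X \<Longrightarrow> card {y\<in>X. L y = L x \<and> p y = p x} = k"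
    using split_fibres[OF X k L] by blast
  obtain q :: "'x \<Rightarrow> nat" where q: "\<And>x. x \<in> X \<Longrightarrow> card {y\<in>X. R y = R x \<and> q y = q x} = k"
    using split_fibres[OF X k R] by blast
  have "\<exists>col. \<forall>x\<in>X. col x < k \<and>
    (\<forall>i<k. card {y\<in>X. (L y, p y) = (L x, p x) \<and> col y = i} = 1 \<and> card {y\<in>X. (R y, q y) = (R x, q x) \<and> col y = i} = 1)"
    by (rule regular_factorization[OF X]) (use p q in auto)
  then obtain col where col: "\<And>x. x \<in> X \<Longrightarrow> col x < k"
    "\<And>x i. x \<in> X \<Longrightarrow> i < k \<Longrightarrow> card {y\<in>X. (L y = L x \<and> p y = p x) \<and> col y = i} = 1"
    "\<And>x i. x \<in> X \<Longrightarrow> i < k \<Longrightarrow> card {y\<in>X. (R y = R x \<and> q y = q x) \<and> col y = i} = 1"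
    by (auto simp only: prod.inject)
  show ?thesis
    using that[of col] col(1) balanced_count[OF X p col(2)] balanced_count[OF X q col(3)] by blast
qed

section \<open>From orientations to decompositions\<close>

definition arcs_of :: "('v, 'e) mgraph \<Rightarrow> ('e \<Rightarrow> 'v \<times> 'v) \<Rightarrow> bool" where
  "arcs_of G h \<longleftrightarrow> (\<forall>e\<in>edges G. ends G e = {#fst (h e), snd (h e)#})"

lemma exists_arcs:
  assumes "multigraph G" obtains h where "arcs_of G h"
proof -
  have "\<exists>a. ends G e = {#fst a, snd a#}" if "e \<in> edges G" for e
  proof -
    have "size (ends G e) = Suc (Suc 0)" using assms that by (auto simp: multigraph_def)
    then obtain x N where x: "ends G e = add_mset x N" by (metis size_eq_Suc_imp_eq_union)
    then have "size N = Suc 0" using \<open>size (ends G e) = Suc (Suc 0)\<close> by simp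
    then obtain y where "N = {#y#}" by (metis size_1_singleton_mset One_nat_def)
    then have "ends G e = {#fst (x, y), snd (x, y)#}" using x by simp
    then show ?thesis by blast
  qed
  then show ?thesis using that unfolding arcs_of_def by metis
qed

lemma card_filter_sum: "finite S \<Longrightarrow> int (card {x\<in>S. P x}) = (\<Sum>x\<in>S. if P x then 1 else 0)"
  using sum.inter_filter[of S "\<lambda>_. 1::int" P] by simp

lemma arcs_in_verts:
  assumes "multigraph G" "arcs_of G h" shows "h ` edges G \<subseteq> verts G \<times> verts G"
proof
  fix a assume "a \<in> h ` edges G"
  then obtain e where e: "e \<in> edges G" "a = h e" by blast
  have "set_mset (ends G e) \<subseteq> verts G" using assms(1) e(1) unfolding multigraph_def by blast
  moreover have "ends G e = {#fst a, snd a#}" using assms(2) e unfolding arcs_of_def by blast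
  ultimately show "a \<in> verts G \<times> verts G" by (simp add: mem_Times_iff)
qed

lemma cut_size_arcs:
  assumes "finite (edges G)" "arcs_of G h" shows "int (cut_size G A) = ecut (edges G) h A"
proof -
  have "{e\<in>edges G. size {#x \<in># ends G e. x \<in> A#} = 1} = {e\<in>edges G. flux (h e) A \<noteq> 0}"
    using assms(2) by (auto simp: arcs_of_def flux_def split: if_splits)
  then have "int (cut_size G A) = (\<Sum>e\<in>edges G. if flux (h e) A \<noteq> 0 then 1 else 0)"
    unfolding cut_size_def using card_filter_sum[OF assms(1)] by simp
  also have "\<dots> = ecut (edges G) h A" unfolding ecut_def
    by (rule sum.cong) (auto simp: flux_def)
  finally show ?thesis .
qed

lemma sum_ends_count:
  assumes "finite F"
  shows "(\<Sum>e\<in>F. count {#t e, s e#} v) = card {e\<in>F. t e = v} + card {e\<in>F. s e = v}"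
proof -
  have "card {e\<in>F. g e = v} = (\<Sum>e\<in>F. if g e = v then 1 else 0)" for g
    using sum.inter_filter[OF assms, of "\<lambda>_. 1::nat" "\<lambda>e. g e = v"] by simp
  then show ?thesis by (simp add: sum.distrib[symmetric], intro sum.cong) auto
qed

lemma degree_arcs:
  assumes "finite (edges G)" "\<And>e. e \<in> edges G \<Longrightarrow> ends G e = {#t e, s e#}"
  shows "degree G v = card {e\<in>edges G. t e = v} + card {e\<in>edges G. s e = v}"
  unfolding degree_def using sum_ends_count[OF assms(1), of t s v] assms(2) by (metis (no_types, lifting) sum.cong)

lemma sum_degree:
  assumes "multigraph G" shows "(\<Sum>v\<in>verts G. degree G v) = 2 * card (edges G)"
proof -
  obtain h where h: "arcs_of G h" using exists_arcs[OF assms] .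
  have f: "finite (edges G)" "finite (verts G)" using assms by (auto simp: multigraph_def)
  have hV: "fst (h e) \<in> verts G" "snd (h e) \<in> verts G" if "e \<in> edges G" for e
    using arcs_in_verts[OF assms h] that by (auto simp: image_subset_iff mem_Times_iff)
  have "(\<Sum>v\<in>verts G. degree G v) = (\<Sum>v\<in>verts G. card {e\<in>edges G. fst (h e) = v}) + (\<Sum>v\<in>verts G. card {e\<in>edges G. snd (h e) = v})"
    using degree_arcs[OF f(1), of "fst \<circ> h" "snd \<circ> h"] h by (simp add: arcs_of_def sum.distrib)
  also have "(\<Sum>v\<in>verts G. card {e\<in>edges G. fst (h e) = v}) = card (edges G)"
    by (rule card_fibres[symmetric]) (use f hV in auto)
  also have "(\<Sum>v\<in>verts G. card {e\<in>edges G. snd (h e) = v}) = card (edges G)"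
    by (rule card_fibres[symmetric]) (use f hV in auto)
  finally show ?thesis by simp
qed

lemma connected_factor_spans:
  assumes G: "arcs_of G h" and T: "factor T G" "connected_graph T"
  shows "spans (verts G) (edges T) h"
  unfolding spans_def
proof (intro allI impI, rule ccontr)
  fix A assume A: "A \<noteq> {}" "A \<subset> verts G" and no: "\<not> (\<exists>e\<in>edges T. flux (h e) A \<noteq> 0)"
  obtain u w where uw: "u \<in> A" "w \<in> verts G - A" using A by blast
  have V: "verts T = verts G" using T(1) by (simp add: factor_def)
  have "(u, w) \<in> {(x, y). \<exists>e\<in>edges T. ends T e = {#x, y#}}\<^sup>*"
    using T(2) uw A(2) unfolding connected_graph_def V by blast
  then have "w \<in> A"
  proof (induction rule: rtrancl_induct)
    case base then show ?case by (rule uw(1))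
  next
    case (step x y)
    then obtain e where e: "e \<in> edges T" "ends T e = {#x, y#}" by auto
    have "ends T e = {#fst (h e), snd (h e)#}" using e(1) T(1) G unfolding factor_def arcs_of_def by (metis subsetD)
    then have "{#fst (h e), snd (h e)#} = {#x, y#}" using e(2) by simp
    then have "(fst (h e) = x \<and> snd (h e) = y) \<or> (fst (h e) = y \<and> snd (h e) = x)"
      by (auto simp: add_eq_conv_ex)
    moreover have "flux (h e) A = 0" using no e(1) by blast
    ultimately show ?case using step.IH by (auto simp: flux_eq_0_iff)
  qed
  then show False using uw(2) by simp
qed

text \<open>An out-degree congruent to \<open>p v\<close> modulo \<open>k\<close> is the same as a balance congruent to \<open>2 * p v\<close> minus the degree modulo
\<open>2 * k\<close>. For cuts of size at least \<open>3 * k - 3\<close> the bound of the extension theorem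
holds with nothing oriented in advance: the distance is at most \<open>k\<close>, and equality is excluded by parity when
the cut has size exactly \<open>3 * k - 3\<close>.\<close>

theorem modulo_orientation:
  fixes G :: "('v, 'e) mgraph" and k :: nat and p :: "'v \<Rightarrow> int"
  assumes G: "multigraph G" and k: "k \<ge> 2"
    and conn: "edge_connected (3 * k - 3) G \<or> tree_connected (2 * k - 2) G"
    and p: "int k dvd (\<Sum>v\<in>verts G. p v) - int (card (edges G))"
  shows "\<exists>t s. (\<forall>e\<in>edges G. ends G e = {#t e, s e#}) \<and>
    (\<forall>v\<in>verts G. int k dvd int (card {e\<in>edges G. t e = v}) - p v)"
proof -
  let ?V = "verts G" and ?E = "edges G" and ?k = "int k"
  obtain h where h: "arcs_of G h" using exists_arcs[OF G] .
  have f: "finite ?E" "finite ?V" using G by (auto simp: multigraph_def)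
  note hV = arcs_in_verts[OF G h]
  define u where "u v = 2 * p v - int (degree G v)" for v
  have deg: "int (degree G v) = (\<Sum>e\<in>?E. (if fst (h e) = v then 1 else 0) + (if snd (h e) = v then 1 else 0))" for v
    using degree_arcs[OF f(1), of "fst \<circ> h" "snd \<circ> h" v] h card_filter_sum[OF f(1)]
    by (simp add: arcs_of_def sum.distrib)
  have par: "even (u v + ecut ?E h {v})" for v
  proof -
    have "even (\<Sum>e\<in>?E. ((if fst (h e) = v then 1 else 0) + (if snd (h e) = v then 1 else 0)) + \<bar>flux (h e) {v}\<bar>)"
      by (rule dvd_sum) (auto simp: flux_def)
    then have "even (int (degree G v) + ecut ?E h {v})" unfolding deg ecut_def by (simp only: sum.distrib)
    then show ?thesis unfolding u_def by presburger
  qed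
  have sumu: "2 * ?k dvd sum u ?V"
  proof -
    have "sum u ?V = 2 * ((\<Sum>v\<in>?V. p v) - int (card ?E))"
      unfolding u_def using sum_degree[OF G]
      by (simp add: sum_subtractf flip: sum_distrib_left of_nat_sum)
    then show ?thesis using p by (simp only: mult_dvd_mono dvd_refl)
  qed
  have k0: "?k > 0" "?k \<ge> 2" using k by auto
  have "orientable ?k ?V ?E h u"
    using conn
  proof
    assume ec: "edge_connected (3 * k - 3) G"
    have "admissible ?k ?V ?E h (\<lambda>_. 0) (\<lambda>_. 0) u {}"
    proof (rule admissibleI)
      fix A assume A: "A \<noteq> {}" "A \<subset> ?V"
      have "3 * k - 3 \<le> cut_size G A" using ec A unfolding edge_connected_def by blast
      then have c: "3 * ?k - 3 \<le> ecut ?E h A" using cut_size_arcs[OF f(1) h, of A] k by linarith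
      have "finite A" using A f(2) finite_subset by blast
      then have "even (sum u A + sum (\<lambda>_. 0) A + ecut ?E h A)" by (rule even_sum_cut) (use par in simp)
      moreover note cdist_parity[OF k0(1), of "sum u A"] cdist_le[OF k0(1), of "sum u A"]
      ultimately have "2 * ?k - 2 + cdist ?k (sum u A) \<le> ecut ?E h A" using c by simp presburger
      then show "2 * ?k - 2 + cdist ?k (sum u A) \<le> ecut ?E h A + (\<Sum>v\<in>A. 0)" by simp
    next
      show "(\<Sum>v\<in>?V. 0) \<le> 2 * ?k - 2 + cdist ?k (sum u ?V)" using k0 cdist_nonneg[OF k0(1)] by simp
      show "even (u v + 0 + ecut ?E h {v})" for v using par[of v] by simp
    qed (use f hV sumu in auto)
    from admissible_orientable[OF k0(2) this] show ?thesis by simp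
  next
    assume "tree_connected (2 * k - 2) G"
    then obtain T where T: "\<And>i. i < 2 * k - 2 \<Longrightarrow> factor (T i) G \<and> tree (T i)"
      "disjoint_family_on (\<lambda>i. edges (T i)) {..<2 * k - 2}" unfolding tree_connected_def by blast
    have "packing (2 * k - 2) ?V ?E h (\<lambda>i. edges (T i))" unfolding packing_def
    proof (intro conjI allI impI)
      fix i assume i: "i < 2 * k - 2"
      show "edges (T i) \<subseteq> ?E" using T(1)[OF i] unfolding factor_def by blast
      show "spans ?V (edges (T i)) h"
        using T(1)[OF i] connected_factor_spans[OF h] unfolding tree_def by blast
    qed (rule T(2))
    moreover have "int (2 * k - 2) = 2 * ?k - 2" using k by simp
    ultimately show ?thesis using packing_orientable[OF k0(2) _ f(2,1) hV _ par sumu] by blast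
  qed
  then obtain \<sigma> where s: "sign_fun \<sigma>" and d: "\<And>v. v \<in> ?V \<Longrightarrow> 2 * ?k dvd net \<sigma> ?E h {v} - u v"
    unfolding orientable_def by blast
  define t where "t e = (if \<sigma> e = 1 then fst (h e) else snd (h e))" for e
  define t' where "t' e = (if \<sigma> e = 1 then snd (h e) else fst (h e))" for e
  have ends: "ends G e = {#t e, t' e#}" if "e \<in> ?E" for e
    using h that by (auto simp: arcs_of_def t_def t'_def add_mset_commute)
  have "?k dvd int (card {e\<in>?E. t e = v}) - p v" if v: "v \<in> ?V" for v
  proof -
    have "net \<sigma> ?E h {v} = (\<Sum>e\<in>?E. (if t e = v then 1 else 0) - (if t' e = v then 1 else 0))"
      unfolding net_def
    proof (rule sum.cong[OF refl])
      fix e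
      have "\<sigma> e = 1 \<or> \<sigma> e = - 1" using s by (auto simp: sign_fun_def)
      then show "\<sigma> e * flux (h e) {v} = (if t e = v then 1 else 0) - (if t' e = v then 1 else 0)"
        by (auto simp: flux_def t_def t'_def)
    qed
    also have "\<dots> = int (card {e\<in>?E. t e = v}) - int (card {e\<in>?E. t' e = v})"
      unfolding sum_subtractf card_filter_sum[OF f(1)] ..
    finally have "net \<sigma> ?E h {v} - u v = 2 * (int (card {e\<in>?E. t e = v}) - p v)"
      using degree_arcs[OF f(1) ends, of v] by (simp add: u_def)
    then have "2 * ?k dvd 2 * (int (card {e\<in>?E. t e = v}) - p v)" using d[OF v] by simp
    then show ?thesis by (simp only: dvd_mult_cancel_left) simp
  qed
  then show ?thesis using ends by blast
qed

text \<open>In the proof \<open>X\<close> is the edge set of the auxiliary bipartite multigraph, with the dummy edges on the right of the sum type.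
The tail vertex \<open>None\<close> is the additional vertex: it receives the edges of \<open>B v\<close>, which are \<open>b v\<close> chosen edges leaving \<open>v\<close>, and
\<open>c v\<close> dummy edges leading to \<open>v\<close>. Of its \<open>k\<close> edges exactly one has colour \<open>i\<close>. If it belongs
to some \<open>B v\<close>, then colour \<open>i\<close> has one edge too many at \<open>v\<close>, counted by \<open>\<beta> i v\<close>; if it is a dummy edge at
\<open>v\<close>, one too few, counted by \<open>\<gamma> i v\<close>.\<close>

lemma decomposition_from_orientation:
  fixes G :: "('v, 'e) mgraph" and k :: nat and b c :: "'v \<Rightarrow> nat" and f :: "'v \<Rightarrow> int"
  assumes G: "multigraph G" and k: "k > 0"
    and ends: "\<And>e. e \<in> edges G \<Longrightarrow> ends G e = {#t e, s e#}"
    and out: "\<And>v. v \<in> verts G \<Longrightarrow> int k dvd int (card {e\<in>edges G. t e = v}) - int (b v)"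
    and b: "\<And>v. v \<in> verts G \<Longrightarrow> b v < k"
    and deg: "\<And>v. v \<in> verts G \<Longrightarrow> int (degree G v) = int k * f v + int (b v) - int (c v)"
    and total: "(\<Sum>v\<in>verts G. b v + c v) = k"
  shows "\<exists>H. edge_decomposition G k H \<and> (\<forall>i<k. almost_factor G f (H i)) \<and>
    (\<forall>v\<in>verts G. card {i. i < k \<and> almost_factor_at G f v (H i)} = b v + c v)"
proof -
  let ?V = "verts G" and ?E = "edges G"
  have fin: "finite ?E" "finite ?V" using G by (auto simp: multigraph_def)
  have tsV: "t e \<in> ?V" "s e \<in> ?V" if "e \<in> ?E" for e
  proof -
    have "set_mset (ends G e) \<subseteq> ?V" using G that unfolding multigraph_def by blast
    then show "t e \<in> ?V" "s e \<in> ?V" using ends[OF that] by auto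
  qed
  have "b v \<le> card {e\<in>?E. t e = v}" if "v \<in> ?V" for v
  proof (rule ccontr)
    assume n: "\<not> ?thesis"
    have "int k dvd int (b v) - int (card {e\<in>?E. t e = v})" using out[OF that] by (simp add: dvd_diff_commute)
    then have "int k \<le> int (b v) - int (card {e\<in>?E. t e = v})" using n by (intro zdvd_imp_le) auto
    then show False using b[OF that] by simp
  qed
  then have "\<forall>v\<in>?V. \<exists>B. B \<subseteq> {e\<in>?E. t e = v} \<and> card B = b v" by (metis obtain_subset_with_card_n)
  then obtain B where B: "\<And>v. v \<in> ?V \<Longrightarrow> B v \<subseteq> {e\<in>?E. t e = v}" "\<And>v. v \<in> ?V \<Longrightarrow> card (B v) = b v"
    by metis
  have fB: "finite (B v)" if "v \<in> ?V" for v using B(1)[OF that] fin(1) by (auto intro: finite_subset)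
  define X :: "('e + 'v \<times> nat) set" where "X = Inl ` ?E \<union> Inr ` (SIGMA v:?V. {..<c v})"
  define L :: "'e + 'v \<times> nat \<Rightarrow> 'v option"
    where "L x = (case x of Inl e \<Rightarrow> if e \<in> B (t e) then None else Some (t e) | Inr _ \<Rightarrow> None)" for x
  define R :: "'e + 'v \<times> nat \<Rightarrow> 'v" where "R x = (case x of Inl e \<Rightarrow> s e | Inr a \<Rightarrow> fst a)" for x
  define own :: "'e + 'v \<times> nat \<Rightarrow> 'v" where "own x = (case x of Inl e \<Rightarrow> t e | Inr a \<Rightarrow> fst a)" for x
  have fX: "finite X" using fin by (auto simp: X_def)
  have un: "card (Inl ` S \<union> Inr ` Pair v ` S' :: ('e + 'v \<times> nat) set) = card S + card S'" if "finite S" "finite S'"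
    for S :: "'e set" and S' :: "nat set" and v :: 'v
  proof -
    have "card (Inl ` S \<union> Inr ` Pair v ` S' :: ('e + 'v \<times> nat) set) =
        card (Inl ` S :: ('e + 'v \<times> nat) set) + card (Inr ` Pair v ` S' :: ('e + 'v \<times> nat) set)"
      using that by (intro card_Un_disjoint) auto
    then show ?thesis by (simp add: card_image inj_on_def)
  qed
  have cL: "card {x\<in>X. L x = Some v \<and> Q x} = card {e\<in>?E. t e = v \<and> e \<notin> B v \<and> Q (Inl e)}" for v Q
  proof -
    have "{x\<in>X. L x = Some v \<and> Q x} = Inl ` {e\<in>?E. t e = v \<and> e \<notin> B v \<and> Q (Inl e)}"
      by (auto simp: X_def L_def split: if_splits)
    then show ?thesis by (simp add: card_image)
  qed
  have cR: "card {x\<in>X. R x = v \<and> Q x} = card {e\<in>?E. s e = v \<and> Q (Inl e)} + card {j\<in>{..<c v}. Q (Inr (v, j))}"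
    if "v \<in> ?V" for v Q
  proof -
    have "{x\<in>X. R x = v \<and> Q x} = Inl ` {e\<in>?E. s e = v \<and> Q (Inl e)} \<union> Inr ` Pair v ` {j\<in>{..<c v}. Q (Inr (v, j))}"
      using that by (auto simp: X_def R_def)
    then show ?thesis using un fin by simp
  qed
  have cN: "card {x\<in>X. L x = None \<and> Q x} = (\<Sum>v\<in>?V. card {e\<in>B v. Q (Inl e)} + card {j\<in>{..<c v}. Q (Inr (v, j))})" for Q
  proof -
    have "card {x\<in>X. L x = None \<and> Q x} = (\<Sum>v\<in>?V. card {x\<in>{x\<in>X. L x = None \<and> Q x}. own x = v})"
      by (rule card_fibres) (use fX fin tsV in \<open>auto simp: X_def own_def\<close>)
    also have "\<dots> = (\<Sum>v\<in>?V. card {e\<in>B v. Q (Inl e)} + card {j\<in>{..<c v}. Q (Inr (v, j))})"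
    proof (rule sum.cong[OF refl])
      fix v assume v: "v \<in> ?V"
      have "{x\<in>{x\<in>X. L x = None \<and> Q x}. own x = v} =
          Inl ` {e\<in>B v. Q (Inl e)} \<union> Inr ` Pair v ` {j\<in>{..<c v}. Q (Inr (v, j))}"
        using v B(1)[OF v] by (auto simp: X_def L_def own_def split: if_splits)
      then show "card {x\<in>{x\<in>X. L x = None \<and> Q x}. own x = v} =
          card {e\<in>B v. Q (Inl e)} + card {j\<in>{..<c v}. Q (Inr (v, j))}"
        using un fB[OF v] by simp
    qed
    finally show ?thesis .
  qed
  have cN0: "card {x\<in>X. L x = None} = k"
    using cN[of "\<lambda>_. True"] B(2) total by simp
  have cL0: "int (card {x\<in>X. L x = Some v}) = int (card {e\<in>?E. t e = v}) - int (b v)" if v: "v \<in> ?V" for v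
  proof -
    have "{e\<in>?E. t e = v \<and> e \<notin> B v} = {e\<in>?E. t e = v} - B v" by auto
    then have "card {x\<in>X. L x = Some v} = card {e\<in>?E. t e = v} - b v"
      using cL[of v "\<lambda>_. True"] B[OF v] fB[OF v] by (simp add: card_Diff_subset)
    then show ?thesis using card_mono[OF _ B(1)[OF v]] B(2)[OF v] fin(1) by simp
  qed
  have cR0: "int (card {x\<in>X. R x = v}) = int k * f v + int (b v) - int (card {e\<in>?E. t e = v})" if v: "v \<in> ?V" for v
    using cR[OF v, of "\<lambda>_. True"] degree_arcs[OF fin(1) ends, of v] deg[OF v] by simp
  obtain col where col: "\<And>x. x \<in> X \<Longrightarrow> col x < k"
    "\<And>i l. i < k \<Longrightarrow> k * card {y\<in>X. L y = l \<and> col y = i} = card {y\<in>X. L y = l}"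
    "\<And>i r. i < k \<Longrightarrow> k * card {y\<in>X. R y = r \<and> col y = i} = card {y\<in>X. R y = r}"
  proof (rule balanced_colouring[OF fX k, of L R])
    fix x assume x: "x \<in> X"
    show "k dvd card {y\<in>X. L y = L x}"
    proof (cases "L x")
      case None
      then show ?thesis using cN0 by simp
    next
      case (Some v)
      then have "v \<in> ?V" using x tsV by (auto simp: X_def L_def split: if_splits)
      then have "int k dvd int (card {y\<in>X. L y = Some v})" using cL0 out by simp
      then show ?thesis using Some by simp
    qed
    have "R x \<in> ?V" using x tsV by (auto simp: X_def R_def)
    then have "int (card {y\<in>X. R y = R x}) = int k * f (R x) - (int (card {e\<in>?E. t e = R x}) - int (b (R x)))"
      "int k dvd int (card {e\<in>?E. t e = R x}) - int (b (R x))" using cR0 out by auto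
    then have "int k dvd int (card {y\<in>X. R y = R x})" by (simp only: dvd_diff dvd_triv_left)
    then show "k dvd card {y\<in>X. R y = R x}" by simp
  qed (rule that)
  define H where "H i = \<lparr>verts = ?V, edges = {e\<in>?E. col (Inl e) = i}, ends = ends G\<rparr>" for i
  define \<beta> where "\<beta> i v = card {e\<in>B v. col (Inl e) = i}" for i v
  define \<gamma> where "\<gamma> i v = card {j\<in>{..<c v}. col (Inr (v, j)) = i}" for i v
  have dH: "int (degree (H i) v) = f v + int (\<beta> i v) - int (\<gamma> i v)" if i: "i < k" and v: "v \<in> ?V" for i v
  proof -
    let ?F = "{e\<in>?E. col (Inl e) = i}"
    have "degree (H i) v = card {e\<in>?F. t e = v} + card {e\<in>?F. s e = v}"
      using degree_arcs[of "H i" t s v] fin(1) ends by (simp add: H_def)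
    moreover have "card {e\<in>?F. t e = v} = card {x\<in>X. L x = Some v \<and> col x = i} + \<beta> i v"
    proof -
      have "{e\<in>?F. t e = v} = {e\<in>?E. t e = v \<and> e \<notin> B v \<and> col (Inl e) = i} \<union> {e\<in>B v. col (Inl e) = i}"
        using B(1)[OF v] by auto
      then have "card {e\<in>?F. t e = v} = card {e\<in>?E. t e = v \<and> e \<notin> B v \<and> col (Inl e) = i} + card {e\<in>B v. col (Inl e) = i}"
        using fin(1) fB[OF v] by (simp only:) (rule card_Un_disjoint, auto)
      then show ?thesis using cL[of v "\<lambda>x. col x = i"] by (simp add: \<beta>_def)
    qed
    moreover have "card {x\<in>X. R x = v \<and> col x = i} = card {e\<in>?F. s e = v} + \<gamma> i v"
    proof -
      have "{e\<in>?F. s e = v} = {e\<in>?E. s e = v \<and> col (Inl e) = i}" by auto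
      then show ?thesis using cR[OF v, of "\<lambda>x. col x = i"] by (simp add: \<gamma>_def)
    qed
    moreover have "int (card {x\<in>X. L x = Some v \<and> col x = i}) + int (card {x\<in>X. R x = v \<and> col x = i}) = f v"
    proof -
      have "int k * (int (card {x\<in>X. L x = Some v \<and> col x = i}) + int (card {x\<in>X. R x = v \<and> col x = i}))
        = int (k * card {x\<in>X. L x = Some v \<and> col x = i}) + int (k * card {x\<in>X. R x = v \<and> col x = i})"
        by (simp add: distrib_left)
      also have "\<dots> = int k * f v" unfolding col(2)[OF i] col(3)[OF i] cL0[OF v] cR0[OF v] by simp
      finally show ?thesis using k by simp
    qed
    ultimately show ?thesis by linarith
  qed
  have one: "(\<Sum>v\<in>?V. \<beta> i v + \<gamma> i v) = 1" if i: "i < k" for i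
  proof -
    have "k * (\<Sum>v\<in>?V. \<beta> i v + \<gamma> i v) = k"
      using col(2)[OF i, of None] cN[of "\<lambda>x. col x = i"] cN0 by (simp add: \<beta>_def \<gamma>_def)
    then show ?thesis using k by simp
  qed
  have factorH: "factor (H i) G" for i by (auto simp: factor_def H_def)
  have at: "almost_factor_at G f v (H i) \<longleftrightarrow> \<beta> i v + \<gamma> i v = 1" if i: "i < k" and v: "v \<in> ?V" for i v
  proof -
    obtain u where u: "u \<in> ?V" "\<beta> i u + \<gamma> i u = 1" "\<And>w. w \<in> ?V \<Longrightarrow> u \<noteq> w \<Longrightarrow> \<beta> i w + \<gamma> i w = 0"
      using one[OF i] unfolding sum_eq_1_iff[OF fin(2)] by blast
    have "\<beta> i u = 0 \<and> \<gamma> i u = 1 \<or> \<beta> i u = 1 \<and> \<gamma> i u = 0" using u(2) by linarith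
    then have du: "int (degree (H i) u) \<in> {f u - 1, f u + 1}" using dH[OF i u(1)] by auto
    have dw: "int (degree (H i) w) = f w" if "w \<in> ?V" "u \<noteq> w" for w using dH[OF i that(1)] u(3)[OF that] by simp
    show ?thesis
    proof (cases "v = u")
      case True
      then show ?thesis using du dw u(1,2) factorH by (auto simp: almost_factor_at_def)
    next
      case False
      then have "\<not> almost_factor_at G f v (H i)" using du u(1) by (auto simp: almost_factor_at_def)
      then show ?thesis using u(3)[OF v] False by simp
    qed
  qed
  have "edge_decomposition G k H" unfolding edge_decomposition_def
  proof (intro conjI)
    show "\<forall>i<k. factor (H i) G" using factorH by blast
    show "disjoint_family_on (\<lambda>i. edges (H i)) {..<k}" by (auto simp: disjoint_family_on_def H_def)
    show "(\<Union>i<k. edges (H i)) = edges G" using col(1) by (auto simp: H_def X_def)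
  qed
  moreover have "almost_factor G f (H i)" if i: "i < k" for i
    using one[OF i] at[OF i] unfolding almost_factor_def sum_eq_1_iff[OF fin(2)] by blast
  moreover have "card {i. i < k \<and> almost_factor_at G f v (H i)} = b v + c v" if v: "v \<in> ?V" for v
  proof -
    have le: "\<beta> i v + \<gamma> i v \<le> 1" if "i < k" for i
      using one[OF that] member_le_sum[OF v, of "\<lambda>v. \<beta> i v + \<gamma> i v"] fin(2) by simp
    have "{i. i < k \<and> almost_factor_at G f v (H i)} = {i\<in>{..<k}. \<beta> i v + \<gamma> i v = 1}" using at[OF _ v] by auto
    then have "card {i. i < k \<and> almost_factor_at G f v (H i)} = (\<Sum>i<k. if \<beta> i v + \<gamma> i v = 1 then 1 else 0)"
      using sum.inter_filter[of "{..<k}" "\<lambda>_. 1::nat"] by simp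
    also have "\<dots> = (\<Sum>i<k. \<beta> i v + \<gamma> i v)"
    proof (rule sum.cong[OF refl])
      fix i assume "i \<in> {..<k}"
      then show "(if \<beta> i v + \<gamma> i v = 1 then 1 else 0) = \<beta> i v + \<gamma> i v" using le[of i] by auto
    qed
    also have "\<dots> = (\<Sum>i<k. \<beta> i v) + (\<Sum>i<k. \<gamma> i v)" by (rule sum.distrib)
    also have "(\<Sum>i<k. \<beta> i v) = card (B v)" unfolding \<beta>_def
      by (rule card_fibres[symmetric, OF fB[OF v]]) (use B(1)[OF v] col(1) in \<open>auto simp: X_def\<close>)
    also have "(\<Sum>i<k. \<gamma> i v) = card {..<c v}" unfolding \<gamma>_def
      by (rule card_fibres[symmetric]) (use v col(1) in \<open>auto simp: X_def\<close>)
    finally show ?thesis using B(2)[OF v] by simp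
  qed
  ultimately show ?thesis by blast
qed

text \<open>Each factor has exactly one exceptional vertex, and the degrees of \<open>v\<close> in the factors sum up to its
degree, with an error of \<open>1\<close> or \<open>- 1\<close> for each factor that is exceptional at \<open>v\<close>.\<close>

lemma almost_factor_counts:
  fixes G :: "('v, 'e) mgraph" and f :: "'v \<Rightarrow> int"
  assumes G: "multigraph G" and H: "edge_decomposition G k H" "\<And>i. i < k \<Longrightarrow> almost_factor G f (H i)"
  defines "S \<equiv> \<lambda>v. {i. i < k \<and> almost_factor_at G f v (H i)}"
  shows "(\<Sum>v\<in>verts G. card (S v)) = k"
    and "v \<in> verts G \<Longrightarrow> \<bar>int (degree G v) - int k * f v\<bar> \<le> int (card (S v))"
    and "v \<in> verts G \<Longrightarrow> even (int (degree G v) - int k * f v + int (card (S v)))"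
proof -
  let ?V = "verts G"
  have fin: "finite (edges G)" "finite ?V" using G by (auto simp: multigraph_def)
  have fS: "finite (S v)" "S v \<subseteq> {..<k}" for v by (auto simp: S_def)
  have uniq: "u = w" if "almost_factor_at G f u (H i)" "almost_factor_at G f w (H i)" for u w i
  proof (rule ccontr)
    assume "u \<noteq> w"
    then have "w \<in> verts G - {u}" using that(2) by (auto simp: almost_factor_at_def)
    then have "int (degree (H i) w) = f w" using that(1) by (auto simp: almost_factor_at_def)
    then show False using that(2) by (auto simp: almost_factor_at_def)
  qed
  obtain z where z: "\<And>i. i < k \<Longrightarrow> almost_factor_at G f (z i) (H i)"
    using H(2) unfolding almost_factor_def by metis
  have zV: "z i \<in> ?V" if "i < k" for i using z[OF that] by (simp add: almost_factor_at_def)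
  have Sz: "S v = {i\<in>{..<k}. z i = v}" for v using z uniq by (auto simp: S_def)
  have "card {..<k} = (\<Sum>v\<in>?V. card (S v))"
    unfolding Sz by (rule card_fibres) (use fin(2) zV in auto)
  then show "(\<Sum>v\<in>?V. card (S v)) = k" by simp
  fix v assume v: "v \<in> ?V"
  have "degree G v = (\<Sum>i<k. degree (H i) v)"
  proof -
    have U: "edges G = (\<Union>i\<in>{..<k}. edges (H i))" and dis: "disjoint_family_on (\<lambda>i. edges (H i)) {..<k}"
      and fac: "\<And>i. i < k \<Longrightarrow> factor (H i) G"
      using H(1) by (auto simp: edge_decomposition_def)
    have "degree G v = (\<Sum>i<k. \<Sum>e\<in>edges (H i). count (ends G e) v)"
      unfolding degree_def U
    proof (rule sum.UNION_disjoint)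
      show "\<forall>i\<in>{..<k}. finite (edges (H i))"
        using fac fin(1) unfolding factor_def by (auto intro: finite_subset)
      show "\<forall>i\<in>{..<k}. \<forall>j\<in>{..<k}. i \<noteq> j \<longrightarrow> edges (H i) \<inter> edges (H j) = {}"
        using dis by (auto simp: disjoint_family_on_def)
    qed simp
    also have "\<dots> = (\<Sum>i<k. degree (H i) v)" unfolding degree_def
    proof (rule sum.cong[OF refl], rule sum.cong[OF refl])
      fix i e assume "i \<in> {..<k}" "e \<in> edges (H i)"
      then show "count (ends G e) v = count (ends (H i) e) v" using fac[of i] by (simp add: factor_def)
    qed
    finally show ?thesis .
  qed
  then have D: "int (degree G v) - int k * f v = (\<Sum>i<k. int (degree (H i) v) - f v)"
    by (simp add: sum_subtractf)
  also have "\<dots> = (\<Sum>i\<in>S v. int (degree (H i) v) - f v)"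
  proof (rule sum.mono_neutral_right[OF _ fS(2)])
    show "\<forall>i\<in>{..<k} - S v. int (degree (H i) v) - f v = 0"
    proof
      fix i assume i: "i \<in> {..<k} - S v"
      then have "z i \<noteq> v" by (auto simp: Sz)
      then have "v \<in> ?V - {z i}" using v by auto
      then show "int (degree (H i) v) - f v = 0" using z[of i] i by (auto simp: almost_factor_at_def)
    qed
  qed simp
  finally have E: "int (degree G v) - int k * f v = (\<Sum>i\<in>S v. int (degree (H i) v) - f v)" .
  have pm: "int (degree (H i) v) - f v = 1 \<or> int (degree (H i) v) - f v = - 1" if "i \<in> S v" for i
    using that by (auto simp: S_def almost_factor_at_def)
  have "\<bar>\<Sum>i\<in>S v. int (degree (H i) v) - f v\<bar> \<le> (\<Sum>i\<in>S v. \<bar>int (degree (H i) v) - f v\<bar>)" by (rule sum_abs)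
  also have "\<dots> = (\<Sum>i\<in>S v. 1)" by (rule sum.cong) (use pm in force)+
  finally show "\<bar>int (degree G v) - int k * f v\<bar> \<le> int (card (S v))" using E by simp
  have "even (\<Sum>i\<in>S v. (int (degree (H i) v) - f v) + 1)"
  proof (rule dvd_sum)
    fix i assume "i \<in> S v"
    from pm[OF this] show "even ((int (degree (H i) v) - f v) + 1)" by (elim disjE) simp_all
  qed
  then show "even (int (degree G v) - int k * f v + int (card (S v)))" unfolding E by (simp add: sum.distrib)
qed

theorem theorem4p3:
  fixes G :: "('v, 'e) mgraph" and k :: nat and Z :: "'v set" and m :: int and f :: "'v \<Rightarrow> int"
  assumes "k > 0"
    and "multigraph G"
    and "edge_connected (3 * k - 3) G \<or> tree_connected (2 * k - 2) G"
    and "Z \<subseteq> verts G"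
    and "m = (int (card (edges G)) - (\<Sum>v\<in>Z. int (degree G v))) mod int k"
    and "m > 0"
    and "(\<Sum>v\<in>Z. int (degree G v) mod int k)
       + (\<Sum>v\<in>verts G - Z. (int k - int (degree G v)) mod int k) = int k - 2 * m"
    and "\<And>v. v \<in> Z \<Longrightarrow> f v = \<lfloor>real (degree G v) / real k\<rfloor>"
    and "\<And>v. v \<in> verts G - Z \<Longrightarrow> f v = \<lceil>real (degree G v) / real k\<rceil>"
  shows "(\<exists>H. edge_decomposition G k H \<and> (\<forall>i<k. almost_factor G f (H i))) \<and>
    (\<forall>s :: 'v \<Rightarrow> nat.
      (\<exists>H. edge_decomposition G k H \<and> (\<forall>i<k. almost_factor G f (H i)) \<and>
           (\<forall>v\<in>verts G. card {i. i < k \<and> almost_factor_at G f v (H i)} = s v))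
      \<longleftrightarrow>
      (\<forall>v\<in>Z. int (s v) - int (degree G v) mod int k \<ge> 0 \<and>
             even (int (s v) - int (degree G v) mod int k)) \<and>
      (\<forall>v\<in>verts G - Z. int (s v) - (int k - int (degree G v)) mod int k \<ge> 0 \<and>
             even (int (s v) - (int k - int (degree G v)) mod int k)) \<and>
      (\<Sum>v\<in>verts G. s v) = k)"
proof -
  let ?V = "verts G" and ?k = "int k"
  have fin: "finite ?V" "finite Z" "?V \<noteq> {}" using assms(2,4) finite_subset by (auto simp: multigraph_def)
  have "m < ?k" using assms(1,5) by simp
  then have k2: "k \<ge> 2" using assms(6) by linarith
  define r where "r v = (if v \<in> Z then int (degree G v) mod ?k else (?k - int (degree G v)) mod ?k)" for v
  have r0: "0 \<le> r v" for v using assms(1) by (simp add: r_def)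
  have split: "sum g ?V = sum g Z + sum g (?V - Z)" for g :: "'v \<Rightarrow> int"
    using sum.subset_diff[OF assms(4) fin(1), of g] by simp
  have sumr: "sum r ?V = ?k - 2 * m" unfolding split assms(7)[symmetric] by (simp add: r_def)
  have degf: "int (degree G v) = ?k * f v + (if v \<in> Z then r v else - r v)" if "v \<in> ?V" for v
  proof (cases "v \<in> Z")
    case True
    have "f v = int (degree G v) div ?k"
      using assms(8)[OF True] by (simp add: floor_divide_of_nat_eq zdiv_int)
    then show ?thesis using True by (simp add: r_def)
  next
    case False
    have "f v = - (- int (degree G v) div ?k)"
      using assms(9)[of v] False that ceiling_divide_eq_div[of "int (degree G v)" ?k, where 'a = real] by simp
    moreover have "(?k - int (degree G v)) mod ?k = (- int (degree G v)) mod ?k"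
      using mod_add_self1[of ?k "- int (degree G v)"] by simp
    moreover have "- int (degree G v) = ?k * (- int (degree G v) div ?k) + (- int (degree G v)) mod ?k"
      by (rule mult_div_mod_eq[symmetric])
    ultimately have "- int (degree G v) = ?k * (- f v) + r v" using False by (simp only: r_def if_False minus_minus)
    then show ?thesis using False by simp
  qed
  define good where "good s \<longleftrightarrow> (\<forall>v\<in>?V. r v \<le> int (s v) \<and> even (int (s v) - r v)) \<and> (\<Sum>v\<in>?V. s v) = k" for s :: "'v \<Rightarrow> nat"
  have good_iff: "good s \<longleftrightarrow> (\<forall>v\<in>Z. int (s v) - int (degree G v) mod ?k \<ge> 0 \<and>
             even (int (s v) - int (degree G v) mod ?k)) \<and>
      (\<forall>v\<in>?V - Z. int (s v) - (?k - int (degree G v)) mod ?k \<ge> 0 \<and>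
             even (int (s v) - (?k - int (degree G v)) mod ?k)) \<and> (\<Sum>v\<in>?V. s v) = k" for s
  proof -
    have "?V = Z \<union> (?V - Z)" using assms(4) by auto
    then have "(\<forall>v\<in>?V. P v) \<longleftrightarrow> (\<forall>v\<in>Z. P v) \<and> (\<forall>v\<in>?V - Z. P v)" for P by blast
    then show ?thesis unfolding good_def by (simp add: r_def)
  qed
  have suff: "\<exists>H. edge_decomposition G k H \<and> (\<forall>i<k. almost_factor G f (H i)) \<and>
           (\<forall>v\<in>?V. card {i. i < k \<and> almost_factor_at G f v (H i)} = s v)" if good: "good s" for s
  proof -
    have s: "r v \<le> int (s v)" "even (int (s v) - r v)" if "v \<in> ?V" for v using good that by (auto simp: good_def)
    have sk: "(\<Sum>v\<in>?V. s v) = k" using good by (simp add: good_def)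
    \<comment> \<open>The prescribed out-degree \<open>p v\<close> is the number of surpluses at \<open>v\<close>; the other \<open>s v - p v\<close> deviations are deficits.\<close>
    define p where "p v = (if v \<in> Z then (int (s v) + r v) div 2 else (int (s v) - r v) div 2)" for v
    define b where "b v = nat (p v)" for v
    define c where "c v = nat (int (s v) - p v)" for v
    have p2: "2 * p v = int (s v) + (if v \<in> Z then r v else - r v)" if "v \<in> ?V" for v
      using s(2)[OF that] by (auto simp: p_def)
    have p0: "0 \<le> p v" "p v \<le> int (s v)" if "v \<in> ?V" for v
      using p2[OF that] s(1)[OF that] r0[of v] by (auto split: if_splits)
    have bc: "int (b v) = p v" "int (c v) = int (s v) - p v" "b v + c v = s v" if "v \<in> ?V" for v
      using p0[OF that] by (auto simp: b_def c_def)
    \<comment> \<open>Since \<open>m > 0\<close>, the residue \<open>r v\<close> is too small for a surplus of \<open>k\<close>; this makes the required edges leaving \<open>v\<close> available.\<close>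
    have "p v < ?k" if v: "v \<in> ?V" for v
    proof -
      have "r v \<le> ?k - 2 * m" using member_le_sum[OF v, of r] r0 fin(1) sumr by simp
      moreover have "s v \<le> k" using member_le_sum[OF v, of s] fin(1) sk by simp
      ultimately show ?thesis using p2[OF v] r0[of v] assms(6) by (auto split: if_splits)
    qed
    then have bk: "b v < k" if "v \<in> ?V" for v using bc(1)[OF that] that by (metis of_nat_less_iff)
    have "?k dvd (\<Sum>v\<in>?V. p v) - int (card (edges G))"
    proof -
      have "2 * (\<Sum>v\<in>?V. p v) = (\<Sum>v\<in>?V. int (s v) + (if v \<in> Z then r v else - r v))"
        unfolding sum_distrib_left by (rule sum.cong) (use p2 in auto)
      also have "\<dots> = ?k + (\<Sum>v\<in>?V. if v \<in> Z then r v else - r v)"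
        using sk by (simp add: sum.distrib flip: of_nat_sum)
      also have "(\<Sum>v\<in>?V. if v \<in> Z then r v else - r v) = sum r Z - sum r (?V - Z)"
        unfolding split by (simp add: sum_negf)
      finally have "(\<Sum>v\<in>?V. p v) = sum r Z + m" using sumr unfolding split[of r] by linarith
      moreover have "?k dvd sum r Z - (\<Sum>v\<in>Z. int (degree G v))"
      proof -
        have "?k dvd (\<Sum>v\<in>Z. r v - int (degree G v))"
          by (rule dvd_sum) (auto simp: r_def mod_eq_dvd_iff[symmetric])
        then show ?thesis by (simp add: sum_subtractf)
      qed
      moreover have "?k dvd m - (int (card (edges G)) - (\<Sum>v\<in>Z. int (degree G v)))"
        unfolding assms(5) by (simp add: mod_eq_dvd_iff[symmetric])
      ultimately show ?thesis
        using dvd_add[of ?k "sum r Z - (\<Sum>v\<in>Z. int (degree G v))"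
            "m - (int (card (edges G)) - (\<Sum>v\<in>Z. int (degree G v)))"] by (simp add: add_diff_eq)
    qed
    from modulo_orientation[OF assms(2) k2 assms(3) this]
    obtain t h where th: "\<And>e. e \<in> edges G \<Longrightarrow> ends G e = {#t e, h e#}"
      "\<And>v. v \<in> ?V \<Longrightarrow> ?k dvd int (card {e\<in>edges G. t e = v}) - p v"
      by blast
    have "\<exists>H. edge_decomposition G k H \<and> (\<forall>i<k. almost_factor G f (H i)) \<and>
      (\<forall>v\<in>?V. card {i. i < k \<and> almost_factor_at G f v (H i)} = b v + c v)"
    proof (rule decomposition_from_orientation[OF assms(2,1) th(1)])
      fix v assume v: "v \<in> ?V"
      show "?k dvd int (card {e\<in>edges G. t e = v}) - int (b v)" using th(2)[OF v] bc(1)[OF v] by simp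
      show "b v < k" by (rule bk[OF v])
      show "int (degree G v) = ?k * f v + int (b v) - int (c v)"
        using degf[OF v] bc(1,2)[OF v] p2[OF v] by (auto split: if_splits)
    next
      show "(\<Sum>v\<in>?V. b v + c v) = k" using bc(3) sk by simp
    qed
    then show ?thesis using bc(3) by auto
  qed
  have nec: "good s" if H: "edge_decomposition G k H" "\<forall>i<k. almost_factor G f (H i)"
    "\<forall>v\<in>?V. card {i. i < k \<and> almost_factor_at G f v (H i)} = s v" for s H
  proof -
    have H2: "almost_factor G f (H i)" if "i < k" for i using H(2) that by blast
    note C = almost_factor_counts[OF assms(2) H(1) H2]
    have "(\<Sum>v\<in>?V. s v) = k" using C(1) H(3) by simp
    moreover have "r v \<le> int (s v) \<and> even (int (s v) - r v)" if v: "v \<in> ?V" for v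
      using C(2)[OF _ v] C(3)[OF _ v] H(3) v degf[OF v] by (auto split: if_splits)
    ultimately show ?thesis by (simp add: good_def)
  qed
  have ex: "\<exists>s. good s"
  proof -
    obtain z where z: "z \<in> ?V" using fin(3) by auto
    \<comment> \<open>The missing \<open>2 * m\<close> deviations may all be placed at one vertex, as \<open>m\<close> surpluses and \<open>m\<close> deficits.\<close>
    define s where "s v = nat (r v + (if v = z then 2 * m else 0))" for v
    have si: "int (s v) = r v + (if v = z then 2 * m else 0)" for v using r0[of v] assms(6) by (simp add: s_def)
    have "int (\<Sum>v\<in>?V. s v) = ?k" using sumr z fin(1) by (simp add: si sum.distrib)
    then have "(\<Sum>v\<in>?V. s v) = k" by (simp only: of_nat_eq_iff)
    then have "good s" using assms(6) by (simp add: good_def si)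
    then show ?thesis by blast
  qed
  show ?thesis
  proof (intro conjI allI)
    show "\<exists>H. edge_decomposition G k H \<and> (\<forall>i<k. almost_factor G f (H i))" using ex suff by blast
  next
    fix s :: "'v \<Rightarrow> nat"
    show "(\<exists>H. edge_decomposition G k H \<and> (\<forall>i<k. almost_factor G f (H i)) \<and>
           (\<forall>v\<in>verts G. card {i. i < k \<and> almost_factor_at G f v (H i)} = s v))
      \<longleftrightarrow>
      (\<forall>v\<in>Z. int (s v) - int (degree G v) mod int k \<ge> 0 \<and>
             even (int (s v) - int (degree G v) mod int k)) \<and>
      (\<forall>v\<in>verts G - Z. int (s v) - (int k - int (degree G v)) mod int k \<ge> 0 \<and>
             even (int (s v) - (int k - int (degree G v)) mod int k)) \<and>
      (\<Sum>v\<in>verts G. s v) = k"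
      unfolding good_iff[symmetric] using suff nec by blast
  qed
qed

end
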